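(* If $K\subseteq\mathbb R^2$ is a compact convex body such that the topological boundary of $K$ is an ellipse, then $K^{\rm max}$ has Smith-Ward geometry.
   Context: $\mathbb B$ is the C$^*$-algebra of bounded linear operators on $\ell^2(\mathbb N)$ and $\mathbb K$ is the ideal of compact operators. For a $d$-tuple $\mathfrak x$ of elements of a unital C$^*$-algebra, $\mathcal O_{\mathfrak x}=\mathrm{Span}\{1,x_1,x_1^*,\dots,x_d,x_d^*\}$. The matrix range is $W(\mathfrak x)=\bigsqcup_n W_n(\mathfrak x)$, $W_n(\mathfrak x)=\{(\phi(x_1),\dots,\phi(x_d)) : \phi:\mathrm C^*(\mathcal O_{\mathfrak x})\to M_n(\mathbb C)\text{ unital completely positive}\}$. For $\mathfrak x\in\mathbb B^d$, the essential matrix range $W_{\rm e}(\mathfrak x)=\bigsqcup_n W_{n,{\rm e}}(\mathfrak x)$ is defined in the same way but using only those $\phi$ that vanish on every compact operator in $\mathrm C^*(\mathcal O_{\mathfrak x})$; it equals the matrix range of the image of $\mathfrak x$ in $\mathbb B/\mathbb K$. For a compact convex set $K\subseteq\mathbb R^d$, $K^{\rm max}=\bigsqcup_n K_n^{\rm max}$, where $K_n^{\rm max}$ is the set of all $d$-tuples $\mathfrak a$ of $n\times n$ complex matrices with $W_1(\mathfrak a)\subseteq K$ (such matrices are automatically selfadjoint). A tuple $\mathfrak x\in\mathbb B^d$ has the Smith-Ward property if $W_{\rm e}(\mathfrak x)=W(\mathfrak x+\mathfrak k)$ for some $\mathfrak k\in\mathbb K^d$. A compact matrix convex set is a graded set $K_{\rm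 nc}=\bigsqcup_n K_n$, $K_n\subseteq M_n(\mathbb C)^d$ compact, such that $\sum_{j=1}^m\gamma_j^*\mathfrak a_j\gamma_j\in K_n$ whenever $\mathfrak a_j\in K_{n_j}$ and $\gamma_j:\mathbb C^n\to\mathbb C^{n_j}$ are linear with $\sum_j\gamma_j^*\gamma_j=1_n$. It has Smith-Ward geometry if every tuple $\mathfrak x\in\mathbb B^d$ with $W_{\rm e}(\mathfrak x)=K_{\rm nc}$ has the Smith-Ward property. *)

theory Defs
  imports "HOL-Analysis.Analysis" "HOL-Algebra.Module" "Jordan_Normal_Form.Schur_Decomposition"
begin

section \<open>The Hilbert space of square-summable complex sequences\<close>

typedef ell2 = "{x :: nat \<Rightarrow> complex. summable (\<lambda>n. (cmod (x n))\<^sup>2)}"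
  morphisms ell2_nth Abs_ell2
  by (rule exI[of _ "\<lambda>_. 0"]) simp

setup_lifting type_definition_ell2

lemma square_summable_add:
  fixes x y :: "nat \<Rightarrow> complex"
  assumes "summable (\<lambda>n. (cmod (x n))\<^sup>2)" "summable (\<lambda>n. (cmod (y n))\<^sup>2)"
  shows "summable (\<lambda>n. (cmod (x n + y n))\<^sup>2)"
proof (rule summable_comparison_test')
  show "summable (\<lambda>n. 2 * (cmod (x n))\<^sup>2 + 2 * (cmod (y n))\<^sup>2)"
    using assms by (intro summable_add summable_mult)
  fix n :: nat
  have "(cmod (x n + y n))\<^sup>2 \<le> (cmod (x n) + cmod (y n))\<^sup>2"
    by (intro power_mono norm_triangle_ineq) simp
  also have "\<dots> \<le> 2 * (cmod (x n))\<^sup>2 + 2 * (cmod (y n))\<^sup>2"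
    using sum_squares_bound[of "cmod (x n)" "cmod (y n)"] by (simp add: power2_sum)
  finally show "norm ((cmod (x n + y n))\<^sup>2) \<le> 2 * (cmod (x n))\<^sup>2 + 2 * (cmod (y n))\<^sup>2"
    by simp
qed

lemma square_summable_mult:
  fixes x :: "nat \<Rightarrow> complex"
  assumes "summable (\<lambda>n. (cmod (x n))\<^sup>2)"
  shows "summable (\<lambda>n. (cmod (c * x n))\<^sup>2)"
  using summable_mult[OF assms, of "(cmod c)\<^sup>2"] by (simp add: norm_mult power_mult_distrib)

lemma square_summable_inner:
  fixes x y :: "nat \<Rightarrow> complex"
  assumes "summable (\<lambda>n. (cmod (x n))\<^sup>2)" "summable (\<lambda>n. (cmod (y n))\<^sup>2)"
  shows "summable (\<lambda>n. cnj (x n) * y n)"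
proof (rule summable_comparison_test')
  show "summable (\<lambda>n. (cmod (x n))\<^sup>2 + (cmod (y n))\<^sup>2)"
    using assms by (intro summable_add)
  fix n :: nat
  have "cmod (x n) * cmod (y n) \<le> 2 * cmod (x n) * cmod (y n)" by simp
  also have "\<dots> \<le> (cmod (x n))\<^sup>2 + (cmod (y n))\<^sup>2" by (rule sum_squares_bound)
  finally show "norm (cnj (x n) * y n) \<le> (cmod (x n))\<^sup>2 + (cmod (y n))\<^sup>2"
    by (simp add: norm_mult)
qed

lift_definition scaleC_ell2 :: "complex \<Rightarrow> ell2 \<Rightarrow> ell2" is "\<lambda>c x n. c * x n"
  by (rule square_summable_mult)

lift_definition cinner_ell2 :: "ell2 \<Rightarrow> ell2 \<Rightarrow> complex" is "\<lambda>x y. \<Sum>n. cnj (x n) * y n" .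

instantiation ell2 :: real_inner
begin

lift_definition zero_ell2 :: ell2 is "\<lambda>_. 0" by simp
lift_definition plus_ell2 :: "ell2 \<Rightarrow> ell2 \<Rightarrow> ell2" is "\<lambda>x y n. x n + y n"
  by (rule square_summable_add)
lift_definition uminus_ell2 :: "ell2 \<Rightarrow> ell2" is "\<lambda>x n. - x n" by simp
definition minus_ell2 :: "ell2 \<Rightarrow> ell2 \<Rightarrow> ell2" where "minus_ell2 x y = x + - y"
definition scaleR_ell2 :: "real \<Rightarrow> ell2 \<Rightarrow> ell2"
  where "scaleR_ell2 r = scaleC_ell2 (complex_of_real r)"
definition inner_ell2 :: "ell2 \<Rightarrow> ell2 \<Rightarrow> real" where "inner_ell2 x y = Re (cinner_ell2 x y)"
definition norm_ell2 :: "ell2 \<Rightarrow> real" where "norm_ell2 x = sqrt (inner x x)"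
definition dist_ell2 :: "ell2 \<Rightarrow> ell2 \<Rightarrow> real" where "dist_ell2 x y = norm (x - y)"
definition sgn_ell2 :: "ell2 \<Rightarrow> ell2" where "sgn_ell2 x = inverse (norm x) *\<^sub>R x"
definition uniformity_ell2 :: "(ell2 \<times> ell2) filter"
  where "uniformity_ell2 = (INF e\<in>{0<..}. principal {(x, y). dist x y < e})"
definition open_ell2 :: "ell2 set \<Rightarrow> bool"
  where "open_ell2 U \<longleftrightarrow> (\<forall>x\<in>U. \<forall>\<^sub>F (x', y) in uniformity. x' = x \<longrightarrow> y \<in> U)"

instance
proof
  fix x y z :: ell2 and r s :: real
  show "x + y + z = x + (y + z)" by transfer (simp add: add.assoc)
  show "x + y = y + x" by transfer (simp add: add.commute)
  show "0 + x = x" by transfer simp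
  show "- x + x = 0" by transfer simp
  show "x - y = x + - y" by (rule minus_ell2_def)
  show "r *\<^sub>R (x + y) = r *\<^sub>R x + r *\<^sub>R y"
    unfolding scaleR_ell2_def by transfer (simp add: algebra_simps)
  show "(r + s) *\<^sub>R x = r *\<^sub>R x + s *\<^sub>R x"
    unfolding scaleR_ell2_def by transfer (simp add: algebra_simps)
  show "r *\<^sub>R s *\<^sub>R x = (r * s) *\<^sub>R x"
    unfolding scaleR_ell2_def by transfer (simp add: algebra_simps)
  show "1 *\<^sub>R x = x"
    unfolding scaleR_ell2_def by transfer simp
  show "dist x y = norm (x - y)" by (rule dist_ell2_def)
  show "sgn x = inverse (norm x) *\<^sub>R x" by (rule sgn_ell2_def)
  show "uniformity = (INF e\<in>{0<..}. principal {(x, y :: ell2). dist x y < e})"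
    by (rule uniformity_ell2_def)
  show "open U = (\<forall>x\<in>U. \<forall>\<^sub>F (x', y) in uniformity. x' = x \<longrightarrow> y \<in> U)" for U :: "ell2 set"
    by (rule open_ell2_def)
  have re: "inner u v = (\<Sum>n. Re (cnj (ell2_nth u n) * ell2_nth v n))"
    and sm: "summable (\<lambda>n. Re (cnj (ell2_nth u n) * ell2_nth v n))" for u v :: ell2
  proof -
    have "summable (\<lambda>n. cnj (ell2_nth u n) * ell2_nth v n)"
      using square_summable_inner ell2_nth[of u] ell2_nth[of v] by simp
    then show "inner u v = (\<Sum>n. Re (cnj (ell2_nth u n) * ell2_nth v n))"
      "summable (\<lambda>n. Re (cnj (ell2_nth u n) * ell2_nth v n))"
      unfolding inner_ell2_def cinner_ell2.rep_eq
      by (simp_all add: Re_suminf summable_Re del: complex_cnj_mult times_complex.simps)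
  qed
  show "inner x y = inner y x"
    unfolding re by (intro suminf_cong) (simp add: mult.commute)
  show "inner (x + y) z = inner x z + inner y z"
    unfolding re plus_ell2.rep_eq
    by (subst suminf_add[OF sm sm]) (intro suminf_cong, simp add: algebra_simps)
  show "inner (r *\<^sub>R x) y = r * inner x y"
    unfolding re scaleR_ell2_def scaleC_ell2.rep_eq
    by (subst suminf_mult[OF sm, symmetric]) (intro suminf_cong, simp add: algebra_simps)
  have sq: "Re (cnj w * w) = (cmod w)\<^sup>2" for w
    unfolding cmod_power2 by (simp add: power2_eq_square)
  have smx: "summable (\<lambda>n. (cmod (ell2_nth x n))\<^sup>2)" using ell2_nth[of x] by simp
  have ixx: "inner x x = (\<Sum>n. (cmod (ell2_nth x n))\<^sup>2)" unfolding re sq ..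
  show "0 \<le> inner x x" unfolding ixx by (intro suminf_nonneg smx) simp
  have "inner x x = 0 \<longleftrightarrow> (\<forall>n. ell2_nth x n = 0)"
    unfolding ixx using suminf_eq_zero_iff[OF smx] by simp
  also have "\<dots> \<longleftrightarrow> x = 0" by transfer auto
  finally show "inner x x = 0 \<longleftrightarrow> x = 0" .
  show "norm x = sqrt (inner x x)" by (rule norm_ell2_def)
qed

end

section \<open>Unital C*-algebras given by a carrier and operations\<close>

record 'a star_algebra = "(complex, 'a) module" +
  adj :: "'a \<Rightarrow> 'a"
  nrm :: "'a \<Rightarrow> real"

text \<open>The algebra of bounded complex-linear operators on the Hilbert space above.  The type
  of continuous real-linear maps provides the operator norm; the carrier cuts out the
  complex-linear ones.\<close>

definition clinear_ell2 :: "(ell2 \<Rightarrow>\<^sub>L ell2) \<Rightarrow> bool" where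
  "clinear_ell2 T \<longleftrightarrow>
    (\<forall>c v. blinfun_apply T (scaleC_ell2 c v) = scaleC_ell2 c (blinfun_apply T v))"

definition adj_op :: "(ell2 \<Rightarrow>\<^sub>L ell2) \<Rightarrow> (ell2 \<Rightarrow>\<^sub>L ell2)" where
  "adj_op T = (THE S. \<forall>u v. cinner_ell2 (blinfun_apply S u) v = cinner_ell2 u (blinfun_apply T v))"

definition bounded_ops :: "(ell2 \<Rightarrow>\<^sub>L ell2) star_algebra" where
  "bounded_ops = \<lparr>
     carrier = {T. clinear_ell2 T},
     mult = (\<lambda>S T. S o\<^sub>L T),
     one = id_blinfun,
     zero = 0,
     add = (+),
     smult = (\<lambda>c T. Blinfun (\<lambda>v. scaleC_ell2 c (blinfun_apply T v))),
     adj = adj_op,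
     nrm = norm\<rparr>"

definition compact_ops :: "(ell2 \<Rightarrow>\<^sub>L ell2) set" where
  "compact_ops = {T \<in> carrier bounded_ops. compact (closure (blinfun_apply T ` cball 0 1))}"

definition vec_norm2 :: "complex vec \<Rightarrow> real" where
  "vec_norm2 v = sqrt (\<Sum>i<dim_vec v. (cmod (vec_index v i))\<^sup>2)"

definition matrix_alg :: "nat \<Rightarrow> complex mat star_algebra" where
  "matrix_alg n = \<lparr>
     carrier = carrier_mat n n,
     mult = (*),
     one = 1\<^sub>m n,
     zero = 0\<^sub>m n n,
     add = (+),
     smult = (\<cdot>\<^sub>m),
     adj = mat_adjoint,
     nrm = (\<lambda>a. SUP v\<in>{v \<in> carrier_vec n. vec_norm2 v \<le> 1}. vec_norm2 (a *\<^sub>v v))\<rparr>"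

definition cstar_subalgebra :: "'a set \<Rightarrow> 'a star_algebra \<Rightarrow> bool" where
  "cstar_subalgebra B A \<longleftrightarrow>
     B \<subseteq> carrier A \<and> \<zero>\<^bsub>A\<^esub> \<in> B \<and>
     (\<forall>a\<in>B. \<forall>b\<in>B. a \<oplus>\<^bsub>A\<^esub> b \<in> B \<and> a \<otimes>\<^bsub>A\<^esub> b \<in> B) \<and>
     (\<forall>a\<in>B. adj A a \<in> B \<and> (\<forall>c. c \<odot>\<^bsub>A\<^esub> a \<in> B)) \<and>
     (\<forall>f a. (\<forall>i::nat. f i \<in> B) \<and> a \<in> carrier A \<and>
        (\<lambda>i. nrm A (f i \<ominus>\<^bsub>A\<^esub> a)) \<longlonglongrightarrow> 0 \<longrightarrow> a \<in> B)"

definition op_system :: "'a star_algebra \<Rightarrow> ('d::finite \<Rightarrow> 'a) \<Rightarrow> 'a set" where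
  "op_system A x =
     {(c \<odot>\<^bsub>A\<^esub> \<one>\<^bsub>A\<^esub>) \<oplus>\<^bsub>A\<^esub>
        (\<Oplus>\<^bsub>A\<^esub>k\<in>UNIV. (\<alpha> k \<odot>\<^bsub>A\<^esub> x k) \<oplus>\<^bsub>A\<^esub> (\<beta> k \<odot>\<^bsub>A\<^esub> adj A (x k))) | c \<alpha> \<beta>. True}"

definition cstar_gen :: "'a star_algebra \<Rightarrow> 'a set \<Rightarrow> 'a star_algebra" where
  "cstar_gen A S = A\<lparr>carrier := \<Inter>{B. cstar_subalgebra B A \<and> S \<subseteq> B}\<rparr>"

section \<open>Unital completely positive maps\<close>

text \<open>An element of the C*-algebra of m by m matrices over A is positive iff it has the form
  b* b for a matrix b over A.\<close>

definition positive_matrix :: "'a star_algebra \<Rightarrow> nat \<Rightarrow> (nat \<Rightarrow> nat \<Rightarrow> 'a) \<Rightarrow> bool" where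
  "positive_matrix A m a \<longleftrightarrow>
     (\<exists>b. (\<forall>i<m. \<forall>j<m. b i j \<in> carrier A) \<and>
          (\<forall>i<m. \<forall>j<m. a i j = (\<Oplus>\<^bsub>A\<^esub>k\<in>{..<m}. adj A (b k i) \<otimes>\<^bsub>A\<^esub> b k j)))"

definition linear_maps :: "'a star_algebra \<Rightarrow> 'b star_algebra \<Rightarrow> ('a \<Rightarrow> 'b) set" where
  "linear_maps A B =
     {\<phi> \<in> carrier A \<rightarrow> carrier B.
        (\<forall>a\<in>carrier A. \<forall>b\<in>carrier A. \<phi> (a \<oplus>\<^bsub>A\<^esub> b) = \<phi> a \<oplus>\<^bsub>B\<^esub> \<phi> b) \<and>
        (\<forall>c. \<forall>a\<in>carrier A. \<phi> (c \<odot>\<^bsub>A\<^esub> a) = c \<odot>\<^bsub>B\<^esub> \<phi> a)}"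

definition completely_positive :: "'a star_algebra \<Rightarrow> 'b star_algebra \<Rightarrow> ('a \<Rightarrow> 'b) \<Rightarrow> bool" where
  "completely_positive A B \<phi> \<longleftrightarrow>
     (\<forall>m a. positive_matrix A m a \<longrightarrow> positive_matrix B m (\<lambda>i j. \<phi> (a i j)))"

definition ucp_maps :: "'a star_algebra \<Rightarrow> 'b star_algebra \<Rightarrow> ('a \<Rightarrow> 'b) set" where
  "ucp_maps A B = {\<phi> \<in> linear_maps A B. \<phi> \<one>\<^bsub>A\<^esub> = \<one>\<^bsub>B\<^esub> \<and> completely_positive A B \<phi>}"

section \<open>Matrix ranges\<close>

text \<open>A graded set is a disjoint union over the matrix sizes n \<open>\<ge>\<close> 1, encoded as a set of pairs
  of a size n and a tuple of n by n matrices; its n-th level is the image of {n}.\<close>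

type_synonym 'd graded_set = "(nat \<times> ('d \<Rightarrow> complex mat)) set"

definition matrix_range_level ::
    "nat \<Rightarrow> 'a star_algebra \<Rightarrow> ('d::finite \<Rightarrow> 'a) \<Rightarrow> ('d \<Rightarrow> complex mat) set" where
  "matrix_range_level n A x =
     {(\<lambda>k. \<phi> (x k)) | \<phi>. \<phi> \<in> ucp_maps (cstar_gen A (op_system A x)) (matrix_alg n)}"

definition matrix_range :: "'a star_algebra \<Rightarrow> ('d::finite \<Rightarrow> 'a) \<Rightarrow> 'd graded_set" where
  "matrix_range A x = (SIGMA n:{1..}. matrix_range_level n A x)"

definition ess_matrix_range_level ::
    "nat \<Rightarrow> ('d::finite \<Rightarrow> (ell2 \<Rightarrow>\<^sub>L ell2)) \<Rightarrow> ('d \<Rightarrow> complex mat) set" where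
  "ess_matrix_range_level n x =
     (let C = cstar_gen bounded_ops (op_system bounded_ops x) in
      {(\<lambda>k. \<phi> (x k)) | \<phi>. \<phi> \<in> ucp_maps C (matrix_alg n) \<and>
         (\<forall>T \<in> carrier C \<inter> compact_ops. \<phi> T = \<zero>\<^bsub>matrix_alg n\<^esub>)})"

definition ess_matrix_range :: "('d::finite \<Rightarrow> (ell2 \<Rightarrow>\<^sub>L ell2)) \<Rightarrow> 'd graded_set" where
  "ess_matrix_range x = (SIGMA n:{1..}. ess_matrix_range_level n x)"

definition real_point :: "real ^ 'd \<Rightarrow> 'd \<Rightarrow> complex mat" where
  "real_point p = (\<lambda>k. mat 1 1 (\<lambda>_. complex_of_real (vec_nth p k)))"

definition max_matrix_set :: "(real ^ 'd::finite) set \<Rightarrow> 'd graded_set" where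
  "max_matrix_set K =
     (SIGMA n:{1..}. {a. (\<forall>k. a k \<in> carrier_mat n n) \<and>
        matrix_range_level 1 (matrix_alg n) a \<subseteq> real_point ` K})"

section \<open>Compact matrix convex sets and Smith-Ward geometry\<close>

text \<open>The type of matrices carries no topology, so compactness of a set of tuples is expressed
  through the entries, in the product topology.\<close>

definition mat_entries :: "nat \<Rightarrow> ('d \<Rightarrow> complex mat) \<Rightarrow> 'd \<Rightarrow> nat \<times> nat \<Rightarrow> complex" where
  "mat_entries n a = (\<lambda>k (i, j). if i < n \<and> j < n then a k $$ (i, j) else 0)"

definition compact_matrix_convex :: "'d graded_set \<Rightarrow> bool" where
  "compact_matrix_convex K \<longleftrightarrow>
     K \<subseteq> (SIGMA n:{1..}. {a. \<forall>k. a k \<in> carrier_mat n n}) \<and>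
     (\<forall>n\<ge>1. compact (mat_entries n ` (K `` {n}))) \<and>
     (\<forall>n (m::nat) N a \<gamma>. n \<ge> 1 \<and>
        (\<forall>j<m. (N j, a j) \<in> K \<and> \<gamma> j \<in> carrier_mat (N j) n) \<and>
        (\<Oplus>\<^bsub>matrix_alg n\<^esub>j\<in>{..<m}. mat_adjoint (\<gamma> j) * \<gamma> j) = 1\<^sub>m n \<longrightarrow>
        (n, \<lambda>k. \<Oplus>\<^bsub>matrix_alg n\<^esub>j\<in>{..<m}. mat_adjoint (\<gamma> j) * a j k * \<gamma> j) \<in> K)"

definition smith_ward_property :: "('d::finite \<Rightarrow> (ell2 \<Rightarrow>\<^sub>L ell2)) \<Rightarrow> bool" where
  "smith_ward_property x \<longleftrightarrow>
     (\<exists>\<kappa>. (\<forall>i. \<kappa> i \<in> compact_ops) \<and>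
        ess_matrix_range x = matrix_range bounded_ops (\<lambda>i. x i + \<kappa> i))"

definition smith_ward_geometry :: "'d::finite graded_set \<Rightarrow> bool" where
  "smith_ward_geometry K \<longleftrightarrow> compact_matrix_convex K \<and>
     (\<forall>x. (\<forall>i. x i \<in> carrier bounded_ops) \<and> ess_matrix_range x = K \<longrightarrow> smith_ward_property x)"

section \<open>Ellipses\<close>

definition ellipse :: "(real ^ 2) set \<Rightarrow> bool" where
  "ellipse E \<longleftrightarrow>
     (\<exists>c u v a b. norm u = 1 \<and> norm v = 1 \<and> inner u v = 0 \<and> 0 < a \<and> 0 < b \<and>
        E = {p. (inner (p - c) u / a)\<^sup>2 + (inner (p - c) v / b)\<^sup>2 = 1})"

end

theory Submission
  imports Defs
begin

text \<open>
A tuple \<open>a\<close> of matrices lies in the maximal matrix convex set of \<open>K\<close> iff its joint numerical range lies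
in \<open>K\<close>.  Let the essential matrix range of \<open>x\<close> be this set.  Limits of vector states along unit
vectors supported in \<open>[N, \<infinity>)\<close>, \<open>N \<rightarrow> \<infinity>\<close>, belong to the essential range, so \<open>x\<close> is selfadjoint
modulo compacts and the joint numerical range of its compression to \<open>[N, \<infinity>)\<close> is eventually
contained in \<open>(1 + e) K\<close>, where 0 is taken to be an interior point of \<open>K\<close>.  Choose
\<open>g\<^sup>2 + h\<^sup>2 = 1\<close> diagonal and slowly varying, with \<open>g\<close> finitely supported and \<open>h\<close> supported far out.
If the numerical range of \<open>T\<close> lies in \<open>(1 + e) K\<close>, then that of \<open>g T g / (1 + e) + h T h\<close> lies in
\<open>(1 + e / 2) K\<close>, and the correction is of finite rank and of norm \<open>O(e)\<close>.  Iteration produces a compact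
\<open>k\<close> such that the joint numerical range of \<open>x + k\<close>, hence its matrix range, is inside \<open>K\<close>, respectively
its maximal matrix convex set.  Conversely a unital completely positive map vanishing on compacts
extends continuously along compact perturbations, so the matrix range of \<open>x + k\<close> contains the
essential one.
\<close>

section \<open>Square-summable sequences\<close>

text \<open>Membership in \<open>K\<close> is tested by half-spaces, so every bound on a joint
  numerical range becomes a family of quadratic form inequalities indexed by a polar set; such
  inequalities survive sums of compressions and norm limits. An error e costs a correction of norm
  at most a constant times e. Halving e makes the corrections summable, and the constant stays fixed
  because the form inequalities themselves bound the norms of all iterates. Two obstacles shape the
  rest. Positivity over a generated C*-algebra is by definition a factorization inside that algebra,
  so square roots have to be found there; a quadratic iteration produces them from polynomials and
  limits. Also, C*(x) and C*(x + k) need not contain each other, so a map on one cannot simply be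
  restricted to the other. The extension becomes possible through an estimate: a state of C*(x) that
  vanishes on the compact elements of C*(x) is bounded at z by the distance of z to all compact
  operators, including those outside C*(x).\<close>

lemma ell2_summable_norm: "summable (\<lambda>n. (cmod (ell2_nth x n))\<^sup>2)"
  using ell2_nth[of x] by simp

lemma ell2_summable_cinner: "summable (\<lambda>n. cnj (ell2_nth x n) * ell2_nth y n)"
  using square_summable_inner ell2_summable_norm by blast

lemma ell2_eqI: "(\<And>n. ell2_nth x n = ell2_nth y n) \<Longrightarrow> x = y"
  by (metis ell2_nth_inject ext)

lemma minus_ell2_nth: "ell2_nth (x - y) n = ell2_nth x n - ell2_nth y n"
  unfolding minus_ell2_def plus_ell2.rep_eq uminus_ell2.rep_eq by simp

lemma scaleR_ell2_nth: "ell2_nth (r *\<^sub>R x) n = complex_of_real r * ell2_nth x n"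
  unfolding scaleR_ell2_def scaleC_ell2.rep_eq by simp

lemmas ell2_nth_simps = plus_ell2.rep_eq uminus_ell2.rep_eq zero_ell2.rep_eq minus_ell2_nth
  scaleR_ell2_nth scaleC_ell2.rep_eq

lemma cinner_add_left: "cinner_ell2 (x + y) z = cinner_ell2 x z + cinner_ell2 y z"
  unfolding cinner_ell2.rep_eq
  by (subst suminf_add[OF ell2_summable_cinner ell2_summable_cinner])
    (simp add: ell2_nth_simps algebra_simps)

lemma cinner_commute: "cinner_ell2 y x = cnj (cinner_ell2 x y)"
  unfolding cinner_ell2.rep_eq
  using sums_unique[OF sums_cnj[THEN iffD2, OF summable_sums[OF ell2_summable_cinner[of x y]]]]
  by (simp add: mult.commute)

lemma cinner_scaleC_right: "cinner_ell2 x (scaleC_ell2 c y) = c * cinner_ell2 x y"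
  unfolding cinner_ell2.rep_eq
  by (subst suminf_mult[OF ell2_summable_cinner, symmetric])
    (simp add: ell2_nth_simps algebra_simps)

lemma cinner_scaleC_left: "cinner_ell2 (scaleC_ell2 c x) y = cnj c * cinner_ell2 x y"
  by (metis cinner_commute cinner_scaleC_right complex_cnj_cnj complex_cnj_mult)

lemma cinner_add_right: "cinner_ell2 x (y + z) = cinner_ell2 x y + cinner_ell2 x z"
  by (metis cinner_commute cinner_add_left complex_cnj_add)

lemma scaleR_eq_scaleC: "r *\<^sub>R x = scaleC_ell2 (complex_of_real r) x"
  unfolding scaleR_ell2_def ..

lemma scaleC_simps:
  "scaleC_ell2 c (x + y) = scaleC_ell2 c x + scaleC_ell2 c y"
  "scaleC_ell2 c (x - y) = scaleC_ell2 c x - scaleC_ell2 c y"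
  "scaleC_ell2 (c + d) x = scaleC_ell2 c x + scaleC_ell2 d x"
  "scaleC_ell2 c (scaleC_ell2 d x) = scaleC_ell2 (c * d) x"
  "scaleC_ell2 1 x = x" "scaleC_ell2 0 x = 0" "scaleC_ell2 c 0 = 0" "scaleC_ell2 (-1) x = - x"
  by (rule ell2_eqI, simp add: ell2_nth_simps algebra_simps)+

lemma minus_eq_scaleC: "x - y = x + scaleC_ell2 (-1) (y::ell2)"
  by (simp add: scaleC_simps)

lemma cinner_diff_left: "cinner_ell2 (x - y) z = cinner_ell2 x z - cinner_ell2 y z"
  unfolding minus_eq_scaleC cinner_add_left cinner_scaleC_left by simp

lemma cinner_diff_right: "cinner_ell2 x (y - z) = cinner_ell2 x y - cinner_ell2 x z"
  unfolding minus_eq_scaleC cinner_add_right cinner_scaleC_right by simp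

lemma cinner_scaleR_left: "cinner_ell2 (r *\<^sub>R x) y = complex_of_real r * cinner_ell2 x y"
  unfolding scaleR_eq_scaleC cinner_scaleC_left by simp

lemma cinner_scaleR_right: "cinner_ell2 x (r *\<^sub>R y) = complex_of_real r * cinner_ell2 x y"
  unfolding scaleR_eq_scaleC cinner_scaleC_right by simp

lemma cinner_zero: "cinner_ell2 0 x = 0" "cinner_ell2 x 0 = 0"
  by (simp_all add: cinner_ell2.rep_eq zero_ell2.rep_eq)

lemma cinner_sum_left: "cinner_ell2 (\<Sum>i\<in>I. f i) x = (\<Sum>i\<in>I. cinner_ell2 (f i) x)"
  by (induction I rule: infinite_finite_induct) (simp_all add: cinner_zero cinner_add_left)

lemma cinner_sum_right: "cinner_ell2 x (\<Sum>i\<in>I. f i) = (\<Sum>i\<in>I. cinner_ell2 x (f i))"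
  by (induction I rule: infinite_finite_induct) (simp_all add: cinner_zero cinner_add_right)

lemma norm_ell2_square: "(norm x)\<^sup>2 = (\<Sum>n. (cmod (ell2_nth x n))\<^sup>2)"
proof -
  have "(norm x)\<^sup>2 = Re (cinner_ell2 x x)" by (simp add: power2_norm_eq_inner inner_ell2_def)
  also have "\<dots> = (\<Sum>n. (cmod (ell2_nth x n))\<^sup>2)"
    unfolding cinner_ell2.rep_eq Re_suminf[OF ell2_summable_cinner]
    by (intro suminf_cong, unfold cmod_power2) (simp add: power2_eq_square)
  finally show ?thesis .
qed

lemma cinner_self: "cinner_ell2 x x = complex_of_real ((norm x)\<^sup>2)"
proof (rule complex_eqI)
  show "Re (cinner_ell2 x x) = Re (complex_of_real ((norm x)\<^sup>2))"
    by (simp add: power2_norm_eq_inner inner_ell2_def)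
  have "cinner_ell2 x x = cnj (cinner_ell2 x x)" by (rule cinner_commute)
  then have "Im (cinner_ell2 x x) = - Im (cinner_ell2 x x)"
    by (metis cnj.simps(2))
  then show "Im (cinner_ell2 x x) = Im (complex_of_real ((norm x)\<^sup>2))" by simp
qed

lemma norm_scaleC: "norm (scaleC_ell2 c x) = cmod c * norm x"
proof -
  have "(norm (scaleC_ell2 c x))\<^sup>2 = (cmod c * norm x)\<^sup>2"
    unfolding norm_ell2_square power_mult_distrib
    by (subst suminf_mult[OF ell2_summable_norm, symmetric])
      (simp add: ell2_nth_simps norm_mult power_mult_distrib)
  then show ?thesis by (simp add: power2_eq_iff_nonneg)
qed

text \<open>Rotating \<open>x\<close> by the phase of the inner product makes that product real and
  equal to its modulus, so that the Cauchy-Schwarz inequality of the underlying real inner product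
  applies.\<close>

lemma cmod_cinner_le: "cmod (cinner_ell2 x y) \<le> norm x * norm y"
proof (cases "cinner_ell2 x y = 0")
  case False
  define c where "c = sgn (cinner_ell2 x y)"
  have c: "cmod c = 1" using False by (simp add: c_def norm_sgn)
  have "complex_of_real (cmod (cinner_ell2 x y)) = cnj c * cinner_ell2 x y"
  proof -
    have "cnj c * cinner_ell2 x y
        = complex_of_real ((cmod (cinner_ell2 x y))\<^sup>2) / complex_of_real (cmod (cinner_ell2 x y))"
      unfolding complex_norm_square c_def sgn_eq by (simp add: mult.commute)
    also have "\<dots> = complex_of_real (cmod (cinner_ell2 x y))"
      using False by (simp add: power2_eq_square)
    finally show ?thesis by simp
  qed
  also have "\<dots> = cinner_ell2 (scaleC_ell2 c x) y" by (simp add: cinner_scaleC_left)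
  finally have "cmod (cinner_ell2 x y) = inner (scaleC_ell2 c x) y"
    unfolding inner_ell2_def by (metis Re_complex_of_real)
  also have "\<dots> \<le> norm (scaleC_ell2 c x) * norm y" by (rule norm_cauchy_schwarz)
  finally show ?thesis by (simp add: norm_scaleC c)
qed simp

lemma bounded_linear_cinner_right: "bounded_linear (cinner_ell2 x)"
  by (rule bounded_linear_intro[where K = "norm x"])
    (simp_all add: cinner_add_right cinner_scaleR_right scaleR_conv_of_real
      cmod_cinner_le mult.commute[of _ "norm x"])

lemma bounded_linear_cinner_left: "bounded_linear (\<lambda>x. cinner_ell2 x y)"
  by (rule bounded_linear_intro[where K = "norm y"])
    (simp_all add: cinner_add_left cinner_scaleR_left scaleR_conv_of_real cmod_cinner_le)

lemma cmod_ell2_nth_le: "cmod (ell2_nth x n) \<le> norm x"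
proof -
  have "(\<Sum>i\<in>{n}. (cmod (ell2_nth x i))\<^sup>2) \<le> (norm x)\<^sup>2"
    unfolding norm_ell2_square by (rule sum_le_suminf[OF ell2_summable_norm]) auto
  then have "(cmod (ell2_nth x n))\<^sup>2 \<le> (norm x)\<^sup>2" by simp
  then show ?thesis by (rule power2_le_imp_le) simp
qed

text \<open>Builds vectors from coordinates: a uniform bound on partial sums gives square
  summability and the norm estimate together. Completeness and the existence of adjoints rest on
  it.\<close>

lemma ell2_bound:
  assumes "\<And>M. (\<Sum>n<M. (cmod (f n))\<^sup>2) \<le> b\<^sup>2" "0 \<le> b"
  obtains x where "ell2_nth x = f" "norm x \<le> b"
proof -
  have s: "summable (\<lambda>n. (cmod (f n))\<^sup>2)"
    by (rule summableI_nonneg_bounded[OF _ assms(1)]) simp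
  then have x: "ell2_nth (Abs_ell2 f) = f" by (simp add: Abs_ell2_inverse)
  moreover have "(norm (Abs_ell2 f))\<^sup>2 \<le> b\<^sup>2"
    unfolding norm_ell2_square x by (rule suminf_le_const[OF s assms(1)])
  ultimately show ?thesis using that assms(2) power2_le_imp_le by blast
qed

instance ell2 :: banach
proof
  fix X :: "nat \<Rightarrow> ell2"
  assume X: "Cauchy X"
  have "Cauchy (\<lambda>k. ell2_nth (X k) n)" for n
  proof (rule CauchyI)
    fix e :: real assume "0 < e"
    then obtain M where "\<forall>m\<ge>M. \<forall>k\<ge>M. norm (X m - X k) < e" using X CauchyD by blast
    then show "\<exists>M. \<forall>m\<ge>M. \<forall>k\<ge>M. norm (ell2_nth (X m) n - ell2_nth (X k) n) < e"
      by (metis cmod_ell2_nth_le minus_ell2_nth le_less_trans)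
  qed
  then have "\<exists>l. (\<lambda>k. ell2_nth (X k) n) \<longlonglongrightarrow> l" for n
    using Cauchy_convergent convergent_def by blast
  then obtain f where f: "\<And>n. (\<lambda>k. ell2_nth (X k) n) \<longlonglongrightarrow> f n" by metis
  \<comment> \<open>The coordinatewise limit \<open>f\<close> is not yet known to be square
    summable, but its difference from \<open>X m\<close> is, by passing to the limit in finite
    partial sums. Afterwards \<open>f\<close> is recovered by subtracting such a difference from one
    \<open>X M\<close>.\<close>
  have main: "\<exists>M. \<forall>m\<ge>M. \<exists>z. ell2_nth z = (\<lambda>n. ell2_nth (X m) n - f n) \<and> norm z \<le> e"
    if e: "0 < e" for e
  proof -
    obtain M where M: "\<And>m k. m \<ge> M \<Longrightarrow> k \<ge> M \<Longrightarrow> norm (X m - X k) < e"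
      using X CauchyD e by blast
    have "\<exists>z. ell2_nth z = (\<lambda>n. ell2_nth (X m) n - f n) \<and> norm z \<le> e" if m: "m \<ge> M" for m
    proof -
      have "(\<Sum>n<L. (cmod (ell2_nth (X m) n - f n))\<^sup>2) \<le> e\<^sup>2" for L
      proof (rule tendsto_upperbound)
        show "(\<lambda>k. \<Sum>n<L. (cmod (ell2_nth (X m) n - ell2_nth (X k) n))\<^sup>2) \<longlonglongrightarrow>
            (\<Sum>n<L. (cmod (ell2_nth (X m) n - f n))\<^sup>2)"
          by (intro tendsto_intros f)
        have "(\<Sum>n<L. (cmod (ell2_nth (X m) n - ell2_nth (X k) n))\<^sup>2) \<le> e\<^sup>2" if k: "k \<ge> M" for k
        proof -
          have "(\<Sum>n<L. (cmod (ell2_nth (X m) n - ell2_nth (X k) n))\<^sup>2) \<le> (norm (X m - X k))\<^sup>2"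
            unfolding norm_ell2_square minus_ell2_nth[symmetric]
            by (rule sum_le_suminf[OF ell2_summable_norm]) auto
          also have "\<dots> \<le> e\<^sup>2" using M[OF m k] by (intro power_mono) auto
          finally show ?thesis .
        qed
        then show "\<forall>\<^sub>F k in sequentially. (\<Sum>n<L. (cmod (ell2_nth (X m) n - ell2_nth (X k) n))\<^sup>2) \<le> e\<^sup>2"
          using eventually_sequentially by blast
      qed simp
      from ell2_bound[OF this] e show ?thesis by (metis less_eq_real_def)
    qed
    then show ?thesis by blast
  qed
  obtain M z where "ell2_nth z = (\<lambda>n. ell2_nth (X M) n - f n)" using main[of 1] by force
  then have x: "ell2_nth (X M - z) = f" by (simp add: fun_eq_iff minus_ell2_nth)
  have "X \<longlonglongrightarrow> X M - z"
  proof (rule LIMSEQ_I)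
    fix e :: real assume "0 < e"
    then obtain N where N: "\<And>m. m \<ge> N \<Longrightarrow> \<exists>z. ell2_nth z = (\<lambda>n. ell2_nth (X m) n - f n) \<and> norm z \<le> e/2"
      using main[of "e/2"] by auto
    have "norm (X m - (X M - z)) < e" if m: "m \<ge> N" for m
    proof -
      obtain w where w: "ell2_nth w = (\<lambda>n. ell2_nth (X m) n - f n)" "norm w \<le> e/2" using N[OF m] by blast
      have "X m - (X M - z) = w" by (rule ell2_eqI) (simp only: minus_ell2_nth[of "X m"] x w)
      then show ?thesis using w \<open>0 < e\<close> by simp
    qed
    then show "\<exists>N. \<forall>m\<ge>N. norm (X m - (X M - z)) < e" by blast
  qed
  then show "convergent X" by (auto simp: convergent_def)
qed

subsection \<open>Diagonal operators\<close>

text \<open>The guard sends symbols not bounded by 1 to the zero map, which makes the definition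
  total. The symbols that occur are 0-1 sequences, cosines and sines.\<close>

lift_definition diag_vec :: "(nat \<Rightarrow> real) \<Rightarrow> ell2 \<Rightarrow> ell2" is
  "\<lambda>f x n. if \<forall>k. \<bar>f k\<bar> \<le> 1 then complex_of_real (f n) * x n else 0"
proof -
  fix f :: "nat \<Rightarrow> real" and x :: "nat \<Rightarrow> complex"
  assume x: "summable (\<lambda>n. (cmod (x n))\<^sup>2)"
  show "summable (\<lambda>n. (cmod (if \<forall>k. \<bar>f k\<bar> \<le> 1 then complex_of_real (f n) * x n else 0))\<^sup>2)"
    by (rule summable_comparison_test'[OF x])
      (auto simp: norm_mult power_mult_distrib abs_square_le_1 intro!: mult_left_le_one_le)
qed

definition diag_op :: "(nat \<Rightarrow> real) \<Rightarrow> ell2 \<Rightarrow>\<^sub>L ell2" where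
  "diag_op f = Blinfun (diag_vec f)"

lemma norm_diag_vec_le:
  assumes "\<And>n. \<bar>f n\<bar> \<le> 1" shows "norm (diag_vec f x) \<le> norm x"
proof (rule power2_le_imp_le)
  show "(norm (diag_vec f x))\<^sup>2 \<le> (norm x)\<^sup>2"
    unfolding norm_ell2_square
    by (rule suminf_le[OF _ ell2_summable_norm ell2_summable_norm])
      (use assms in \<open>auto simp: diag_vec.rep_eq norm_mult power_mult_distrib abs_square_le_1
        intro!: mult_left_le_one_le\<close>)
qed simp

lemma diag_op_apply:
  assumes "\<And>n. \<bar>f n\<bar> \<le> 1" shows "blinfun_apply (diag_op f) x = diag_vec f x"
proof -
  have "bounded_linear (diag_vec f)"
    by (rule bounded_linear_intro[where K = 1])
      (use norm_diag_vec_le[OF assms] in \<open>auto intro!: ell2_eqI simp: diag_vec.rep_eq ell2_nth_simps assms algebra_simps\<close>)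
  then show ?thesis unfolding diag_op_def by (simp add: bounded_linear_Blinfun_apply)
qed

lemma diag_op_nth:
  assumes "\<And>n. \<bar>f n\<bar> \<le> 1"
  shows "ell2_nth (blinfun_apply (diag_op f) x) n = complex_of_real (f n) * ell2_nth x n"
  using assms by (simp add: diag_op_apply diag_vec.rep_eq)

lemma norm_diag_op_le:
  assumes "\<And>n. \<bar>f n\<bar> \<le> 1" shows "norm (diag_op f) \<le> 1"
  by (rule norm_blinfun_bound) (use assms norm_diag_vec_le in \<open>auto simp: diag_op_apply\<close>)

lemma clinear_diag_op:
  assumes "\<And>n. \<bar>f n\<bar> \<le> 1" shows "clinear_ell2 (diag_op f)"
  unfolding clinear_ell2_def
  by (auto intro!: ell2_eqI simp: diag_op_nth assms ell2_nth_simps algebra_simps)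

lemma cinner_diag_op:
  assumes "\<And>n. \<bar>f n\<bar> \<le> 1"
  shows "cinner_ell2 (blinfun_apply (diag_op f) x) y = cinner_ell2 x (blinfun_apply (diag_op f) y)"
  unfolding cinner_ell2.rep_eq
  by (intro suminf_cong) (simp add: diag_op_nth assms algebra_simps)

definition low :: "nat \<Rightarrow> ell2 \<Rightarrow>\<^sub>L ell2" where
  "low n = diag_op (\<lambda>k. if k < n then 1 else 0)"

definition high :: "nat \<Rightarrow> ell2 \<Rightarrow>\<^sub>L ell2" where
  "high n = diag_op (\<lambda>k. if k < n then 0 else 1)"

lemma low_nth: "ell2_nth (blinfun_apply (low n) x) k = (if k < n then ell2_nth x k else 0)"
  unfolding low_def by (subst diag_op_nth) auto

lemma high_nth: "ell2_nth (blinfun_apply (high n) x) k = (if k < n then 0 else ell2_nth x k)"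
  unfolding high_def by (subst diag_op_nth) auto

lemma low_plus_high: "blinfun_apply (low n) x + blinfun_apply (high n) x = x"
  by (rule ell2_eqI) (simp add: low_nth high_nth ell2_nth_simps)

lemma high_high: "blinfun_apply (high n) (blinfun_apply (high m) x) = blinfun_apply (high (max m n)) x"
  by (rule ell2_eqI) (auto simp: high_nth less_max_iff_disj)

lemma norm_high_apply_le: "norm (blinfun_apply (high n) x) \<le> norm x"
  unfolding high_def by (subst diag_op_apply) (auto intro!: norm_diag_vec_le)

lemma norm_high_le: "norm (high n) \<le> 1" unfolding high_def by (rule norm_diag_op_le) auto
lemma norm_low_le: "norm (low n) \<le> 1" unfolding low_def by (rule norm_diag_op_le) auto

lemma cinner_high: "cinner_ell2 (blinfun_apply (high n) x) y = cinner_ell2 x (blinfun_apply (high n) y)"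
  unfolding high_def by (rule cinner_diag_op) auto

lemma clinear_high: "clinear_ell2 (high n)" unfolding high_def by (rule clinear_diag_op) auto

lemma high_tendsto_0: "(\<lambda>n. blinfun_apply (high n) x) \<longlonglongrightarrow> 0"
proof -
  have "(norm (blinfun_apply (high n) x))\<^sup>2 = (\<Sum>k. (cmod (ell2_nth x (k + n)))\<^sup>2)" for n
  proof -
    have "(norm (blinfun_apply (high n) x))\<^sup>2 =
        (\<Sum>k. (cmod (ell2_nth (blinfun_apply (high n) x) (k + n)))\<^sup>2)
        + (\<Sum>k<n. (cmod (ell2_nth (blinfun_apply (high n) x) k))\<^sup>2)"
      unfolding norm_ell2_square by (rule suminf_split_initial_segment[OF ell2_summable_norm])
    then show ?thesis by (simp add: high_nth)
  qed
  moreover have "(\<lambda>n. \<Sum>k. (cmod (ell2_nth x (k + n)))\<^sup>2) \<longlonglongrightarrow> 0"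
    by (rule suminf_exist_split2[OF ell2_summable_norm])
  ultimately have "(\<lambda>n. (norm (blinfun_apply (high n) x))\<^sup>2) \<longlonglongrightarrow> 0" by simp
  then have "(\<lambda>n. sqrt ((norm (blinfun_apply (high n) x))\<^sup>2)) \<longlonglongrightarrow> sqrt 0"
    by (intro tendsto_intros)
  then show ?thesis by (simp add: tendsto_norm_zero_iff)
qed

lift_definition ket :: "nat \<Rightarrow> ell2" is "\<lambda>n k. if k = n then 1 else 0"
  by (rule summable_finite[of "{n}" for n]) auto

lemma low_Suc: "blinfun_apply (low (Suc n)) x = blinfun_apply (low n) x + scaleC_ell2 (ell2_nth x n) (ket n)"
  by (rule ell2_eqI) (auto simp: low_nth ell2_nth_simps ket.rep_eq less_Suc_eq)

lemma low_eq_sum: "blinfun_apply (low n) x = (\<Sum>k<n. scaleC_ell2 (ell2_nth x k) (ket k))"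
proof (induction n)
  case 0 show ?case by (rule ell2_eqI) (simp add: low_nth zero_ell2.rep_eq)
qed (simp add: low_Suc)

lemma cinner_ket: "cinner_ell2 x (ket n) = cnj (ell2_nth x n)" "cinner_ell2 (ket n) x = ell2_nth x n"
proof -
  have "cinner_ell2 (ket n) x = (\<Sum>k\<in>{n}. cnj (ell2_nth (ket n) k) * ell2_nth x k)"
    unfolding cinner_ell2.rep_eq by (rule suminf_finite) (auto simp: ket.rep_eq)
  then show "cinner_ell2 (ket n) x = ell2_nth x n" by (simp add: ket.rep_eq)
  then show "cinner_ell2 x (ket n) = cnj (ell2_nth x n)" using cinner_commute by metis
qed

lemma norm_ket: "norm (ket n) = 1"
proof -
  have "complex_of_real ((norm (ket n))\<^sup>2) = 1"
    unfolding cinner_self[symmetric] cinner_ket by (simp add: ket.rep_eq)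
  then have "(norm (ket n))\<^sup>2 = 1" by (metis of_real_eq_1_iff)
  then show ?thesis using norm_ge_zero[of "ket n"] by (auto simp: power2_eq_1_iff simp del: norm_ge_zero) 
qed

section \<open>Bounded operators\<close>

lemma clinear_scaleC: "clinear_ell2 T \<Longrightarrow> T (scaleC_ell2 c v) = scaleC_ell2 c (T v)"
  by (simp add: clinear_ell2_def)

definition cscale :: "complex \<Rightarrow> (ell2 \<Rightarrow>\<^sub>L ell2) \<Rightarrow> ell2 \<Rightarrow>\<^sub>L ell2" where
  "cscale c T = Blinfun (\<lambda>v. scaleC_ell2 c (blinfun_apply T v))"

lemma bounded_linear_scaleC: "bounded_linear (scaleC_ell2 c)"
  by (rule bounded_linear_intro[where K = "cmod c"])
    (simp_all add: scaleC_simps norm_scaleC scaleR_eq_scaleC mult.commute)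

lemma bounded_linear_scaleC_left: "bounded_linear (\<lambda>c. scaleC_ell2 c x)"
  by (rule bounded_linear_intro[where K = "norm x"])
    (simp_all add: scaleC_simps norm_scaleC scaleR_eq_scaleC scaleR_conv_of_real)

lemma cscale_apply: "cscale c T v = scaleC_ell2 c (T v)"
  unfolding cscale_def
  by (subst bounded_linear_Blinfun_apply)
    (auto intro: bounded_linear_compose[OF bounded_linear_scaleC] blinfun.bounded_linear_right)

lemma norm_cscale: "norm (cscale c T) \<le> cmod c * norm T"
  by (rule norm_blinfun_bound)
    (auto simp: cscale_apply norm_scaleC mult.assoc intro!: mult_left_mono norm_blinfun)

lemma scaleR_eq_cscale: "r *\<^sub>R T = cscale (complex_of_real r) T"
  by (rule blinfun_eqI) (simp add: cscale_apply blinfun.scaleR_left scaleR_eq_scaleC)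

section \<open>Adjoints and complex linearity\<close>

lemma blinfun_cinner_eqI:
  fixes S T :: "ell2 \<Rightarrow>\<^sub>L ell2"
  shows "(\<And>u v. cinner_ell2 (S u) v = cinner_ell2 (T u) v) \<Longrightarrow> S = T"
  by (rule blinfun_eqI, rule ell2_eqI) (metis cinner_ket(1) complex_cnj_cancel_iff)

text \<open>\<open>adj_op\<close> is a definite description, so a witness must be built. Its
  coordinates at \<open>u\<close> are forced: the conjugates of <u, T e_n>. The adjoint identity
  holds on finitely supported vectors and extends by continuity.\<close>

lemma adjoint_exists:
  assumes T: "clinear_ell2 T"
  shows "\<exists>S. clinear_ell2 S \<and> norm S \<le> norm T \<and> (\<forall>u v. cinner_ell2 (S u) v = cinner_ell2 u (T v))"
proof -
  have "\<exists>s. ell2_nth s = (\<lambda>n. cnj (cinner_ell2 u (T (ket n)))) \<and> norm s \<le> norm T * norm u" for u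
  proof -
    let ?f = "\<lambda>n. cnj (cinner_ell2 u (T (ket n)))"
    have "(\<Sum>n<M. (cmod (?f n))\<^sup>2) \<le> (norm T * norm u)\<^sup>2" for M
    proof -
      have sm: "summable (\<lambda>n. (cmod (if n < M then ?f n else 0))\<^sup>2)"
        by (rule summable_finite[of "{..<M}"]) auto
      \<comment> \<open>The truncated candidate is tested against itself: its squared norm equals
        <u, T w>, hence is at most norm u * norm T * norm w, and one factor norm w cancels.\<close>
      define w where "w = Abs_ell2 (\<lambda>n. if n < M then ?f n else 0)"
      have w: "ell2_nth w = (\<lambda>n. if n < M then ?f n else 0)"
        unfolding w_def using sm by (subst Abs_ell2_inverse) simp_all
      have nw: "(norm w)\<^sup>2 = (\<Sum>n<M. (cmod (?f n))\<^sup>2)"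
        unfolding norm_ell2_square w by (subst suminf_finite[of "{..<M}"]) auto
      have "w = low M w" by (rule ell2_eqI) (simp add: low_nth w)
      then have "cinner_ell2 u (T w) = cinner_ell2 u (T (\<Sum>k<M. scaleC_ell2 (ell2_nth w k) (ket k)))"
        by (metis low_eq_sum)
      also have "\<dots> = (\<Sum>k<M. ?f k * cinner_ell2 u (T (ket k)))"
        by (simp add: blinfun.sum_right cinner_sum_right clinear_scaleC[OF T] cinner_scaleC_right w)
      also have "\<dots> = complex_of_real ((norm w)\<^sup>2)"
        unfolding nw of_real_sum by (intro sum.cong refl) (metis complex_mod_cnj complex_norm_square complex_cnj_cnj)
      finally have "(norm w)\<^sup>2 \<le> norm u * norm (T w)"
        by (metis cmod_cinner_le norm_of_real abs_power2)
      also have "\<dots> \<le> norm u * (norm T * norm w)" by (intro mult_left_mono norm_blinfun) auto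
      finally have "norm w * norm w \<le> (norm T * norm u) * norm w"
        by (simp add: power2_eq_square algebra_simps)
      then have "norm w \<le> norm T * norm u"
        by (cases "norm w = 0") (use norm_ge_zero[of w] in \<open>auto simp: mult_le_cancel_right\<close>)
      then show ?thesis unfolding nw[symmetric] by (intro power_mono) auto
    qed
    from ell2_bound[OF this] show ?thesis by (metis mult_nonneg_nonneg norm_ge_zero)
  qed
  then obtain s where s: "\<And>u. ell2_nth (s u) = (\<lambda>n. cnj (cinner_ell2 u (T (ket n))))"
    "\<And>u. norm (s u) \<le> norm T * norm u" by metis
  have bl: "bounded_linear s"
    by (rule bounded_linear_intro[where K = "norm T"])
      (auto intro!: ell2_eqI simp: s(1) ell2_nth_simps cinner_add_left cinner_scaleR_left,
        metis s(2) mult.commute)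
  have ap: "Blinfun s u = s u" for u using bl by (simp add: bounded_linear_Blinfun_apply)
  have "cinner_ell2 (s u) v = cinner_ell2 u (T v)" for u v
  proof -
    have l: "(\<lambda>n. low n v) \<longlonglongrightarrow> v"
    proof -
      have "(\<lambda>n. v - high n v) \<longlonglongrightarrow> v - 0" by (intro tendsto_intros high_tendsto_0)
      moreover have "v - high n v = low n v" for n using low_plus_high[of n v] by (simp add: algebra_simps)
      ultimately show ?thesis by simp
    qed
    have eq: "cinner_ell2 (s u) (low n v) = cinner_ell2 u (T (low n v))" for n
      unfolding low_eq_sum
      by (simp add: blinfun.sum_right cinner_sum_right clinear_scaleC[OF T] cinner_scaleC_right cinner_ket s(1))
    have "(\<lambda>n. cinner_ell2 (s u) (low n v)) \<longlonglongrightarrow> cinner_ell2 (s u) v"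
      by (rule bounded_linear.tendsto[OF bounded_linear_cinner_right l])
    moreover have "(\<lambda>n. cinner_ell2 u (T (low n v))) \<longlonglongrightarrow> cinner_ell2 u (T v)"
      by (intro bounded_linear.tendsto[OF bounded_linear_cinner_right] blinfun.tendsto l tendsto_const)
    ultimately show ?thesis unfolding eq by (rule LIMSEQ_unique)
  qed
  moreover have "clinear_ell2 (Blinfun s)"
    unfolding clinear_ell2_def ap
    by (auto intro!: ell2_eqI simp: s(1) ell2_nth_simps cinner_scaleC_left)
  moreover have "norm (Blinfun s) \<le> norm T"
    by (rule norm_blinfun_bound) (auto simp: ap s(2))
  ultimately show ?thesis by (intro exI[of _ "Blinfun s"]) (simp add: ap)
qed

lemma adj_op_unique:
  fixes S T :: "ell2 \<Rightarrow>\<^sub>L ell2"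
  assumes "\<And>u v. cinner_ell2 (S u) v = cinner_ell2 u (T v)" shows "adj_op T = S"
  unfolding adj_op_def
  by (rule the_equality) (auto intro!: blinfun_cinner_eqI simp: assms)

lemma
  assumes "clinear_ell2 T"
  shows cinner_adj_left: "cinner_ell2 (adj_op T u) v = cinner_ell2 u (T v)"
    and clinear_adj: "clinear_ell2 (adj_op T)"
    and norm_adj_le: "norm (adj_op T) \<le> norm T"
  using adjoint_exists[OF assms] adj_op_unique by metis+

lemma cinner_adj_right: "clinear_ell2 T \<Longrightarrow> cinner_ell2 u (adj_op T v) = cinner_ell2 (T u) v"
  by (metis cinner_adj_left cinner_commute)

lemma adj_adj: "clinear_ell2 T \<Longrightarrow> adj_op (adj_op T) = T"
  by (rule adj_op_unique) (simp add: cinner_adj_right)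

lemma clinear_add: "clinear_ell2 S \<Longrightarrow> clinear_ell2 T \<Longrightarrow> clinear_ell2 (S + T)"
  and clinear_diff: "clinear_ell2 S \<Longrightarrow> clinear_ell2 T \<Longrightarrow> clinear_ell2 (S - T)"
  and clinear_comp: "clinear_ell2 S \<Longrightarrow> clinear_ell2 T \<Longrightarrow> clinear_ell2 (S o\<^sub>L T)"
  and clinear_zero: "clinear_ell2 0"
  and clinear_id: "clinear_ell2 id_blinfun"
  and clinear_cscale: "clinear_ell2 T \<Longrightarrow> clinear_ell2 (cscale c T)"
  by (simp_all add: clinear_ell2_def blinfun.add_left blinfun.diff_left scaleC_simps cscale_apply mult.commute)

lemma clinear_scaleR: "clinear_ell2 T \<Longrightarrow> clinear_ell2 (r *\<^sub>R T)"
  unfolding scaleR_eq_cscale by (rule clinear_cscale)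

lemma clinear_sum: "(\<And>i. i \<in> I \<Longrightarrow> clinear_ell2 (f i)) \<Longrightarrow> clinear_ell2 (sum f I)"
  by (induction I rule: infinite_finite_induct) (auto simp: clinear_zero clinear_add)

lemma clinear_tendsto:
  assumes "f \<longlonglongrightarrow> T" "\<And>i::nat. clinear_ell2 (f i)" shows "clinear_ell2 T"
  unfolding clinear_ell2_def
proof (intro allI)
  fix c v
  have "(\<lambda>i. f i (scaleC_ell2 c v)) \<longlonglongrightarrow> T (scaleC_ell2 c v)"
    by (intro blinfun.tendsto assms tendsto_const)
  moreover have "(\<lambda>i. scaleC_ell2 c (f i v)) \<longlonglongrightarrow> scaleC_ell2 c (T v)"
    by (intro bounded_linear.tendsto[OF bounded_linear_scaleC] blinfun.tendsto assms tendsto_const)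
  ultimately show "T (scaleC_ell2 c v) = scaleC_ell2 c (T v)"
    unfolding clinear_scaleC[OF assms(2)] by (rule LIMSEQ_unique)
qed

lemma adj_add: "clinear_ell2 S \<Longrightarrow> clinear_ell2 T \<Longrightarrow> adj_op (S + T) = adj_op S + adj_op T"
  by (rule adj_op_unique) (simp add: blinfun.add_left cinner_add_left cinner_add_right cinner_adj_left)

lemma adj_diff: "clinear_ell2 S \<Longrightarrow> clinear_ell2 T \<Longrightarrow> adj_op (S - T) = adj_op S - adj_op T"
  by (rule adj_op_unique) (simp add: blinfun.diff_left cinner_diff_left cinner_diff_right cinner_adj_left)

lemma adj_comp: "clinear_ell2 S \<Longrightarrow> clinear_ell2 T \<Longrightarrow> adj_op (S o\<^sub>L T) = adj_op T o\<^sub>L adj_op S"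
  by (rule adj_op_unique) (simp add: cinner_adj_left)

lemma adj_cscale: "clinear_ell2 T \<Longrightarrow> adj_op (cscale c T) = cscale (cnj c) (adj_op T)"
  by (rule adj_op_unique) (simp add: cscale_apply cinner_scaleC_left cinner_scaleC_right cinner_adj_left)

lemma adj_id: "adj_op id_blinfun = id_blinfun" and adj_high: "adj_op (high n) = high n"
  by (auto intro!: adj_op_unique simp: cinner_high)

section \<open>Selfadjoint operators and their quadratic forms\<close>

definition selfadj :: "(ell2 \<Rightarrow>\<^sub>L ell2) \<Rightarrow> bool" where
  "selfadj T \<longleftrightarrow> clinear_ell2 T \<and> (\<forall>u v. cinner_ell2 (T u) v = cinner_ell2 u (T v))"

lemma selfadj_clinear: "selfadj T \<Longrightarrow> clinear_ell2 T"
  and selfadj_cinner: "selfadj T \<Longrightarrow> cinner_ell2 (T u) v = cinner_ell2 u (T v)"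
  and selfadj_adj: "selfadj T \<Longrightarrow> adj_op T = T"
  by (auto simp: selfadj_def intro: adj_op_unique)

lemma selfadj_inner: "selfadj T \<Longrightarrow> inner (T u) v = inner u (T v)"
  by (simp add: inner_ell2_def selfadj_cinner)

lemma selfadjI: "clinear_ell2 T \<Longrightarrow> adj_op T = T \<Longrightarrow> selfadj T"
  unfolding selfadj_def by (metis cinner_adj_left)

lemma selfadj_id: "selfadj id_blinfun" and selfadj_zero: "selfadj 0"
  and selfadj_high: "selfadj (high n)"
  by (simp_all add: selfadj_def clinear_id clinear_zero cinner_zero cinner_high clinear_high)

lemma selfadj_add: "selfadj S \<Longrightarrow> selfadj T \<Longrightarrow> selfadj (S + T)"
  and selfadj_diff: "selfadj S \<Longrightarrow> selfadj T \<Longrightarrow> selfadj (S - T)"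
  by (simp_all add: selfadj_def clinear_add clinear_diff blinfun.add_left blinfun.diff_left
      cinner_add_left cinner_add_right cinner_diff_left cinner_diff_right)

lemma selfadj_scaleR: "selfadj S \<Longrightarrow> selfadj (r *\<^sub>R S)"
  by (simp add: selfadj_def clinear_scaleR blinfun.scaleR_left cinner_scaleR_left cinner_scaleR_right)

lemma selfadj_sum: "(\<And>i. i \<in> I \<Longrightarrow> selfadj (f i)) \<Longrightarrow> selfadj (sum f I)"
  by (induction I rule: infinite_finite_induct) (auto simp: selfadj_zero selfadj_add)

lemma selfadj_sandwich: "selfadj T \<Longrightarrow> selfadj g \<Longrightarrow> selfadj (g o\<^sub>L T o\<^sub>L g)"
  by (simp add: selfadj_def clinear_comp)

lemma selfadj_tendsto:
  assumes "f \<longlonglongrightarrow> T" "\<And>i::nat. selfadj (f i)" shows "selfadj T"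
  unfolding selfadj_def
proof (intro conjI allI)
  show "clinear_ell2 T" using assms clinear_tendsto selfadj_clinear by blast
  fix u v
  have "(\<lambda>i. cinner_ell2 (f i u) v) \<longlonglongrightarrow> cinner_ell2 (T u) v"
    by (intro bounded_linear.tendsto[OF bounded_linear_cinner_left] blinfun.tendsto assms tendsto_const)
  moreover have "(\<lambda>i. cinner_ell2 u (f i v)) \<longlonglongrightarrow> cinner_ell2 u (T v)"
    by (intro bounded_linear.tendsto[OF bounded_linear_cinner_right] blinfun.tendsto assms tendsto_const)
  ultimately show "cinner_ell2 (T u) v = cinner_ell2 u (T v)"
    unfolding selfadj_cinner[OF assms(2)] by (rule LIMSEQ_unique)
qed

text \<open>Polarization expresses <w, T v> by the quadratic form at v + w and v - w, and the
  parallelogram law bounds the result. The norm appears by pairing T u with a multiple of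
  itself.\<close>

lemma norm_selfadj_le:
  assumes T: "selfadj T" and b: "\<And>v. \<bar>inner v (T v)\<bar> \<le> b * (norm v)\<^sup>2" and "0 \<le> b"
  shows "norm T \<le> b"
proof (rule norm_blinfun_bound[OF \<open>0 \<le> b\<close>])
  fix u
  have key: "2 * inner w (T v) \<le> b * ((norm v)\<^sup>2 + (norm w)\<^sup>2)" for v w
  proof -
    have "4 * inner w (T v) = inner (v + w) (T (v + w)) - inner (v - w) (T (v - w))"
      using selfadj_inner[OF T, of v w]
      by (simp add: blinfun.add_right blinfun.diff_right inner_add_left inner_add_right
          inner_diff_left inner_diff_right inner_commute)
    also have "\<dots> \<le> b * (norm (v + w))\<^sup>2 + b * (norm (v - w))\<^sup>2"
      using b[of "v + w"] b[of "v - w"] by linarith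
    also have "\<dots> = 2 * (b * ((norm v)\<^sup>2 + (norm w)\<^sup>2))"
      by (simp add: power2_norm_eq_inner inner_add_left inner_add_right inner_diff_left
          inner_diff_right inner_commute algebra_simps)
    finally show ?thesis by simp
  qed
  show "norm (T u) \<le> b * norm u"
  proof (cases "norm (T u) = 0 \<or> norm u = 0")
    case True then show ?thesis using \<open>0 \<le> b\<close> by auto
  next
    case False
    \<comment> \<open>With this factor r T u has the norm of \<open>u\<close>, so that both terms on
      the right of \<open>key\<close> coincide and the constant comes out as
      \<open>b\<close>.\<close>
    define r where "r = norm u / norm (T u)"
    have r: "r > 0" using False by (simp add: r_def)
    have "2 * (r * (norm (T u))\<^sup>2) \<le> b * ((norm u)\<^sup>2 + (norm (r *\<^sub>R T u))\<^sup>2)"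
      using key[of "r *\<^sub>R T u" u] by (simp add: power2_norm_eq_inner)
    moreover have "r * (norm (T u))\<^sup>2 = norm u * norm (T u)"
      using False by (simp add: r_def power2_eq_square)
    moreover have "norm (r *\<^sub>R T u) = norm u" using False by (simp add: r_def)
    ultimately have "2 * (norm u * norm (T u)) \<le> b * ((norm u)\<^sup>2 + (norm u)\<^sup>2)" by simp
    then have "norm u * norm (T u) \<le> norm u * (b * norm u)"
      by (simp add: power2_eq_square algebra_simps)
    then show ?thesis using False by (simp add: mult_le_cancel_left)
  qed
qed

subsection \<open>Compact operators\<close>

text \<open>Compactness in coordinates, as \<open>compact_ops_iff\<close> confirms. In this form the
  ideal properties and norm closedness are short estimates.\<close>

definition tail_null :: "(ell2 \<Rightarrow>\<^sub>L ell2) \<Rightarrow> bool" where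
  "tail_null T \<longleftrightarrow> (\<lambda>n. norm (high n o\<^sub>L T)) \<longlonglongrightarrow> 0"

lemma norm_high_comp_le: "norm (high n o\<^sub>L T) \<le> norm T"
  using norm_blinfun_compose[of "high n" T] norm_high_le[of n] mult_right_mono[of "norm (high n)" 1 "norm T"]
  by simp

lemma blinfun_compose_assoc: "(R o\<^sub>L S) o\<^sub>L T = R o\<^sub>L (S o\<^sub>L T)"
  by (rule blinfun_eqI) simp

lemma tail_null_add: "tail_null S \<Longrightarrow> tail_null T \<Longrightarrow> tail_null (S + T)"
  unfolding tail_null_def tendsto_norm_zero_iff
  by (simp add: bounded_bilinear.add_right[OF bounded_bilinear_blinfun_compose] tendsto_add_zero)

lemma tail_null_bound:
  assumes "tail_null T" "\<And>n. norm (high n o\<^sub>L S) \<le> norm (high n o\<^sub>L T) * c"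
  shows "tail_null S"
  unfolding tail_null_def
proof (rule Lim_null_comparison[rotated])
  show "(\<lambda>n. norm (high n o\<^sub>L T) * c) \<longlonglongrightarrow> 0"
    using assms(1) unfolding tail_null_def by (rule tendsto_mult_left_zero)
qed (use assms(2) in \<open>auto intro!: always_eventually\<close>)

lemma tail_null_comp_right: "tail_null T \<Longrightarrow> tail_null (T o\<^sub>L S)"
  by (erule tail_null_bound[where c = "norm S"])
    (metis blinfun_compose_assoc norm_blinfun_compose)

lemma tail_null_limit:
  assumes "\<And>e. 0 < e \<Longrightarrow> \<exists>S. tail_null S \<and> norm (T - S) < e"
  shows "tail_null T"
  unfolding tail_null_def
proof (rule LIMSEQ_I)
  fix e :: real assume e: "0 < e"
  then obtain S where S: "tail_null S" "norm (T - S) < e / 2" using assms[of "e/2"] by auto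
  then obtain N where N: "\<And>n. n \<ge> N \<Longrightarrow> norm (high n o\<^sub>L S) < e / 2"
    using e LIMSEQ_D[of "\<lambda>n. norm (high n o\<^sub>L S)" 0 "e/2"] unfolding tail_null_def by auto
  have "norm (high n o\<^sub>L T) < e" if "n \<ge> N" for n
  proof -
    have "high n o\<^sub>L T = (high n o\<^sub>L (T - S)) + (high n o\<^sub>L S)"
      by (rule blinfun_eqI) (simp add: blinfun.diff_left blinfun.add_left blinfun.diff_right)
    then have "norm (high n o\<^sub>L T) \<le> norm (high n o\<^sub>L (T - S)) + norm (high n o\<^sub>L S)"
      by (metis norm_triangle_ineq)
    then show ?thesis using N[OF that] S(2) norm_high_comp_le[of n "T - S"] by linarith
  qed
  then show "\<exists>N. \<forall>n\<ge>N. norm (norm (high n o\<^sub>L T) - 0) < e" by auto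
qed

lemma tail_null_tendsto:
  assumes "f \<longlonglongrightarrow> T" "\<And>i::nat. tail_null (f i)" shows "tail_null T"
proof (rule tail_null_limit)
  fix e :: real assume "0 < e"
  then obtain i where "norm (f i - T) < e" using assms(1) LIMSEQ_D by blast
  then show "\<exists>S. tail_null S \<and> norm (T - S) < e" using assms(2) by (metis norm_minus_commute)
qed

text \<open>The operator has finite rank: its values are combinations of the vectors
  \<open>S (ket k)\<close> with k < m, whose coefficients are bounded by the norm of the argument,
  and the tails of finitely many vectors vanish together.\<close>

lemma tail_null_comp_low:
  assumes "clinear_ell2 S" shows "tail_null (S o\<^sub>L low m)"
  unfolding tail_null_def
proof (rule Lim_null_comparison[rotated])
  show "(\<lambda>n. \<Sum>k<m. norm (high n (S (ket k)))) \<longlonglongrightarrow> 0"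
    by (intro tendsto_null_sum tendsto_norm_zero high_tendsto_0)
  have "norm (high n o\<^sub>L (S o\<^sub>L low m)) \<le> (\<Sum>k<m. norm (high n (S (ket k))))" for n
  proof (rule norm_blinfun_bound)
    fix x
    have "(high n o\<^sub>L (S o\<^sub>L low m)) x = (\<Sum>k<m. scaleC_ell2 (ell2_nth x k) (high n (S (ket k))))"
      by (simp add: low_eq_sum blinfun.sum_right clinear_scaleC assms clinear_high)
    also have "norm \<dots> \<le> (\<Sum>k<m. norm (high n (S (ket k))) * norm x)"
      by (rule sum_norm_le) (use cmod_ell2_nth_le[of x] in \<open>auto simp: norm_scaleC mult.commute intro!: mult_left_mono mult_right_mono\<close>)
    finally show "norm ((high n o\<^sub>L (S o\<^sub>L low m)) x) \<le> (\<Sum>k<m. norm (high n (S (ket k)))) * norm x"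
      by (simp add: sum_distrib_right)
  qed (simp add: sum_nonneg)
  then show "\<forall>\<^sub>F n in sequentially. norm (norm (high n o\<^sub>L (S o\<^sub>L low m))) \<le> (\<Sum>k<m. norm (high n (S (ket k))))"
    by simp
qed

lemma comp_minus_low: "S - (S o\<^sub>L low n) = S o\<^sub>L high n"
proof (rule blinfun_eqI)
  fix x
  have "S x = S (low n x + high n x)" by (simp add: low_plus_high)
  then show "(S - (S o\<^sub>L low n)) x = (S o\<^sub>L high n) x"
    by (simp add: blinfun.diff_left blinfun.add_right)
qed

text \<open>The products of \<open>S\<close>, \<open>low n\<close> and \<open>T\<close> approximate
  S T in norm, because the error is \<open>S\<close> times the tail of \<open>T\<close>; each of
  them factors through the finite rank operator S low n.\<close>

lemma tail_null_comp_left: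
  assumes S: "clinear_ell2 S" and T: "tail_null T" shows "tail_null (S o\<^sub>L T)"
proof (rule tail_null_limit)
  fix e :: real assume e: "0 < e"
  have "(\<lambda>n. norm S * norm (high n o\<^sub>L T)) \<longlonglongrightarrow> 0"
    using T unfolding tail_null_def by (rule tendsto_mult_right_zero)
  then obtain n where n: "norm S * norm (high n o\<^sub>L T) < e"
    using LIMSEQ_D[of _ 0 e] e by force
  have "(S o\<^sub>L T) - (S o\<^sub>L low n o\<^sub>L T) = S o\<^sub>L (high n o\<^sub>L T)"
    using comp_minus_low[of S n]
    by (metis (no_types, lifting) blinfun_compose_assoc bounded_bilinear.diff_left bounded_bilinear_blinfun_compose)
  then have "norm ((S o\<^sub>L T) - (S o\<^sub>L low n o\<^sub>L T)) < e"
    using norm_blinfun_compose[of S "high n o\<^sub>L T"] n by simp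
  then show "\<exists>R. tail_null R \<and> norm ((S o\<^sub>L T) - R) < e"
    using tail_null_comp_right[OF tail_null_comp_low[OF S]] by blast
qed

lemma tail_null_cscale: "tail_null T \<Longrightarrow> tail_null (cscale c T)"
proof -
  assume "tail_null T"
  then have "tail_null (cscale c id_blinfun o\<^sub>L T)"
    by (intro tail_null_comp_left clinear_cscale clinear_id)
  moreover have "cscale c id_blinfun o\<^sub>L T = cscale c T" by (rule blinfun_eqI) (simp add: cscale_apply)
  ultimately show ?thesis by simp
qed

lemma tail_null_scaleR: "tail_null T \<Longrightarrow> tail_null (r *\<^sub>R T)"
  unfolding scaleR_eq_cscale by (rule tail_null_cscale)

lemma tail_null_diff: "tail_null S \<Longrightarrow> tail_null T \<Longrightarrow> tail_null (S - T)"
  using tail_null_add[OF _ tail_null_scaleR[of T "-1"], of S] by simp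

lemma tail_null_zero: "tail_null 0" by (simp add: tail_null_def)

text \<open>Truncating the adjoint of \<open>T\<close> on the right leaves the adjoint of the tail
  of \<open>T\<close> as error, so the adjoint is a norm limit of finite rank operators.\<close>

lemma tail_null_adj:
  assumes T: "clinear_ell2 T" "tail_null T" shows "tail_null (adj_op T)"
proof (rule tail_null_limit)
  fix e :: real assume e: "0 < e"
  then obtain n where n: "norm (high n o\<^sub>L T) < e"
    using T(2) LIMSEQ_D[of "\<lambda>n. norm (high n o\<^sub>L T)" 0 e] unfolding tail_null_def by auto
  have "adj_op T - (adj_op T o\<^sub>L low n) = adj_op (high n o\<^sub>L T)"
    by (simp add: comp_minus_low adj_comp clinear_high T(1) adj_high)
  then have "norm (adj_op T - (adj_op T o\<^sub>L low n)) < e"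
    using norm_adj_le[OF clinear_comp[OF clinear_high T(1)]] n by (metis le_less_trans)
  then show "\<exists>S. tail_null S \<and> norm (adj_op T - S) < e"
    using tail_null_comp_low[OF clinear_adj[OF T(1)]] by blast
qed

text \<open>Smallness on the right is what vectors supported far out detect: if
  \<open>high n v = v\<close>, then T v is the value of this product at v.\<close>

lemma tail_null_imp_comp_high:
  assumes T: "clinear_ell2 T" "tail_null T" shows "(\<lambda>n. norm (T o\<^sub>L high n)) \<longlonglongrightarrow> 0"
proof (rule Lim_null_comparison[rotated])
  show "(\<lambda>n. norm (high n o\<^sub>L adj_op T)) \<longlonglongrightarrow> 0"
    using tail_null_adj[OF T] unfolding tail_null_def .
  have "T o\<^sub>L high n = adj_op (high n o\<^sub>L adj_op T)" for n
    by (simp add: adj_comp clinear_high clinear_adj T adj_high adj_adj)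
  then show "\<forall>\<^sub>F n in sequentially. norm (norm (T o\<^sub>L high n)) \<le> norm (high n o\<^sub>L adj_op T)"
    using norm_adj_le[OF clinear_comp[OF clinear_high clinear_adj[OF T(1)]]] by simp
qed

text \<open>Each further coordinate adds a compact disc of multiples of \<open>ket n\<close>; the
  sum is a continuous image of a product of compact sets.\<close>

lemma low_image_subset_compact: "\<exists>F. compact F \<and> low n ` cball 0 r \<subseteq> F"
proof (induction n)
  case 0
  have "low 0 ` cball 0 r \<subseteq> {0}" by (auto intro!: ell2_eqI simp: low_nth zero_ell2.rep_eq)
  then show ?case by (intro exI[of _ "{0}"]) simp
next
  case (Suc n)
  then obtain F where F: "compact F" "low n ` cball 0 r \<subseteq> F" by blast
  let ?G = "(\<lambda>(y, c). y + scaleC_ell2 c (ket n)) ` (F \<times> cball 0 r)"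
  have "compact ?G"
    by (intro compact_continuous_image compact_Times F compact_cball)
      (auto simp: case_prod_unfold intro!: continuous_intros
        bounded_linear.continuous_on[OF bounded_linear_scaleC_left])
  moreover have "low (Suc n) ` cball 0 r \<subseteq> ?G"
  proof
    fix z assume "z \<in> low (Suc n) ` cball 0 r"
    then obtain x where x: "z = low (Suc n) x" "norm x \<le> r" by auto
    have "low n x \<in> F" using F x by auto
    moreover have "ell2_nth x n \<in> cball 0 r" using x cmod_ell2_nth_le[of x n] by auto
    ultimately show "z \<in> ?G" unfolding x low_Suc by force
  qed
  ultimately show ?case by blast
qed

text \<open>A finite net of the image of the unit ball reduces uniform smallness of the tails to
  finitely many vectors, since \<open>high n\<close> is a contraction.\<close>

lemma compact_image_imp_tail_null:
  assumes "compact (closure (blinfun_apply T ` cball 0 1))" shows "tail_null T"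
  unfolding tail_null_def
proof (rule LIMSEQ_I)
  fix e :: real assume e: "0 < e"
  from assms obtain K where K: "finite K" "closure (T ` cball 0 1) \<subseteq> (\<Union>y\<in>K. ball y (e/4))"
    unfolding compact_eq_totally_bounded using e by (meson zero_less_divide_iff zero_less_numeral)
  have "\<forall>\<^sub>F n in sequentially. norm (high n y) < e/4" for y
    using high_tendsto_0[of y] e by (auto simp: tendsto_iff dist_norm dest: spec[of _ "e/4"])
  then have "\<forall>\<^sub>F n in sequentially. \<forall>y\<in>K. norm (high n y) < e/4"
    using K(1) by (simp add: eventually_ball_finite_distrib)
  then obtain N where N: "\<And>n y. n \<ge> N \<Longrightarrow> y \<in> K \<Longrightarrow> norm (high n y) < e/4"
    unfolding eventually_sequentially by blast
  have "norm (high n o\<^sub>L T) \<le> e/2" if n: "n \<ge> N" for n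
  proof (rule norm_blinfun_bound)
    fix x
    have u: "norm (high n (T x)) \<le> e/2" if "norm x \<le> 1" for x
    proof -
      have "T x \<in> closure (T ` cball 0 1)" using that closure_subset by fastforce
      then obtain y where y: "y \<in> K" "norm (T x - y) < e/4" using K(2) by (auto simp: dist_norm norm_minus_commute)
      have "high n (T x) = high n (T x - y) + high n y" by (simp add: blinfun.diff_right)
      then have "norm (high n (T x)) \<le> norm (high n (T x - y)) + norm (high n y)" by (metis norm_triangle_ineq)
      then show ?thesis using norm_high_apply_le[of n "T x - y"] y N[OF n y(1)] by linarith
    qed
    show "norm ((high n o\<^sub>L T) x) \<le> e/2 * norm x"
    proof (cases "x = 0")
      case False
      have "norm (high n (T (inverse (norm x) *\<^sub>R x))) \<le> e/2" by (rule u) (use False in simp)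
      then show ?thesis using False by (simp add: blinfun.scaleR_right field_simps)
    qed simp
  qed (use e in simp)
  then show "\<exists>N. \<forall>n\<ge>N. norm (norm (high n o\<^sub>L T) - 0) < e" using e
    by (intro exI[of _ N]) fastforce
qed

text \<open>Total boundedness: up to a small tail the image of the ball lies in a compact set of
  vectors supported below \<open>n\<close>, and a net of that set serves for the image.\<close>

lemma tail_null_imp_compact_image:
  assumes "tail_null T" shows "compact (closure (blinfun_apply T ` cball 0 1))"
  unfolding compact_eq_totally_bounded
proof (intro conjI allI impI)
  show "complete (closure (T ` cball 0 1))" by (simp add: complete_eq_closed)
  fix e :: real assume e: "0 < e"
  then obtain n where n: "norm (high n o\<^sub>L T) < e/4"
    using assms LIMSEQ_D[of "\<lambda>n. norm (high n o\<^sub>L T)" 0 "e/4"] unfolding tail_null_def by auto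
  obtain F where F: "compact F" "low n ` cball 0 (norm T) \<subseteq> F" using low_image_subset_compact by blast
  then obtain K where K: "finite K" "F \<subseteq> (\<Union>y\<in>K. ball y (e/2))"
    unfolding compact_eq_totally_bounded using e by (meson half_gt_zero)
  have "z \<in> (\<Union>y\<in>K. ball y e)" if z: "z \<in> closure (T ` cball 0 1)" for z
  proof -
    obtain x where x: "norm x \<le> 1" "dist (T x) z < e/4"
      using z e by (auto simp: closure_approachable dest: spec[of _ "e/4"])
    have "norm (T x) \<le> norm T" using norm_blinfun[of T x] x(1) mult_left_le[of "norm x" "norm T"] by simp
    then have "low n (T x) \<in> F" using F by auto
    then obtain y where y: "y \<in> K" "dist y (low n (T x)) < e/2" using K by auto
    have "T x - low n (T x) = (high n o\<^sub>L T) x" using low_plus_high[of n "T x"] by (simp add: algebra_simps)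
    then have "dist (low n (T x)) (T x) \<le> norm (high n o\<^sub>L T) * norm x"
      by (metis norm_blinfun dist_norm dist_commute)
    also have "\<dots> \<le> norm (high n o\<^sub>L T)" using x(1) by (intro mult_left_le) auto
    finally have "dist y z < e"
      using n x(2) y(2) dist_triangle[of y z "low n (T x)"] dist_triangle[of "low n (T x)" z "T x"] by linarith
    then show ?thesis using y(1) by auto
  qed
  then show "\<exists>k. finite k \<and> closure (T ` cball 0 1) \<subseteq> (\<Union>x\<in>k. ball x e)" using K(1) by blast
qed

lemma compact_ops_iff: "T \<in> compact_ops \<longleftrightarrow> clinear_ell2 T \<and> tail_null T"
  using compact_image_imp_tail_null tail_null_imp_compact_image
  by (auto simp: compact_ops_def bounded_ops_def)

section \<open>C*-subalgebras of operators\<close>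

text \<open>Stated for an arbitrary carrier closed under addition, so that it covers the algebra of
  all operators as well as each generated subalgebra.\<close>

lemma finsum_eq_sum:
  fixes G :: "('b::comm_monoid_add, 'm) ring_scheme" (structure)
  assumes "\<And>x y. x \<oplus> y = x + y" "\<zero> = (0::'b)" "0 \<in> carrier G"
    and "\<And>x y. x \<in> carrier G \<Longrightarrow> y \<in> carrier G \<Longrightarrow> x + y \<in> carrier G"
    and f: "\<And>i. i \<in> I \<Longrightarrow> f i \<in> carrier G"
  shows "finsum G f I = sum f I"
proof -
  interpret abelian_monoid G
    by (rule abelian_monoidI) (auto simp: assms(1-4) ac_simps)
  show ?thesis using f
    by (induction I rule: infinite_finite_induct)
      (auto simp: assms(1,2) finsum_infinite Pi_iff)
qed

lemma cstar_gen_simps [simp]: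
  "mult (cstar_gen A S) = mult A" "one (cstar_gen A S) = one A" "zero (cstar_gen A S) = zero A"
  "add (cstar_gen A S) = add A" "smult (cstar_gen A S) = smult A" "adj (cstar_gen A S) = adj A"
  by (simp_all add: cstar_gen_def)

lemma carrier_cstar_gen:
  "carrier (cstar_gen A S) = \<Inter>{B. cstar_subalgebra B A \<and> S \<subseteq> B}"
  by (simp add: cstar_gen_def)

lemma cstar_gen_least:
  "cstar_subalgebra B A \<Longrightarrow> S \<subseteq> B \<Longrightarrow> carrier (cstar_gen A S) \<subseteq> B"
  by (auto simp: carrier_cstar_gen)

lemma subset_cstar_gen: "S \<subseteq> carrier (cstar_gen A S)"
  by (auto simp: carrier_cstar_gen)

text \<open>The set \<open>B\<close> guarantees that the intersected family is nonempty; this is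
  what places the intersection inside the carrier of \<open>A\<close>.\<close>

lemma cstar_subalgebra_gen:
  assumes "cstar_subalgebra B A" "S \<subseteq> B"
  shows "cstar_subalgebra (carrier (cstar_gen A S)) A"
proof -
  have "carrier (cstar_gen A S) \<subseteq> carrier A"
    using assms by (auto simp: cstar_subalgebra_def carrier_cstar_gen)
  then show ?thesis
    unfolding cstar_subalgebra_def carrier_cstar_gen by (intro conjI ballI allI impI InterI) blast+
qed

lemma bounded_ops_simps [simp]:
  "carrier bounded_ops = {T. clinear_ell2 T}" "mult bounded_ops S T = S o\<^sub>L T"
  "one bounded_ops = id_blinfun" "zero bounded_ops = 0" "add bounded_ops S T = S + T"
  "smult bounded_ops c T = cscale c T" "adj bounded_ops = adj_op" "nrm bounded_ops = norm"
  by (simp_all add: bounded_ops_def cscale_def)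

lemma bounded_ops_minus:
  assumes "clinear_ell2 S" shows "T \<ominus>\<^bsub>bounded_ops\<^esub> S = T - S"
proof -
  have "\<ominus>\<^bsub>bounded_ops\<^esub> S = - S"
    unfolding a_inv_def m_inv_def
  proof (rule the_equality)
    show "- S \<in> carrier (add_monoid bounded_ops) \<and>
      S \<otimes>\<^bsub>add_monoid bounded_ops\<^esub> - S = \<one>\<^bsub>add_monoid bounded_ops\<^esub> \<and>
      - S \<otimes>\<^bsub>add_monoid bounded_ops\<^esub> S = \<one>\<^bsub>add_monoid bounded_ops\<^esub>"
      using clinear_diff[OF clinear_zero assms] by simp
  qed (auto simp: eq_neg_iff_add_eq_0)
  then show ?thesis by (simp add: a_minus_def)
qed

text \<open>Norm limits of complex linear operators are complex linear, so the requirement that the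
  limit lie in the carrier is automatic and closedness becomes plain sequential closedness.\<close>

lemma cstar_subalgebra_bounded_ops:
  "cstar_subalgebra B bounded_ops \<longleftrightarrow>
     (\<forall>a\<in>B. clinear_ell2 a) \<and> 0 \<in> B \<and> (\<forall>a\<in>B. \<forall>b\<in>B. a + b \<in> B \<and> a o\<^sub>L b \<in> B) \<and>
     (\<forall>a\<in>B. adj_op a \<in> B \<and> (\<forall>c. cscale c a \<in> B)) \<and>
     (\<forall>f a. (\<forall>i::nat. f i \<in> B) \<and> f \<longlonglongrightarrow> a \<longrightarrow> a \<in> B)"
    (is "_ \<longleftrightarrow> ?cl \<and> ?z \<and> ?m \<and> ?s \<and> ?l")
proof -
  have "(\<forall>f a. (\<forall>i::nat. f i \<in> B) \<and> a \<in> carrier bounded_ops \<and>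
        (\<lambda>i. nrm bounded_ops (f i \<ominus>\<^bsub>bounded_ops\<^esub> a)) \<longlonglongrightarrow> 0 \<longrightarrow> a \<in> B) \<longleftrightarrow> ?l" if ?cl
  proof (intro iff_allI)
    fix f :: "nat \<Rightarrow> ell2 \<Rightarrow>\<^sub>L ell2" and a
    have "(\<lambda>i. norm (f i - a)) \<longlonglongrightarrow> 0 \<longleftrightarrow> f \<longlonglongrightarrow> a"
      by (simp add: tendsto_norm_zero_iff LIM_zero_iff)
    moreover have "clinear_ell2 a" if "f \<longlonglongrightarrow> a" "\<forall>i. f i \<in> B"
      using clinear_tendsto that \<open>?cl\<close> by blast
    ultimately show "((\<forall>i. f i \<in> B) \<and> a \<in> carrier bounded_ops \<and>
        (\<lambda>i. nrm bounded_ops (f i \<ominus>\<^bsub>bounded_ops\<^esub> a)) \<longlonglongrightarrow> 0 \<longrightarrow> a \<in> B) \<longleftrightarrow>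
      ((\<forall>i. f i \<in> B) \<and> f \<longlonglongrightarrow> a \<longrightarrow> a \<in> B)"
      by (auto simp: bounded_ops_minus)
  qed
  moreover have "B \<subseteq> carrier bounded_ops \<longleftrightarrow> ?cl" by auto
  ultimately show ?thesis unfolding cstar_subalgebra_def by auto
qed

lemma cstar_subalgebra_bounded_ops_carrier: "cstar_subalgebra {T. clinear_ell2 T} bounded_ops"
  unfolding cstar_subalgebra_bounded_ops
  by (auto simp: clinear_zero clinear_add clinear_comp clinear_adj clinear_cscale intro: clinear_tendsto)

locale operator_algebra =
  fixes B :: "(ell2 \<Rightarrow>\<^sub>L ell2) set"
  assumes subalgebra: "cstar_subalgebra B bounded_ops" and id_mem: "id_blinfun \<in> B"
begin

lemma mem_clinear: "a \<in> B \<Longrightarrow> clinear_ell2 a"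
  and zero_mem: "0 \<in> B"
  and add_mem: "a \<in> B \<Longrightarrow> b \<in> B \<Longrightarrow> a + b \<in> B"
  and comp_mem: "a \<in> B \<Longrightarrow> b \<in> B \<Longrightarrow> a o\<^sub>L b \<in> B"
  and adj_mem: "a \<in> B \<Longrightarrow> adj_op a \<in> B"
  and cscale_mem: "a \<in> B \<Longrightarrow> cscale c a \<in> B"
  and tendsto_mem: "(\<And>i::nat. f i \<in> B) \<Longrightarrow> f \<longlonglongrightarrow> a \<Longrightarrow> a \<in> B"
  using subalgebra unfolding cstar_subalgebra_bounded_ops by blast+

lemma scaleR_mem: "a \<in> B \<Longrightarrow> r *\<^sub>R a \<in> B"
  unfolding scaleR_eq_cscale by (rule cscale_mem)

lemma diff_mem: "a \<in> B \<Longrightarrow> b \<in> B \<Longrightarrow> a - b \<in> B"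
  using add_mem[OF _ scaleR_mem[of b "-1"], of a] by simp

lemma sum_mem: "(\<And>i. i \<in> I \<Longrightarrow> f i \<in> B) \<Longrightarrow> sum f I \<in> B"
  by (induction I rule: infinite_finite_induct) (auto simp: zero_mem add_mem)

end

subsection \<open>Square roots\<close>

primrec sqrt_iter :: "(ell2 \<Rightarrow>\<^sub>L ell2) \<Rightarrow> nat \<Rightarrow> ell2 \<Rightarrow>\<^sub>L ell2" where
  "sqrt_iter s 0 = 0"
| "sqrt_iter s (Suc n) = (1/2) *\<^sub>R (s + (sqrt_iter s n o\<^sub>L sqrt_iter s n))"

text \<open>The iterates are dominated by the scalar iteration \<open>t \<mapsto> (1 + t\<^sup>2) / 2\<close>, which increases to 1;
  their limit \<open>y\<close> is \<open>1 - sqrt (1 - s)\<close>.\<close>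

lemma sqrt_iter_converges:
  assumes s: "norm s \<le> 1"
  obtains y where "sqrt_iter s \<longlonglongrightarrow> y" "norm y \<le> 1" "2 *\<^sub>R y = s + (y o\<^sub>L y)"
proof -
  define t :: "nat \<Rightarrow> real" where "t = rec_nat 0 (\<lambda>_ a. (1 + a\<^sup>2) / 2)"
  have t: "t 0 = 0" "t (Suc n) = (1 + (t n)\<^sup>2) / 2" for n by (simp_all add: t_def)
  have t01: "0 \<le> t n \<and> t n \<le> 1" for n
  proof (induction n)
    case (Suc n) then show ?case using power_le_one[of "t n" 2] by (auto simp: t)
  qed (simp add: t)
  have tm: "t n \<le> t (Suc n)" for n
    using zero_le_power2[of "t n - 1"] by (simp add: t power2_eq_square algebra_simps)
  define Y where "Y = sqrt_iter s"
  have Y: "Y 0 = 0" "Y (Suc n) = (1/2) *\<^sub>R (s + (Y n o\<^sub>L Y n))" for n by (simp_all add: Y_def)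
  have nY: "norm (Y n) \<le> t n" for n
  proof (induction n)
    case (Suc n)
    have "norm (Y n o\<^sub>L Y n) \<le> norm (Y n) * norm (Y n)" by (rule norm_blinfun_compose)
    also have "\<dots> \<le> (t n)\<^sup>2" unfolding power2_eq_square using Suc by (intro mult_mono) (auto simp: t01)
    finally have "norm (s + (Y n o\<^sub>L Y n)) \<le> 1 + (t n)\<^sup>2" using s norm_triangle_ineq[of s "Y n o\<^sub>L Y n"] by linarith
    then show ?case by (simp add: Y t)
  qed (simp add: Y t)
  have dY: "norm (Y (Suc n) - Y n) \<le> t (Suc n) - t n" for n
  proof (induction n)
    case 0 then show ?case using s by (simp add: Y t)
  next
    case (Suc n)
    \<comment> \<open>A difference of squares without commutativity: A A - B B = A (A - B) + (A - B)
      B.\<close>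
    have "Y (Suc (Suc n)) - Y (Suc n) =
        (1/2) *\<^sub>R ((Y (Suc n) o\<^sub>L (Y (Suc n) - Y n)) + ((Y (Suc n) - Y n) o\<^sub>L Y n))"
      unfolding Y(2)[of "Suc n"] Y(2)[of n]
      by (rule blinfun_eqI) (simp add: blinfun.bilinear_simps algebra_simps del: sqrt_iter.simps)
    then have "norm (Y (Suc (Suc n)) - Y (Suc n)) \<le>
       (norm (Y (Suc n)) * norm (Y (Suc n) - Y n) + norm (Y (Suc n) - Y n) * norm (Y n)) / 2"
      using norm_triangle_ineq[of "Y (Suc n) o\<^sub>L (Y (Suc n) - Y n)" "(Y (Suc n) - Y n) o\<^sub>L Y n"]
        norm_blinfun_compose[of "Y (Suc n)" "Y (Suc n) - Y n"]
        norm_blinfun_compose[of "Y (Suc n) - Y n" "Y n"] by simp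
    also have "\<dots> \<le> (t (Suc n) * (t (Suc n) - t n) + (t (Suc n) - t n) * t n) / 2"
      using Suc nY[of n] nY[of "Suc n"] t01 tm[of n]
      by (intro divide_right_mono add_mono mult_mono) auto
    also have "\<dots> = t (Suc (Suc n)) - t (Suc n)"
      unfolding t(2)[of "Suc n"] t(2)[of n] by (simp add: power2_eq_square field_simps)
    finally show ?case .
  qed
  have "incseq t" using tm by (rule incseq_SucI)
  then obtain l where "t \<longlonglongrightarrow> l" using incseq_convergent[of t 1] t01 by blast
  then have "summable (\<lambda>n. t (Suc n) - t n)" by (rule telescope_summable)
  then have "summable (\<lambda>n. Y (Suc n) - Y n)"
    by (rule summable_comparison_test'[where N = 0]) (rule dY)
  then have "convergent (\<lambda>n. \<Sum>k<n. Y (Suc k) - Y k)" by (simp add: summable_iff_convergent)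
  then have "convergent Y" by (simp add: sum_lessThan_telescope Y(1))
  then obtain y where y: "Y \<longlonglongrightarrow> y" by (auto simp: convergent_def)
  have "norm y \<le> 1"
    by (rule tendsto_upperbound[OF tendsto_norm[OF y]]) (use nY t01 order_trans in \<open>auto intro!: always_eventually, blast\<close>)
  moreover have "(\<lambda>n. 2 *\<^sub>R Y (Suc n)) \<longlonglongrightarrow> 2 *\<^sub>R y"
    by (intro tendsto_intros LIMSEQ_Suc y)
  moreover have "(\<lambda>n. 2 *\<^sub>R Y (Suc n)) \<longlonglongrightarrow> s + (y o\<^sub>L y)"
    unfolding Y by (simp, intro tendsto_add tendsto_const
        bounded_bilinear.tendsto[OF bounded_bilinear_blinfun_compose] y)
  ultimately show ?thesis using that y LIMSEQ_unique unfolding Y_def by blast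
qed

lemma selfadj_comp_self: "selfadj T \<Longrightarrow> selfadj (T o\<^sub>L T)"
  by (simp add: selfadj_def clinear_comp)

lemma sqrt_iter_selfadj: "selfadj s \<Longrightarrow> selfadj (sqrt_iter s n)"
  by (induction n) (simp_all add: selfadj_zero selfadj_scaleR selfadj_add selfadj_comp_self)

lemma sqrt_iter_commute:
  assumes "S o\<^sub>L s = s o\<^sub>L S" shows "S o\<^sub>L sqrt_iter s n = sqrt_iter s n o\<^sub>L S"
proof (induction n)
  case (Suc n)
  have "S (sqrt_iter s n (sqrt_iter s n x)) = sqrt_iter s n (sqrt_iter s n (S x))" for x
    using Suc by (metis blinfun_apply_blinfun_compose)
  moreover have "S (s x) = s (S x)" for x using assms by (metis blinfun_apply_blinfun_compose)
  ultimately show ?case by (intro blinfun_eqI) (simp add: blinfun.bilinear_simps)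
qed simp

lemma (in operator_algebra) sqrt_iter_mem: "s \<in> B \<Longrightarrow> sqrt_iter s n \<in> B"
  by (induction n) (simp_all add: zero_mem scaleR_mem add_mem comp_mem)

text \<open>In the sense of forms 0 <= T <= M, hence 0 <= 1 - T / M <= 1. This is the normalization
  under which the square root iteration converges.\<close>

lemma norm_one_minus_le:
  assumes T: "selfadj T" "\<And>v. 0 \<le> inner v (T v)" "norm T \<le> M" "0 < M"
  shows "norm (id_blinfun - (1/M) *\<^sub>R T) \<le> 1"
proof (rule norm_selfadj_le)
  show "selfadj (id_blinfun - (1/M) *\<^sub>R T)" by (intro selfadj_diff selfadj_id selfadj_scaleR T)
  fix v
  have "inner v (T v) \<le> norm v * (norm T * norm v)"
    using norm_cauchy_schwarz[of v "T v"] mult_left_mono[OF norm_blinfun[of T v], of "norm v"] by simp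
  also have "\<dots> \<le> norm v * (M * norm v)" using T by (intro mult_left_mono mult_right_mono) auto
  finally have "inner v (T v) / M \<le> (norm v)\<^sup>2" using T by (simp add: field_simps power2_eq_square)
  moreover have "0 \<le> inner v (T v) / M" using T(2)[of v] T(4) by simp
  ultimately show "\<bar>inner v ((id_blinfun - (1/M) *\<^sub>R T) v)\<bar> \<le> 1 * (norm v)\<^sup>2"
    by (simp add: blinfun.bilinear_simps inner_diff_right power2_norm_eq_inner[symmetric])
qed simp

text \<open>If \<open>y\<close> is the limit of the iteration for s = 1 - T / M, then 1 - y squares
  to T / M. The iterates are polynomials in \<open>T\<close>; this puts the root into the closed
  algebra and makes it commute with everything that commutes with \<open>T\<close>, which replaces
  functional calculus.\<close>

lemma (in operator_algebra) sqrt_exists: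
  assumes T: "T \<in> B" "selfadj T" "\<And>v. 0 \<le> inner v (T v)"
  obtains b where "b \<in> B" "selfadj b" "b o\<^sub>L b = T" "\<And>v. 0 \<le> inner v (b v)"
    "\<And>S. S o\<^sub>L T = T o\<^sub>L S \<Longrightarrow> S o\<^sub>L b = b o\<^sub>L S"
proof -
  \<comment> \<open>The summand 1 keeps \<open>M\<close> positive when \<open>T\<close> is
    0.\<close>
  define M where "M = norm T + 1"
  have M: "0 < M" "norm T \<le> M" by (auto simp: M_def add_nonneg_pos)
  define s where "s = id_blinfun - (1/M) *\<^sub>R T"
  have "norm s \<le> 1" unfolding s_def by (rule norm_one_minus_le[OF T(2,3) M(2,1)])
  then obtain y where y: "sqrt_iter s \<longlonglongrightarrow> y" "norm y \<le> 1" "2 *\<^sub>R y = s + (y o\<^sub>L y)"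
    by (rule sqrt_iter_converges) 
  have ss: "selfadj s" unfolding s_def by (intro selfadj_diff selfadj_id selfadj_scaleR T)
  have yB: "y \<in> B"
    using tendsto_mem[OF sqrt_iter_mem y(1)] unfolding s_def by (simp add: diff_mem id_mem scaleR_mem T)
  have ys: "selfadj y" by (rule selfadj_tendsto[OF y(1) sqrt_iter_selfadj[OF ss]])
  define b where "b = sqrt M *\<^sub>R (id_blinfun - y)"
  have "y (y v) = 2 *\<^sub>R y v - s v" for v
    using arg_cong[OF y(3), of "\<lambda>f. f v"] by (simp add: blinfun.bilinear_simps)
  then have "v - 2 *\<^sub>R y v + y (y v) = (1/M) *\<^sub>R T v" for v
    by (simp add: s_def blinfun.bilinear_simps)
  moreover have "b (b v) = M *\<^sub>R (v - 2 *\<^sub>R y v + y (y v))" for v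
    using M(1) by (simp add: b_def blinfun.bilinear_simps scaleR_2 algebra_simps)
  ultimately have "b (b v) = T v" for v using M(1) by simp
  then have "b o\<^sub>L b = T" by (intro blinfun_eqI) simp
  moreover have "b \<in> B" unfolding b_def by (intro scaleR_mem diff_mem id_mem yB)
  moreover have "selfadj b" unfolding b_def by (intro selfadj_scaleR selfadj_diff selfadj_id ys)
  moreover have "0 \<le> inner v (b v)" for v
  proof -
    have "inner v (y v) \<le> norm v * norm (y v)" by (rule norm_cauchy_schwarz)
    also have "\<dots> \<le> norm v * (1 * norm v)"
      using norm_blinfun[of y v] mult_right_mono[OF y(2), of "norm v"] by (intro mult_left_mono) auto
    finally show ?thesis using M(1)
      by (simp add: b_def blinfun.bilinear_simps inner_diff_right power2_norm_eq_inner[symmetric] power2_eq_square)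
  qed
  moreover have "S o\<^sub>L b = b o\<^sub>L S" if "S o\<^sub>L T = T o\<^sub>L S" for S
  proof -
    have "S (T x) = T (S x)" for x using that by (metis blinfun_apply_blinfun_compose)
    then have "S o\<^sub>L s = s o\<^sub>L S"
      by (intro blinfun_eqI) (simp add: s_def blinfun.bilinear_simps)
    then have eq: "S o\<^sub>L sqrt_iter s n = sqrt_iter s n o\<^sub>L S" for n by (rule sqrt_iter_commute)
    have "(\<lambda>n. S o\<^sub>L sqrt_iter s n) \<longlonglongrightarrow> (S o\<^sub>L y)" "(\<lambda>n. sqrt_iter s n o\<^sub>L S) \<longlonglongrightarrow> (y o\<^sub>L S)"
      by (intro bounded_bilinear.tendsto[OF bounded_bilinear_blinfun_compose] y(1) tendsto_const)+
    then have "S o\<^sub>L y = y o\<^sub>L S" unfolding eq by (rule LIMSEQ_unique)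
    then have "S (y x) = y (S x)" for x by (metis blinfun_apply_blinfun_compose)
    then show ?thesis by (intro blinfun_eqI) (simp add: b_def blinfun.bilinear_simps)
  qed
  ultimately show ?thesis using that by blast
qed

lemma inner_high_le:
  fixes T :: "ell2 \<Rightarrow>\<^sub>L ell2"
  shows "inner (high n x) (T x) \<le> norm x * (norm T * norm x)"
  by (rule order_trans[OF norm_cauchy_schwarz])
    (intro mult_mono norm_high_apply_le norm_blinfun, auto)

text \<open>With \<open>b = \<bar>f\<bar>\<close> and \<open>p = f + b\<close>, the identity \<open>p f p = p b p = p\<^sup>3 / 2\<close> bounds \<open>p\<^sup>3\<close> by the
  compact operator \<open>2 p k p\<close>.\<close>

lemma (in operator_algebra) essentially_nonpositive_split:
  assumes f: "f \<in> B" "selfadj f" and k: "clinear_ell2 k" "tail_null k"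
    and le: "\<And>v. inner v (f v) \<le> inner v (k v)"
  obtains p b where "p \<in> B" "tail_null p" "b \<in> B" "selfadj b" "f = p - (b o\<^sub>L b)"
proof -
  have "0 \<le> inner v ((f o\<^sub>L f) v)" for v
    using selfadj_inner[OF f(2), of v "f v"] by (metis blinfun_apply_blinfun_compose inner_ge_zero)
  then obtain b where b: "b \<in> B" "selfadj b" "b o\<^sub>L b = f o\<^sub>L f" "\<And>v. 0 \<le> inner v (b v)"
    and comm: "\<And>S. S o\<^sub>L (f o\<^sub>L f) = (f o\<^sub>L f) o\<^sub>L S \<Longrightarrow> S o\<^sub>L b = b o\<^sub>L S"
    using sqrt_exists[OF comp_mem[OF f(1) f(1)] selfadj_comp_self[OF f(2)]] by metis
  have "f o\<^sub>L b = b o\<^sub>L f" by (rule comm) (simp add: blinfun_compose_assoc)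
  then have fb: "f (b x) = b (f x)" for x by (metis blinfun_apply_blinfun_compose)
  have bb: "b (b x) = f (f x)" for x using b(3) by (metis blinfun_apply_blinfun_compose)
  define p where "p = f + b"
  have p: "p \<in> B" "selfadj p" unfolding p_def by (simp_all add: add_mem selfadj_add f b)
  \<comment> \<open>Here \<open>p\<close> is twice the positive part of \<open>f\<close>. Since
    \<open>f\<close> and \<open>b\<close> commute and have equal squares, they agree on the range of
    \<open>p\<close>.\<close>
  have fp: "f (p x) = b (p x)" for x by (simp add: p_def blinfun.bilinear_simps fb bb add.commute)
  have pp: "p (p x) = 2 *\<^sub>R b (p x)" for x
    using fp[of x] by (simp add: p_def blinfun.bilinear_simps scaleR_2)
  have pc: "clinear_ell2 p" using p selfadj_clinear by blast
  define q where "q = k o\<^sub>L p"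
  have "tail_null (p o\<^sub>L q)" unfolding q_def by (intro tail_null_comp_left tail_null_comp_right k pc)
  moreover have "clinear_ell2 (p o\<^sub>L q)" unfolding q_def by (intro clinear_comp k pc)
  ultimately have lim: "(\<lambda>n. norm ((p o\<^sub>L q) o\<^sub>L high n)) \<longlonglongrightarrow> 0" using tail_null_imp_comp_high by blast
  have bnd: "(norm (b (p x)))\<^sup>2 \<le> norm b * inner x ((p o\<^sub>L q) x)" for x
  proof -
    have "inner (p x) (b (p x)) \<le> inner (p x) (k (p x))" using le[of "p x"] fp by simp
    also have "\<dots> = inner x ((p o\<^sub>L q) x)" using selfadj_inner[OF p(2), of x "k (p x)"] by (simp add: q_def)
    finally have 1: "inner (p x) (b (p x)) \<le> inner x ((p o\<^sub>L q) x)" .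
    \<comment> \<open>A root of the positive operator \<open>b\<close> gives the inequality that the
      squared norm of b v is at most norm b times <v, b v>; it turns the form estimate into a norm
      estimate for b p.\<close>
    obtain c where c: "selfadj c" "c o\<^sub>L c = b" using sqrt_exists[OF b(1,2,4)] by metis
    have cc: "b v = c (c v)" for v using c(2) by (metis blinfun_apply_blinfun_compose)
    have "inner (b v) (b v) \<le> norm b * inner v (b v)" for v
    proof -
      have "inner (b v) (b v) = inner (c v) (b (c v))"
        using selfadj_inner[OF c(1)] by (simp add: cc)
      also have "\<dots> \<le> norm (c v) * (norm b * norm (c v))"
        using norm_cauchy_schwarz[of "c v" "b (c v)"] mult_left_mono[OF norm_blinfun[of b "c v"], of "norm (c v)"] by simp
      also have "\<dots> = norm b * inner (c v) (c v)" by (simp add: power2_norm_eq_inner[symmetric] power2_eq_square)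
      also have "inner (c v) (c v) = inner v (b v)" using selfadj_inner[OF c(1)] by (simp add: cc)
      finally show ?thesis .
    qed
    from this[of "p x"] show ?thesis
      using mult_left_mono[OF 1 norm_ge_zero[of b]] by (simp add: power2_norm_eq_inner)
  qed
  have "norm (b o\<^sub>L p o\<^sub>L high n) \<le> sqrt (norm b * norm ((p o\<^sub>L q) o\<^sub>L high n))" for n
  proof (rule norm_blinfun_bound)
    fix x
    have "(norm (b (p (high n x))))\<^sup>2 \<le> norm b * inner (high n x) (((p o\<^sub>L q) o\<^sub>L high n) x)"
      using bnd[of "high n x"] by simp
    also have "\<dots> \<le> norm b * (norm x * (norm ((p o\<^sub>L q) o\<^sub>L high n) * norm x))"
    proof (intro mult_left_mono)
      show "inner (high n x) (((p o\<^sub>L q) o\<^sub>L high n) x) \<le> norm x * (norm ((p o\<^sub>L q) o\<^sub>L high n) * norm x)"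
        by (rule inner_high_le)
    qed simp
    also have "\<dots> = (sqrt (norm b * norm ((p o\<^sub>L q) o\<^sub>L high n)) * norm x)\<^sup>2"
      by (simp add: power_mult_distrib power2_eq_square[of "norm x"] algebra_simps)
    finally show "norm ((b o\<^sub>L p o\<^sub>L high n) x) \<le> sqrt (norm b * norm ((p o\<^sub>L q) o\<^sub>L high n)) * norm x"
      by - (rule power2_le_imp_le, simp_all)
  qed simp
  moreover have "(\<lambda>n. sqrt (norm b * norm ((p o\<^sub>L q) o\<^sub>L high n))) \<longlonglongrightarrow> 0"
    using tendsto_real_sqrt[OF tendsto_mult_right_zero[OF lim, of "norm b"]] by simp
  ultimately have bp: "(\<lambda>n. norm (b o\<^sub>L p o\<^sub>L high n)) \<longlonglongrightarrow> 0"
    by - (rule Lim_null_comparison[where g = "\<lambda>n. sqrt (norm b * norm ((p o\<^sub>L q) o\<^sub>L high n))"], simp_all)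
  \<comment> \<open>From b p to p: since p p = 2 b p, the squared norm of p v is 2 <v, b p v>. The
    adjoint then moves the tail projection from the right of \<open>p\<close> to its left.\<close>
  have "norm (high n o\<^sub>L p) \<le> sqrt (2 * norm (b o\<^sub>L p o\<^sub>L high n))" for n
  proof -
    have "norm (p o\<^sub>L high n) \<le> sqrt (2 * norm (b o\<^sub>L p o\<^sub>L high n))"
    proof (rule norm_blinfun_bound)
      fix x
      have "(norm (p (high n x)))\<^sup>2 = inner (high n x) (p (p (high n x)))"
        using selfadj_inner[OF p(2)] by (simp add: power2_norm_eq_inner)
      also have "\<dots> = 2 * inner (high n x) ((b o\<^sub>L p o\<^sub>L high n) x)" by (simp add: pp)
      also have "\<dots> \<le> 2 * (norm x * (norm (b o\<^sub>L p o\<^sub>L high n) * norm x))"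
        by (intro mult_left_mono inner_high_le) simp
      also have "\<dots> = (sqrt (2 * norm (b o\<^sub>L p o\<^sub>L high n)) * norm x)\<^sup>2"
        by (simp add: power_mult_distrib power2_eq_square[of "norm x"])
      finally show "norm ((p o\<^sub>L high n) x) \<le> sqrt (2 * norm (b o\<^sub>L p o\<^sub>L high n)) * norm x"
        by - (rule power2_le_imp_le, simp_all)
    qed simp
    moreover have "high n o\<^sub>L p = adj_op (p o\<^sub>L high n)"
      by (simp add: adj_comp pc clinear_high adj_high selfadj_adj p)
    ultimately show ?thesis using norm_adj_le[OF clinear_comp[OF pc clinear_high]] by (metis order_trans)
  qed
  moreover have "(\<lambda>n. sqrt (2 * norm (b o\<^sub>L p o\<^sub>L high n))) \<longlonglongrightarrow> 0"
    using tendsto_real_sqrt[OF tendsto_mult_right_zero[OF bp, of 2]] by simp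
  ultimately have "tail_null p" unfolding tail_null_def
    by - (rule Lim_null_comparison[where g = "\<lambda>n. sqrt (2 * norm (b o\<^sub>L p o\<^sub>L high n))"], simp_all)
  \<comment> \<open>As f = p - b, a root of \<open>b\<close> supplies the square to be
    subtracted.\<close>
  obtain d where d: "d \<in> B" "selfadj d" "d o\<^sub>L d = b" using sqrt_exists[OF b(1,2,4)] by metis
  show ?thesis by (rule that[OF p(1) \<open>tail_null p\<close> d(1,2)]) (simp add: d p_def)
qed

section \<open>Positive matrices\<close>

lemma nonneg_Reals_sum: "(\<And>i. i \<in> I \<Longrightarrow> f i \<in> \<real>\<^sub>\<ge>\<^sub>0) \<Longrightarrow> sum f I \<in> (\<real>\<^sub>\<ge>\<^sub>0 :: complex set)"
  by (induction I rule: infinite_finite_induct) auto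

lemma cnj_mult_nonneg: "cnj z * z \<in> \<real>\<^sub>\<ge>\<^sub>0"
  by (simp add: complex_nonneg_Reals_iff)

text \<open>Membership in the nonnegative reals inside the complex numbers contains the realness of
  the values, from which hermitian symmetry is derived.\<close>

definition psd_kernel :: "'i set \<Rightarrow> ('i \<Rightarrow> 'i \<Rightarrow> complex) \<Rightarrow> bool" where
  "psd_kernel I k \<longleftrightarrow> (\<forall>c. (\<Sum>p\<in>I. \<Sum>q\<in>I. cnj (c p) * k p q * c q) \<in> \<real>\<^sub>\<ge>\<^sub>0)"

lemma psd_kernelD: "psd_kernel I k \<Longrightarrow> (\<Sum>p\<in>I. \<Sum>q\<in>I. cnj (c p) * k p q * c q) \<in> \<real>\<^sub>\<ge>\<^sub>0"
  by (simp add: psd_kernel_def)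

lemma psd_kernel_subset:
  assumes "psd_kernel I k" "finite I" "J \<subseteq> I" shows "psd_kernel J k"
  unfolding psd_kernel_def
proof
  fix c :: "_ \<Rightarrow> complex"
  let ?c = "\<lambda>p. if p \<in> J then c p else 0"
  have "(\<Sum>p\<in>I. \<Sum>q\<in>I. cnj (?c p) * k p q * ?c q) = (\<Sum>p\<in>J. \<Sum>q\<in>I. cnj (?c p) * k p q * ?c q)"
    using assms by (intro sum.mono_neutral_right) auto
  also have "\<dots> = (\<Sum>p\<in>J. \<Sum>q\<in>J. cnj (?c p) * k p q * ?c q)"
    using assms by (intro sum.cong refl sum.mono_neutral_right) auto
  also have "\<dots> = (\<Sum>p\<in>J. \<Sum>q\<in>J. cnj (c p) * k p q * c q)" by (intro sum.cong refl) simp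
  finally show "(\<Sum>p\<in>J. \<Sum>q\<in>J. cnj (c p) * k p q * c q) \<in> \<real>\<^sub>\<ge>\<^sub>0"
    using psd_kernelD[OF assms(1), of ?c] by simp
qed

lemma psd_kernel_diag:
  assumes "psd_kernel I k" "finite I" "p \<in> I" shows "k p p \<in> \<real>\<^sub>\<ge>\<^sub>0"
  using psd_kernelD[OF psd_kernel_subset[OF assms(1,2), of "{p}"], of "\<lambda>_. 1"] assms(3) by simp

lemma psd_kernel_pair:
  assumes "psd_kernel I k" "finite I" "p \<in> I" "q \<in> I" "p \<noteq> q"
  shows "cnj s * k p p * s + cnj s * k p q * t + cnj t * k q p * s + cnj t * k q q * t \<in> \<real>\<^sub>\<ge>\<^sub>0"
  using psd_kernelD[OF psd_kernel_subset[OF assms(1,2), of "{p, q}"], of "\<lambda>i. if i = p then s else t"]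
    assms(3-5) by (simp add: ac_simps)

text \<open>Realness of the form at the coefficient pairs (1, 1) and (1, i) determines the imaginary
  part of the sum and the real part of the difference of the two off-diagonal entries.\<close>

lemma psd_kernel_hermitian:
  assumes "psd_kernel I k" "finite I" "p \<in> I" "q \<in> I" shows "k q p = cnj (k p q)"
proof (cases "p = q")
  case True then show ?thesis
    using psd_kernel_diag[OF assms(1-3)] by (auto simp: complex_nonneg_Reals_iff complex_eq_iff)
next
  case False
  note d = psd_kernel_diag[OF assms(1-3)] psd_kernel_diag[OF assms(1,2,4)]
  from psd_kernel_pair[OF assms False, of 1 1] psd_kernel_pair[OF assms False, of 1 \<i>] d
  show ?thesis by (auto simp: complex_nonneg_Reals_iff complex_eq_iff)
qed

text \<open>With the coefficient - t k p q at the vanishing diagonal entry the form is affine in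
  \<open>t\<close> with slope -2 times the squared modulus of k p q; it stays nonnegative for all
  \<open>t\<close> only if that entry is 0.\<close>

lemma psd_kernel_zero:
  assumes "psd_kernel I k" "finite I" "p \<in> I" "q \<in> I" "k p p = 0" shows "k p q = 0"
proof (cases "p = q")
  case False
  have h: "k q p = cnj (k p q)" by (rule psd_kernel_hermitian[OF assms(1-4)])
  obtain r where r: "r \<ge> 0" "k q q = complex_of_real r"
    using psd_kernel_diag[OF assms(1,2,4)] by (auto elim: nonneg_Reals_cases)
  have "2 * t * (cmod (k p q))\<^sup>2 \<le> r" for t
  proof -
    have "0 \<le> Re (cnj (- of_real t * k p q) * k p q + cnj 1 * k q p * (- of_real t * k p q) + cnj 1 * k q q * 1)"
      using psd_kernel_pair[OF assms(1-4) False, of "- of_real t * k p q" 1] assms(5)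
      by (simp add: complex_nonneg_Reals_iff)
    also have "\<dots> = r - 2 * t * ((Re (k p q))\<^sup>2 + (Im (k p q))\<^sup>2)"
      by (simp add: h r power2_eq_square algebra_simps)
    finally show ?thesis by (simp add: cmod_power2)
  qed
  from this[of "(r + 1) / (2 * (cmod (k p q))\<^sup>2)"] show ?thesis
    by (cases "k p q = 0") auto
qed (use assms in simp)

text \<open>Cholesky factorization.  The Schur complement step is uniform: division by a vanishing
  pivot yields 0, and then the whole row of the pivot vanishes.\<close>

lemma psd_kernel_factor:
  assumes "finite I" "psd_kernel I k"
  shows "\<exists>L. \<forall>p\<in>I. \<forall>q\<in>I. k p q = (\<Sum>r\<in>I. cnj (L r p) * L r q)"
  using assms
proof (induction I arbitrary: k rule: finite_induct)
  case (insert x I)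
  note P = insert.prems and fin = finite.insertI[OF insert.hyps(1), of x]
  obtain d where d: "d \<ge> 0" "k x x = complex_of_real d"
    using psd_kernel_diag[OF P fin, of x] by (auto elim: nonneg_Reals_cases)
  have herm: "k p x = cnj (k x p)" if "p \<in> insert x I" for p
    using psd_kernel_hermitian[OF P fin _ that, of x] by simp
  have zero: "k x q = 0" if "d = 0" "q \<in> insert x I" for q
    using psd_kernel_zero[OF P fin _ that(2), of x] that(1) d by simp
  define k' where "k' p q = k p q - cnj (k x p) * k x q / of_real d" for p q
  have "psd_kernel I k'"
    unfolding psd_kernel_def
  proof
    fix c
    define S where "S = (\<Sum>q\<in>I. k x q * c q)"
    \<comment> \<open>The pivot coordinate minimizes the form of \<open>k\<close>, so completing the
      square leaves the form of the Schur complement \<open>k'\<close>. For d = 0 the coordinate is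
      0 and the subtracted square is 0 as well.\<close>
    define c' where "c' = c(x := - S / of_real d)"
    have c'I: "c' p = c p" if "p \<in> I" for p using that insert.hyps(2) by (auto simp: c'_def)
    have 1: "(\<Sum>q\<in>I. cnj (c' x) * k x q * c' q) = cnj (c' x) * S"
      unfolding S_def sum_distrib_left by (intro sum.cong) (auto simp: c'I)
    have 2: "(\<Sum>p\<in>I. cnj (c' p) * k p x * c' x) = cnj S * c' x"
      unfolding S_def sum_distrib_right cnj_sum
      by (intro sum.cong) (auto simp: c'I herm)
    have 3: "(\<Sum>p\<in>I. \<Sum>q\<in>I. cnj (c' p) * k p q * c' q) = (\<Sum>p\<in>I. \<Sum>q\<in>I. cnj (c p) * k p q * c q)"
      by (intro sum.cong) (auto simp: c'I)
    have "(\<Sum>p\<in>insert x I. \<Sum>q\<in>insert x I. cnj (c' p) * k p q * c' q) =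
      cnj (c' x) * k x x * c' x + cnj (c' x) * S + cnj S * c' x + (\<Sum>p\<in>I. \<Sum>q\<in>I. cnj (c p) * k p q * c q)"
      using insert.hyps by (simp add: sum.distrib 1 2 3 add.assoc)
    also have "cnj (c' x) * k x x * c' x + cnj (c' x) * S + cnj S * c' x = - (cnj S * S / of_real d)"
      by (cases "d = 0") (auto simp: c'_def d field_simps)
    also have "cnj S * S / of_real d = (\<Sum>p\<in>I. \<Sum>q\<in>I. cnj (c p) * (cnj (k x p) * k x q / of_real d) * c q)"
      unfolding S_def cnj_sum sum_product sum_divide_distrib by (intro sum.cong) (auto simp: algebra_simps)
    also have "- \<dots> + (\<Sum>p\<in>I. \<Sum>q\<in>I. cnj (c p) * k p q * c q) = (\<Sum>p\<in>I. \<Sum>q\<in>I. cnj (c p) * k' p q * c q)"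
      by (simp add: k'_def algebra_simps sum_subtractf)
    finally show "(\<Sum>p\<in>I. \<Sum>q\<in>I. cnj (c p) * k' p q * c q) \<in> \<real>\<^sub>\<ge>\<^sub>0"
      using psd_kernelD[OF P, of c'] by simp
  qed
  from insert.IH[OF this] obtain L where
    L: "\<And>p q. p \<in> I \<Longrightarrow> q \<in> I \<Longrightarrow> k' p q = (\<Sum>r\<in>I. cnj (L r p) * L r q)" by blast
  define L' where "L' r p = (if r = x then k x p / of_real (sqrt d) else if p = x then 0 else L r p)" for r p
  have rI: "r \<noteq> x" if "r \<in> I" for r using that insert.hyps by auto
  have sq: "of_real (sqrt d) * of_real (sqrt d) = complex_of_real d"
    using d(1) by (metis of_real_mult real_sqrt_mult_self abs_of_nonneg)
  have Lx: "cnj (L' x p) * L' x q = cnj (k x p) * k x q / of_real d" for p q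
    unfolding L'_def by (simp add: sq)
  have "k p q = (\<Sum>r\<in>insert x I. cnj (L' r p) * L' r q)"
    if p: "p \<in> insert x I" and q: "q \<in> insert x I" for p q
  proof -
    have "(\<Sum>r\<in>insert x I. cnj (L' r p) * L' r q) =
        cnj (k x p) * k x q / of_real d + (\<Sum>r\<in>I. cnj (L' r p) * L' r q)"
      using insert.hyps by (simp add: Lx)
    also have "(\<Sum>r\<in>I. cnj (L' r p) * L' r q) =
        (if p = x \<or> q = x then 0 else (\<Sum>r\<in>I. cnj (L r p) * L r q))"
      using rI by (auto simp: L'_def intro!: sum.neutral sum.cong)
    finally have *: "(\<Sum>r\<in>insert x I. cnj (L' r p) * L' r q) =
        cnj (k x p) * k x q / of_real d + (if p = x \<or> q = x then 0 else k' p q)"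
      using L p q by auto
    show ?thesis
    proof (cases "p = x \<or> q = x")
      case True
      then show ?thesis unfolding * using zero p q herm[OF p] herm[OF q] d
        by (cases "d = 0") auto
    qed (simp add: * k'_def)
  qed
  then show ?case by blast
qed simp

text \<open>The neutral element is the zero matrix of one fixed size, so finite sums are taken in
  the given structure and evaluated through their entries.\<close>

lemma sum_mat_index:
  fixes G :: "(complex mat, 'm) ring_scheme"
  assumes G: "add G = (+)" "zero G = 0\<^sub>m n n" "carrier G \<subseteq> carrier_mat n n" "0\<^sub>m n n \<in> carrier G"
      "\<And>x y. x \<in> carrier G \<Longrightarrow> y \<in> carrier G \<Longrightarrow> x + y \<in> carrier G"
    and f: "finite I" "\<And>i. i \<in> I \<Longrightarrow> f i \<in> carrier G"
  shows "finsum G f I \<in> carrier G"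
    and "i < n \<Longrightarrow> j < n \<Longrightarrow> finsum G f I $$ (i, j) = (\<Sum>k\<in>I. f k $$ (i, j))"
proof -
  interpret abelian_monoid G
    by (rule abelian_monoidI) (use G in \<open>auto simp: subset_iff intro!: assoc_add_mat[of _ n n] comm_add_mat[of _ n n] left_add_zero_mat[of _ n n]\<close>)
  show mem: "finsum G f I \<in> carrier G" using f by (intro finsum_closed) auto
  show "finsum G f I $$ (i, j) = (\<Sum>k\<in>I. f k $$ (i, j))" if ij: "i < n" "j < n"
    using f
  proof (induction I rule: finite_induct)
    case empty then show ?case using ij G by simp
  next
    case (insert x I)
    have "finsum G f I \<in> carrier_mat n n" using insert G(3) by (auto intro!: finsum_closed subsetD[OF G(3)])
    then show ?case using insert ij G by (subst finsum_insert) (auto simp: Pi_iff)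
  qed
qed

section \<open>Sesquilinear forms and positive block matrices\<close>

lemma matrix_alg_simps [simp]:
  "carrier (matrix_alg n) = carrier_mat n n" "mult (matrix_alg n) = (*)"
  "one (matrix_alg n) = 1\<^sub>m n" "zero (matrix_alg n) = 0\<^sub>m n n" "add (matrix_alg n) = (+)"
  "smult (matrix_alg n) = (\<cdot>\<^sub>m)" "adj (matrix_alg n) = mat_adjoint"
  by (simp_all add: matrix_alg_def)

lemma mat_adjoint_index:
  "i < dim_col A \<Longrightarrow> j < dim_row A \<Longrightarrow> mat_adjoint A $$ (i, j) = cnj (A $$ (j, i))"
  by (simp add: mat_adjoint_def mat_of_rows_def)

lemma mat_adjoint_carrier: "A \<in> carrier_mat n m \<Longrightarrow> mat_adjoint A \<in> carrier_mat m n"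
  by (auto simp: mat_adjoint_def)

lemma finsum_matrix_alg:
  assumes "finite I" "\<And>i. i \<in> I \<Longrightarrow> f i \<in> carrier_mat n n"
  shows "finsum (matrix_alg n) f I \<in> carrier_mat n n"
    and "i < n \<Longrightarrow> j < n \<Longrightarrow> finsum (matrix_alg n) f I $$ (i, j) = (\<Sum>k\<in>I. f k $$ (i, j))"
  using sum_mat_index[of "matrix_alg n" n I f] assms by auto

lemma mat_mult_index:
  assumes "A \<in> carrier_mat n m" "B \<in> carrier_mat m l" "i < n" "j < l"
  shows "(A * B) $$ (i, j) = (\<Sum>k<m. A $$ (i, k) * B $$ (k, j))"
  using assms by (auto simp: scalar_prod_def atLeast0LessThan intro!: sum.cong)

text \<open>Vectors are functions of which only the entries below \<open>n\<close> count; the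
  coordinates of a vector in \<open>ell2\<close> can therefore be inserted unchanged.\<close>

definition mform :: "nat \<Rightarrow> complex mat \<Rightarrow> (nat \<Rightarrow> complex) \<Rightarrow> (nat \<Rightarrow> complex) \<Rightarrow> complex" where
  "mform n a v w = (\<Sum>i<n. \<Sum>j<n. cnj (v i) * a $$ (i, j) * w j)"

lemma mform_adjoint_mult:
  assumes "a \<in> carrier_mat l n" "b \<in> carrier_mat l n"
  shows "mform n (mat_adjoint a * b) v w =
    (\<Sum>g<l. cnj (\<Sum>i<n. a $$ (g, i) * v i) * (\<Sum>j<n. b $$ (g, j) * w j))"
proof -
  have "mform n (mat_adjoint a * b) v w =
      (\<Sum>i<n. \<Sum>j<n. \<Sum>g<l. cnj (a $$ (g, i) * v i) * (b $$ (g, j) * w j))"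
    unfolding mform_def
  proof (intro sum.cong refl)
    fix i j assume "i \<in> {..<n}" "j \<in> {..<n}"
    then show "cnj (v i) * (mat_adjoint a * b) $$ (i, j) * w j =
        (\<Sum>g<l. cnj (a $$ (g, i) * v i) * (b $$ (g, j) * w j))"
      using assms mat_adjoint_carrier[OF assms(1)]
      by (subst mat_mult_index[where n = n and m = l and l = n])
        (auto simp: sum_distrib_left sum_distrib_right mat_adjoint_index algebra_simps intro!: sum.cong)
  qed
  also have "\<dots> = (\<Sum>i<n. \<Sum>g<l. \<Sum>j<n. cnj (a $$ (g, i) * v i) * (b $$ (g, j) * w j))"
    by (intro sum.cong refl sum.swap)
  also have "\<dots> = (\<Sum>g<l. \<Sum>i<n. \<Sum>j<n. cnj (a $$ (g, i) * v i) * (b $$ (g, j) * w j))"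
    by (rule sum.swap)
  also have "\<dots> = (\<Sum>g<l. cnj (\<Sum>i<n. a $$ (g, i) * v i) * (\<Sum>j<n. b $$ (g, j) * w j))"
    by (simp only: cnj_sum sum_product)
  finally show ?thesis .
qed

lemma mform_finsum:
  assumes "finite I" "\<And>i. i \<in> I \<Longrightarrow> f i \<in> carrier_mat n n"
  shows "mform n (finsum (matrix_alg n) f I) v w = (\<Sum>k\<in>I. mform n (f k) v w)"
proof -
  have "mform n (finsum (matrix_alg n) f I) v w =
      (\<Sum>i<n. \<Sum>j<n. \<Sum>k\<in>I. cnj (v i) * f k $$ (i, j) * w j)"
    unfolding mform_def using assms
    by (intro sum.cong refl) (auto simp: finsum_matrix_alg sum_distrib_left sum_distrib_right)
  also have "\<dots> = (\<Sum>i<n. \<Sum>k\<in>I. \<Sum>j<n. cnj (v i) * f k $$ (i, j) * w j)"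
    by (intro sum.cong refl sum.swap)
  also have "\<dots> = (\<Sum>k\<in>I. mform n (f k) v w)" unfolding mform_def by (rule sum.swap)
  finally show ?thesis .
qed

definition psd_blocks :: "nat \<Rightarrow> nat \<Rightarrow> (nat \<Rightarrow> nat \<Rightarrow> complex mat) \<Rightarrow> bool" where
  "psd_blocks n m a \<longleftrightarrow> (\<forall>V. (\<Sum>i<m. \<Sum>j<m. mform n (a i j) (V i) (V j)) \<in> \<real>\<^sub>\<ge>\<^sub>0)"

text \<open>The block matrix is flattened to a kernel on pairs of a block index and an entry index.
  A factor over the same pairs can be cut back into m by m blocks of size n, which is the shape that
  \<open>positive_matrix\<close> prescribes.\<close>

lemma positive_matrixI:
  assumes "psd_blocks n m a" "\<And>i j. i < m \<Longrightarrow> j < m \<Longrightarrow> a i j \<in> carrier_mat n n"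
  shows "positive_matrix (matrix_alg n) m a"
proof -
  let ?I = "{..<m} \<times> {..<n}"
  define k where "k = (\<lambda>(i, g) (j, h). a i j $$ (g, h))"
  have "psd_kernel ?I k"
    unfolding psd_kernel_def
  proof
    fix c :: "nat \<times> nat \<Rightarrow> complex"
    have "(\<Sum>p\<in>?I. \<Sum>q\<in>?I. cnj (c p) * k p q * c q) =
      (\<Sum>i<m. \<Sum>g<n. \<Sum>j<m. \<Sum>h<n. cnj (c (i, g)) * a i j $$ (g, h) * c (j, h))"
      unfolding k_def by (simp add: sum.cartesian_product')
    also have "\<dots> = (\<Sum>i<m. \<Sum>j<m. \<Sum>g<n. \<Sum>h<n. cnj (c (i, g)) * a i j $$ (g, h) * c (j, h))"
      by (intro sum.cong refl sum.swap)
    also have "\<dots> = (\<Sum>i<m. \<Sum>j<m. mform n (a i j) (\<lambda>g. c (i, g)) (\<lambda>h. c (j, h)))"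
      by (simp add: mform_def)
    finally show "(\<Sum>p\<in>?I. \<Sum>q\<in>?I. cnj (c p) * k p q * c q) \<in> \<real>\<^sub>\<ge>\<^sub>0"
      using assms(1) by (simp add: psd_blocks_def)
  qed
  then obtain L where L: "\<And>p q. p \<in> ?I \<Longrightarrow> q \<in> ?I \<Longrightarrow> k p q = (\<Sum>r\<in>?I. cnj (L r p) * L r q)"
    using psd_kernel_factor[of ?I k] by blast
  define b where "b l i = mat n n (\<lambda>(g, h). L (l, g) (i, h))" for l i
  have b: "b l i \<in> carrier_mat n n" for l i by (simp add: b_def)
  have "a i j = finsum (matrix_alg n) (\<lambda>l. mat_adjoint (b l i) * b l j) {..<m}"
    if ij: "i < m" "j < m" for i j
  proof (rule eq_matI)
    have c: "finsum (matrix_alg n) (\<lambda>l. mat_adjoint (b l i) * b l j) {..<m} \<in> carrier_mat n n"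
      by (intro finsum_matrix_alg mult_carrier_mat[OF mat_adjoint_carrier[OF b] b]) auto
    then show "dim_row (a i j) = dim_row (finsum (matrix_alg n) (\<lambda>l. mat_adjoint (b l i) * b l j) {..<m})"
      "dim_col (a i j) = dim_col (finsum (matrix_alg n) (\<lambda>l. mat_adjoint (b l i) * b l j) {..<m})"
      using assms(2)[OF ij] by auto
    fix g h assume "g < dim_row (finsum (matrix_alg n) (\<lambda>l. mat_adjoint (b l i) * b l j) {..<m})"
      "h < dim_col (finsum (matrix_alg n) (\<lambda>l. mat_adjoint (b l i) * b l j) {..<m})"
    with c have gh: "g < n" "h < n" by auto
    have "finsum (matrix_alg n) (\<lambda>l. mat_adjoint (b l i) * b l j) {..<m} $$ (g, h) =
        (\<Sum>l<m. (mat_adjoint (b l i) * b l j) $$ (g, h))"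
      by (intro finsum_matrix_alg gh mult_carrier_mat[OF mat_adjoint_carrier[OF b] b]) auto
    also have "\<dots> = (\<Sum>l<m. \<Sum>r<n. cnj (L (l, r) (i, g)) * L (l, r) (j, h))"
      using gh b
      by (intro sum.cong refl, subst mat_mult_index[OF mat_adjoint_carrier[OF b] b])
        (auto simp: mat_adjoint_index b_def intro!: sum.cong)
    also have "\<dots> = k (i, g) (j, h)"
      using ij gh by (subst L) (auto simp: sum.cartesian_product')
    finally show "a i j $$ (g, h) = finsum (matrix_alg n) (\<lambda>l. mat_adjoint (b l i) * b l j) {..<m} $$ (g, h)"
      by (simp add: k_def)
  qed
  then show ?thesis unfolding positive_matrix_def using b by (intro exI[of _ b]) simp
qed

text \<open>After moving the sums over the blocks inside, the form is a sum of squared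
  moduli.\<close>

lemma psd_blocks_sum_squares:
  fixes N :: nat
  assumes b: "\<And>l i. l < N \<Longrightarrow> i < m \<Longrightarrow> b l i \<in> carrier_mat n n"
    and a: "\<And>i j. i < m \<Longrightarrow> j < m \<Longrightarrow>
      a i j = finsum (matrix_alg n) (\<lambda>l. mat_adjoint (b l i) * b l j) {..<N}"
  shows "psd_blocks n m a"
  unfolding psd_blocks_def
proof
  fix V :: "nat \<Rightarrow> nat \<Rightarrow> complex"
  let ?u = "\<lambda>l i g. \<Sum>h<n. b l i $$ (g, h) * V i h"
  have "(\<Sum>i<m. \<Sum>j<m. mform n (a i j) (V i) (V j)) =
      (\<Sum>i<m. \<Sum>j<m. \<Sum>l<N. \<Sum>g<n. cnj (?u l i g) * ?u l j g)"
  proof (intro sum.cong refl)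
    fix i j assume ij: "i \<in> {..<m}" "j \<in> {..<m}"
    have "mform n (a i j) (V i) (V j) = (\<Sum>l<N. mform n (mat_adjoint (b l i) * b l j) (V i) (V j))"
      using ij b by (simp add: a, intro mform_finsum)
        (auto intro!: mult_carrier_mat[of _ n n] mat_adjoint_carrier)
    also have "\<dots> = (\<Sum>l<N. \<Sum>g<n. cnj (?u l i g) * ?u l j g)"
      using ij b by (intro sum.cong refl mform_adjoint_mult) auto
    finally show "mform n (a i j) (V i) (V j) = (\<Sum>l<N. \<Sum>g<n. cnj (?u l i g) * ?u l j g)" .
  qed
  also have "\<dots> = (\<Sum>i<m. \<Sum>l<N. \<Sum>j<m. \<Sum>g<n. cnj (?u l i g) * ?u l j g)"
    by (intro sum.cong refl sum.swap)
  also have "\<dots> = (\<Sum>l<N. \<Sum>i<m. \<Sum>j<m. \<Sum>g<n. cnj (?u l i g) * ?u l j g)" by (rule sum.swap)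
  also have "\<dots> = (\<Sum>l<N. \<Sum>i<m. \<Sum>g<n. \<Sum>j<m. cnj (?u l i g) * ?u l j g)"
    by (intro sum.cong refl sum.swap)
  also have "\<dots> = (\<Sum>l<N. \<Sum>g<n. \<Sum>i<m. \<Sum>j<m. cnj (?u l i g) * ?u l j g)"
    by (intro sum.cong refl sum.swap)
  also have "\<dots> = (\<Sum>l<N. \<Sum>g<n. cnj (\<Sum>i<m. ?u l i g) * (\<Sum>j<m. ?u l j g))"
    by (simp only: cnj_sum sum_product)
  also have "\<dots> \<in> \<real>\<^sub>\<ge>\<^sub>0" by (intro nonneg_Reals_sum cnj_mult_nonneg)
  finally show "(\<Sum>i<m. \<Sum>j<m. mform n (a i j) (V i) (V j)) \<in> \<real>\<^sub>\<ge>\<^sub>0" .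
qed

lemma positive_matrixD: "positive_matrix (matrix_alg n) m a \<Longrightarrow> psd_blocks n m a"
  unfolding positive_matrix_def
  by (elim exE) (rule psd_blocks_sum_squares, auto)

section \<open>C*-subalgebras of matrices\<close>

definition sq_norm :: "nat \<Rightarrow> (nat \<Rightarrow> complex) \<Rightarrow> real" where
  "sq_norm n v = (\<Sum>i<n. (cmod (v i))\<^sup>2)"

lemma sq_norm_nonneg: "0 \<le> sq_norm n v" by (simp add: sq_norm_def sum_nonneg)

lemma mform_add:
  "a \<in> carrier_mat n n \<Longrightarrow> b \<in> carrier_mat n n \<Longrightarrow> mform n (a + b) v w = mform n a v w + mform n b v w"
  by (simp add: mform_def algebra_simps sum.distrib)

lemma mform_smult: "a \<in> carrier_mat n n \<Longrightarrow> mform n (c \<cdot>\<^sub>m a) v w = c * mform n a v w"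
  by (simp add: mform_def sum_distrib_left algebra_simps)

lemma mform_one: "mform n (1\<^sub>m n) v v = complex_of_real (sq_norm n v)"
proof -
  have "mform n (1\<^sub>m n) v v = (\<Sum>i<n. \<Sum>j<n. if i = j then cnj (v i) * v j else 0)"
    unfolding mform_def by (intro sum.cong refl) auto
  also have "\<dots> = (\<Sum>i<n. cnj (v i) * v i)" by simp
  also have "\<dots> = complex_of_real (sq_norm n v)"
    unfolding sq_norm_def of_real_sum complex_norm_square by (simp add: mult.commute)
  finally show ?thesis .
qed

lemma mform_scale: "mform n a (\<lambda>i. c * v i) (\<lambda>i. d * w i) = cnj c * d * mform n a v w"
  by (simp add: mform_def sum_distrib_left algebra_simps)

lemma sq_norm_scale: "sq_norm n (\<lambda>i. c * v i) = (cmod c)\<^sup>2 * sq_norm n v"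
  by (simp add: sq_norm_def sum_distrib_left norm_mult power_mult_distrib)

lemma matrix_alg_minus:
  assumes "a \<in> carrier_mat n n" "b \<in> carrier_mat n n"
  shows "a \<ominus>\<^bsub>matrix_alg n\<^esub> b = a - b"
proof -
  have "\<ominus>\<^bsub>matrix_alg n\<^esub> b = - b"
    unfolding a_inv_def m_inv_def
  proof (rule the_equality)
    show "- b \<in> carrier (add_monoid (matrix_alg n)) \<and>
      b \<otimes>\<^bsub>add_monoid (matrix_alg n)\<^esub> - b = \<one>\<^bsub>add_monoid (matrix_alg n)\<^esub> \<and>
      - b \<otimes>\<^bsub>add_monoid (matrix_alg n)\<^esub> b = \<one>\<^bsub>add_monoid (matrix_alg n)\<^esub>"
      using assms(2) by (auto intro!: eq_matI)
    fix y assume y: "y \<in> carrier (add_monoid (matrix_alg n)) \<and>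
      b \<otimes>\<^bsub>add_monoid (matrix_alg n)\<^esub> y = \<one>\<^bsub>add_monoid (matrix_alg n)\<^esub> \<and>
      y \<otimes>\<^bsub>add_monoid (matrix_alg n)\<^esub> b = \<one>\<^bsub>add_monoid (matrix_alg n)\<^esub>"
    show "y = - b"
    proof (rule eq_matI)
      fix i j assume "i < dim_row (- b)" "j < dim_col (- b)"
      then have ij: "i < n" "j < n" using assms(2) by auto
      have yc: "y \<in> carrier_mat n n" and by0: "b + y = 0\<^sub>m n n" using y by auto
      have "b $$ (i, j) + y $$ (i, j) = (b + y) $$ (i, j)" using ij yc by simp
      also have "\<dots> = 0" unfolding by0 using ij by simp
      finally show "y $$ (i, j) = (- b) $$ (i, j)"
        using ij assms(2) by (auto simp: eq_neg_iff_add_eq_0 add.commute)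
    qed (use y assms(2) in auto)
  qed
  moreover have "a + - b = a - b" using assms by (auto intro!: eq_matI)
  ultimately show ?thesis by (simp add: a_minus_def)
qed

lemma vec_norm2_mult_le:
  assumes "a \<in> carrier_mat n n" "v \<in> carrier_vec n" "vec_norm2 v \<le> 1"
  shows "vec_norm2 (a *\<^sub>v v) \<le> (\<Sum>i<n. \<Sum>j<n. cmod (a $$ (i, j)))"
proof -
  have v: "cmod (vec_index v j) \<le> 1" if "j < n" for j
  proof -
    have "(cmod (vec_index v j))\<^sup>2 \<le> (\<Sum>i<n. (cmod (vec_index v i))\<^sup>2)"
      using that by (intro member_le_sum) auto
    then have "cmod (vec_index v j) \<le> vec_norm2 v"
      using assms(2) by (auto simp: vec_norm2_def intro: real_le_rsqrt)
    then show ?thesis using assms(3) by linarith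
  qed
  have "vec_norm2 (a *\<^sub>v v) = L2_set (\<lambda>i. cmod (vec_index (a *\<^sub>v v) i)) {..<n}"
    using assms(1) by (simp add: vec_norm2_def L2_set_def)
  also have "\<dots> \<le> (\<Sum>i<n. \<bar>cmod (vec_index (a *\<^sub>v v) i)\<bar>)" by (rule L2_set_le_sum_abs)
  also have "\<dots> \<le> (\<Sum>i<n. \<Sum>j<n. cmod (a $$ (i, j)))"
  proof (rule sum_mono)
    fix i assume i: "i \<in> {..<n}"
    have "vec_index (a *\<^sub>v v) i = (\<Sum>j<n. a $$ (i, j) * vec_index v j)"
      using i assms by (auto simp: scalar_prod_def atLeast0LessThan)
    also have "cmod \<dots> \<le> (\<Sum>j<n. cmod (a $$ (i, j)))"
      by (rule sum_norm_le) (use v in \<open>auto simp: norm_mult intro!: mult_left_le\<close>)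
    finally show "\<bar>cmod (vec_index (a *\<^sub>v v) i)\<bar> \<le> (\<Sum>j<n. cmod (a $$ (i, j)))" by simp
  qed
  finally show ?thesis .
qed

lemma nrm_matrix_alg_le:
  assumes "a \<in> carrier_mat n n"
  shows "nrm (matrix_alg n) a \<le> (\<Sum>i<n. \<Sum>j<n. cmod (a $$ (i, j)))" "0 \<le> nrm (matrix_alg n) a"
proof -
  let ?S = "{v \<in> carrier_vec n. vec_norm2 v \<le> 1}"
  have z: "0\<^sub>v n \<in> ?S" by (simp add: vec_norm2_def)
  show "nrm (matrix_alg n) a \<le> (\<Sum>i<n. \<Sum>j<n. cmod (a $$ (i, j)))"
    unfolding matrix_alg_def using z vec_norm2_mult_le[OF assms] by (auto intro!: cSUP_least)
  have "vec_norm2 (a *\<^sub>v 0\<^sub>v n) \<le> (SUP v\<in>?S. vec_norm2 (a *\<^sub>v v))"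
    by (rule cSUP_upper[OF z]) (use vec_norm2_mult_le[OF assms] in \<open>auto intro!: bdd_aboveI2\<close>)
  moreover have "0 \<le> vec_norm2 w" for w by (simp add: vec_norm2_def sum_nonneg)
  ultimately show "0 \<le> nrm (matrix_alg n) a" unfolding matrix_alg_def by (auto intro: order_trans)
qed

text \<open>The crude bound of the operator norm by the sum of the moduli of the entries suffices to
  make entrywise limits norm limits; norm-closed subalgebras therefore contain their entrywise
  limits.\<close>

lemma nrm_matrix_alg_tendsto:
  assumes "\<And>k. f k \<in> carrier_mat n n" "a \<in> carrier_mat n n"
    and "\<And>i j. i < n \<Longrightarrow> j < n \<Longrightarrow> (\<lambda>k. f k $$ (i, j)) \<longlonglongrightarrow> a $$ (i, j)"
  shows "(\<lambda>k. nrm (matrix_alg n) (f k \<ominus>\<^bsub>matrix_alg n\<^esub> a)) \<longlonglongrightarrow> 0"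
proof (rule Lim_null_comparison)
  show "\<forall>\<^sub>F k in sequentially. norm (nrm (matrix_alg n) (f k \<ominus>\<^bsub>matrix_alg n\<^esub> a)) \<le>
      (\<Sum>i<n. \<Sum>j<n. cmod (f k $$ (i, j) - a $$ (i, j)))"
  proof (intro always_eventually allI)
    fix k
    have c: "f k - a \<in> carrier_mat n n" using assms by auto
    have "(\<Sum>i<n. \<Sum>j<n. cmod ((f k - a) $$ (i, j))) = (\<Sum>i<n. \<Sum>j<n. cmod (f k $$ (i, j) - a $$ (i, j)))"
      using assms by (intro sum.cong refl) auto
    then show "norm (nrm (matrix_alg n) (f k \<ominus>\<^bsub>matrix_alg n\<^esub> a)) \<le>
      (\<Sum>i<n. \<Sum>j<n. cmod (f k $$ (i, j) - a $$ (i, j)))"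
      using nrm_matrix_alg_le[OF c] by (simp add: matrix_alg_minus assms)
  qed
  show "(\<lambda>k. \<Sum>i<n. \<Sum>j<n. cmod (f k $$ (i, j) - a $$ (i, j))) \<longlonglongrightarrow> 0"
    by (intro tendsto_null_sum tendsto_norm_zero) (use assms(3) in \<open>auto simp: LIM_zero_iff\<close>)
qed

lemma cstar_subalgebra_matrix_alg: "cstar_subalgebra (carrier_mat n n) (matrix_alg n)"
  unfolding cstar_subalgebra_def by (auto intro!: mat_adjoint_carrier)

locale matrix_subalgebra =
  fixes n :: nat and C :: "complex mat set"
  assumes subalgebra: "cstar_subalgebra C (matrix_alg n)" and one_mem: "1\<^sub>m n \<in> C"
begin

lemma mem_carrier: "a \<in> C \<Longrightarrow> a \<in> carrier_mat n n"
  and zero_mem: "0\<^sub>m n n \<in> C"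
  and add_mem: "a \<in> C \<Longrightarrow> b \<in> C \<Longrightarrow> a + b \<in> C"
  and mult_mem: "a \<in> C \<Longrightarrow> b \<in> C \<Longrightarrow> a * b \<in> C"
  and smult_mem: "a \<in> C \<Longrightarrow> c \<cdot>\<^sub>m a \<in> C"
  using subalgebra unfolding cstar_subalgebra_def by auto

lemma tendsto_mem:
  assumes "\<And>k. f k \<in> C" "a \<in> carrier_mat n n"
    and "\<And>i j. i < n \<Longrightarrow> j < n \<Longrightarrow> (\<lambda>k. f k $$ (i, j)) \<longlonglongrightarrow> a $$ (i, j)"
  shows "a \<in> C"
  using subalgebra nrm_matrix_alg_tendsto[of f n a] assms mem_carrier
  unfolding cstar_subalgebra_def by (metis matrix_alg_simps(1))

end

subsection \<open>Matrices as operators\<close>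

text \<open>Places a matrix in the upper left corner of an operator, so that the convergence of the
  square root iteration for operators carries over to matrices.\<close>

definition mat_op :: "nat \<Rightarrow> complex mat \<Rightarrow> ell2 \<Rightarrow>\<^sub>L ell2" where
  "mat_op n a = Blinfun (\<lambda>x. \<Sum>i<n. \<Sum>j<n. scaleC_ell2 (a $$ (i, j) * ell2_nth x j) (ket i))"

lemma mat_op_apply: "mat_op n a x = (\<Sum>i<n. \<Sum>j<n. scaleC_ell2 (a $$ (i, j) * ell2_nth x j) (ket i))"
proof -
  have "(\<lambda>x. ell2_nth x j) = cinner_ell2 (ket j)" for j by (simp add: fun_eq_iff cinner_ket)
  then have "bounded_linear (\<lambda>x. ell2_nth x j)" for j by (simp add: bounded_linear_cinner_right)
  then have "bounded_linear (\<lambda>x. scaleC_ell2 (c * ell2_nth x j) (ket i))" for c i j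
    by (intro bounded_linear_compose[OF bounded_linear_scaleC_left]
        bounded_linear_compose[OF bounded_linear_mult_right])
  then show ?thesis
    unfolding mat_op_def by (subst bounded_linear_Blinfun_apply) (intro bounded_linear_sum, auto)
qed

lemma ell2_nth_sum: "ell2_nth (sum f I) i = (\<Sum>k\<in>I. ell2_nth (f k) i)"
  by (induction I rule: infinite_finite_induct) (simp_all add: ell2_nth_simps)

lemma mat_op_nth: "ell2_nth (mat_op n a x) i = (if i < n then \<Sum>j<n. a $$ (i, j) * ell2_nth x j else 0)"
proof -
  have "ell2_nth (mat_op n a x) i =
      (\<Sum>i'<n. if i' = i then \<Sum>j<n. a $$ (i', j) * ell2_nth x j else 0)"
    unfolding mat_op_apply ell2_nth_sum by (intro sum.cong refl) (auto simp: ell2_nth_simps ket.rep_eq)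
  then show ?thesis by simp
qed

lemma clinear_mat_op: "clinear_ell2 (mat_op n a)"
  unfolding clinear_ell2_def
  by (auto intro!: ell2_eqI simp: mat_op_nth ell2_nth_simps sum_distrib_left algebra_simps)

lemma cinner_mat_op_right: "cinner_ell2 u (mat_op n a v) = mform n a (ell2_nth u) (ell2_nth v)"
  unfolding mat_op_apply mform_def
  by (simp add: cinner_sum_right cinner_scaleC_right cinner_ket algebra_simps)

lemma selfadj_mat_op:
  assumes "\<And>i j. i < n \<Longrightarrow> j < n \<Longrightarrow> a $$ (j, i) = cnj (a $$ (i, j))"
  shows "selfadj (mat_op n a)"
  unfolding selfadj_def
proof (intro conjI clinear_mat_op allI)
  fix u v
  have "cinner_ell2 (mat_op n a u) v = cnj (mform n a (ell2_nth v) (ell2_nth u))"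
    by (metis cinner_mat_op_right cinner_commute)
  also have "\<dots> = (\<Sum>i<n. \<Sum>j<n. cnj (ell2_nth u j) * a $$ (j, i) * ell2_nth v i)"
    unfolding mform_def cnj_sum
  proof (intro sum.cong refl)
    fix i j assume "i \<in> {..<n}" "j \<in> {..<n}"
    then have "a $$ (j, i) = cnj (a $$ (i, j))" by (intro assms) auto
    then show "cnj (cnj (ell2_nth v i) * a $$ (i, j) * ell2_nth u j) = cnj (ell2_nth u j) * a $$ (j, i) * ell2_nth v i"
      by simp
  qed
  also have "\<dots> = mform n a (ell2_nth u) (ell2_nth v)" unfolding mform_def by (rule sum.swap)
  finally show "cinner_ell2 (mat_op n a u) v = cinner_ell2 u (mat_op n a v)"
    by (simp add: cinner_mat_op_right)
qed

lemma mat_op_mult: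
  assumes "a \<in> carrier_mat n n" "b \<in> carrier_mat n n"
  shows "mat_op n (a * b) = mat_op n a o\<^sub>L mat_op n b"
proof (rule blinfun_eqI, rule ell2_eqI)
  fix x i
  have "(\<Sum>j<n. (a * b) $$ (i, j) * ell2_nth x j) = (\<Sum>j<n. a $$ (i, j) * (\<Sum>l<n. b $$ (j, l) * ell2_nth x l))"
    if "i < n"
  proof -
    have "(\<Sum>j<n. (a * b) $$ (i, j) * ell2_nth x j) = (\<Sum>j<n. \<Sum>l<n. a $$ (i, l) * b $$ (l, j) * ell2_nth x j)"
      using that assms by (intro sum.cong refl) (simp add: mat_mult_index[of a n n b n] sum_distrib_right del: index_mult_mat(1))
    also have "\<dots> = (\<Sum>l<n. \<Sum>j<n. a $$ (i, l) * b $$ (l, j) * ell2_nth x j)" by (rule sum.swap)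
    finally show ?thesis by (simp add: sum_distrib_left mult.assoc)
  qed
  then show "ell2_nth (mat_op n (a * b) x) i = ell2_nth ((mat_op n a o\<^sub>L mat_op n b) x) i"
    by (simp add: mat_op_nth)
qed

lemma mat_op_add:
  assumes "a \<in> carrier_mat n n" "b \<in> carrier_mat n n"
  shows "mat_op n (a + b) = mat_op n a + mat_op n b"
proof (rule blinfun_eqI, rule ell2_eqI)
  fix x i show "ell2_nth (mat_op n (a + b) x) i = ell2_nth ((mat_op n a + mat_op n b) x) i"
    using assms by (simp add: mat_op_nth ell2_nth_simps blinfun.add_left sum.distrib algebra_simps)
qed

lemma mat_op_smult:
  assumes "a \<in> carrier_mat n n" shows "mat_op n (complex_of_real c \<cdot>\<^sub>m a) = c *\<^sub>R mat_op n a"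
proof (rule blinfun_eqI, rule ell2_eqI)
  fix x i show "ell2_nth (mat_op n (complex_of_real c \<cdot>\<^sub>m a) x) i = ell2_nth ((c *\<^sub>R mat_op n a) x) i"
    using assms by (simp add: mat_op_nth ell2_nth_simps blinfun.scaleR_left sum_distrib_left algebra_simps)
qed

lemma mat_op_ket: "i < n \<Longrightarrow> j < n \<Longrightarrow> ell2_nth (mat_op n a (ket j)) i = a $$ (i, j)"
  by (simp add: mat_op_nth ket.rep_eq if_distrib[where f = "(*) x" for x] cong: if_cong)

lemma mform_psd_kernel:
  assumes "\<And>v. mform n h v v \<in> \<real>\<^sub>\<ge>\<^sub>0" shows "psd_kernel {..<n} (\<lambda>i j. h $$ (i, j))"
  using assms by (simp add: psd_kernel_def mform_def)

text \<open>The factor must lie in \<open>C\<close>, not merely among all n by n matrices, because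
  positivity over a generated subalgebra asks for factors from that subalgebra. The iterates are
  polynomials in \<open>h\<close>, hence in \<open>C\<close>, and their convergence is imported from
  the operator picture.\<close>

lemma (in matrix_subalgebra) sqrt_exists:
  assumes h: "h \<in> C" "\<And>v. mform n h v v \<in> \<real>\<^sub>\<ge>\<^sub>0"
  shows "\<exists>b\<in>C. mat_adjoint b * b = h"
proof -
  have hc: "h \<in> carrier_mat n n" by (rule mem_carrier[OF h(1)])
  have herm: "h $$ (j, i) = cnj (h $$ (i, j))" if "i < n" "j < n" for i j
    using psd_kernel_hermitian[OF mform_psd_kernel[OF h(2)] finite_lessThan, of i j] that by simp
  have sa: "selfadj (mat_op n h)" by (rule selfadj_mat_op[OF herm])
  have pos: "0 \<le> inner v (mat_op n h v)" for v
    using h(2)[of "ell2_nth v"] by (simp add: inner_ell2_def cinner_mat_op_right complex_nonneg_Reals_iff)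
  define M where "M = norm (mat_op n h) + 1"
  have M: "0 < M" "norm (mat_op n h) \<le> M" by (auto simp: M_def add_nonneg_pos)
  define s where "s = 1\<^sub>m n + complex_of_real (-1/M) \<cdot>\<^sub>m h"
  have sC: "s \<in> C" unfolding s_def by (intro add_mem one_mem smult_mem h)
  note sc = mem_carrier[OF sC]
  \<comment> \<open>The identity matrix becomes the coordinate projection \<open>low n\<close>; its
    norm is at most 1, so the contraction estimate is not affected.\<close>
  have "mat_op n s = (id_blinfun - (1/M) *\<^sub>R mat_op n h) o\<^sub>L low n"
  proof (rule blinfun_eqI, rule ell2_eqI)
    fix x i
    have "(\<Sum>j<n. s $$ (i, j) * ell2_nth x j) = ell2_nth x i + (\<Sum>j<n. - (1/M) * h $$ (i, j) * ell2_nth x j)"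
      if "i < n"
    proof -
      have "(\<Sum>j<n. s $$ (i, j) * ell2_nth x j) =
          (\<Sum>j<n. (if j = i then ell2_nth x j else 0) + - (1/M) * h $$ (i, j) * ell2_nth x j)"
        using that hc by (intro sum.cong refl) (auto simp: s_def algebra_simps)
      then show ?thesis using that by (simp add: sum.distrib sum_subtractf sum_negf)
    qed
    then show "ell2_nth (mat_op n s x) i = ell2_nth (((id_blinfun - (1/M) *\<^sub>R mat_op n h) o\<^sub>L low n) x) i"
      by (simp add: mat_op_nth low_nth blinfun.bilinear_simps ell2_nth_simps sum_distrib_left sum_negf sum_divide_distrib algebra_simps)
  qed
  then have "norm (mat_op n s) \<le> norm (id_blinfun - (1/M) *\<^sub>R mat_op n h) * norm (low n)"
    using norm_blinfun_compose by metis
  also have "\<dots> \<le> 1 * 1"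
    by (intro mult_mono norm_one_minus_le sa pos M norm_low_le) auto
  finally obtain y where y: "sqrt_iter (mat_op n s) \<longlonglongrightarrow> y"
    using sqrt_iter_converges by (metis mult_1)
  \<comment> \<open>The same recursion as \<open>sqrt_iter\<close>, run on matrices so that
    membership in \<open>C\<close> can be followed.\<close>
  define z where "z = rec_nat (0\<^sub>m n n) (\<lambda>_ w. complex_of_real (1/2) \<cdot>\<^sub>m (s + w * w))"
  have z: "z 0 = 0\<^sub>m n n" "z (Suc k) = complex_of_real (1/2) \<cdot>\<^sub>m (s + z k * z k)" for k by (simp_all add: z_def)
  have zC: "z k \<in> C" for k
    by (induction k) (simp_all only: z zero_mem smult_mem add_mem mult_mem sC)
  note zc = mem_carrier[OF zC]
  have zz: "(z k * z k) $$ (i, j) = (\<Sum>g<n. z k $$ (i, g) * z k $$ (g, j))" if "i < n" "j < n" for i j k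
    by (rule mat_mult_index[OF zc zc that])
  have zS: "z (Suc k) $$ (i, j) = (1/2) * (s $$ (i, j) + (\<Sum>g<n. z k $$ (i, g) * z k $$ (g, j)))"
    if "i < n" "j < n" for i j k
    using that sc zc[of k] by (simp add: z zz[symmetric] del: index_mult_mat(1))
  have op: "mat_op n (z k) = sqrt_iter (mat_op n s) k" for k
  proof (induction k)
    case 0
    show ?case by (rule blinfun_eqI, rule ell2_eqI) (simp add: z mat_op_nth zero_ell2.rep_eq)
  next
    case (Suc k)
    have "z k * z k \<in> carrier_mat n n" by (rule mult_carrier_mat[OF zc zc])
    then show ?case unfolding z using sc zc[of k] Suc
      by (simp only: mat_op_smult[OF add_carrier_mat] mat_op_add mat_op_mult sqrt_iter.simps)
  qed
  define Z where "Z = mat n n (\<lambda>(i, j). ell2_nth (y (ket j)) i)"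
  have Zc: "Z \<in> carrier_mat n n" by (simp add: Z_def)
  have lim: "(\<lambda>k. z k $$ (i, j)) \<longlonglongrightarrow> Z $$ (i, j)" if "i < n" "j < n" for i j
  proof -
    have "(\<lambda>k. cinner_ell2 (ket i) (sqrt_iter (mat_op n s) k (ket j))) \<longlonglongrightarrow> cinner_ell2 (ket i) (y (ket j))"
      by (intro bounded_linear.tendsto[OF bounded_linear_cinner_right] blinfun.tendsto y tendsto_const)
    then show ?thesis using that by (simp add: cinner_ket op[symmetric] mat_op_ket Z_def)
  qed
  have ZC: "Z \<in> C" by (rule tendsto_mem[OF zC Zc lim])
  have zherm: "z k $$ (j, i) = cnj (z k $$ (i, j))" if "i < n" "j < n" for i j k
    using that
  proof (induction k arbitrary: i j)
    case (Suc k)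
    have "s $$ (j, i) = cnj (s $$ (i, j))" using Suc(2,3) hc herm[OF Suc(2,3)] by (simp add: s_def)
    moreover have "(\<Sum>g<n. z k $$ (j, g) * z k $$ (g, i)) = cnj (\<Sum>g<n. z k $$ (i, g) * z k $$ (g, j))"
      unfolding cnj_sum
    proof (intro sum.cong refl)
      fix g assume "g \<in> {..<n}"
      then show "z k $$ (j, g) * z k $$ (g, i) = cnj (z k $$ (i, g) * z k $$ (g, j))"
        using Suc.IH[of g j] Suc.IH[of i g] Suc(2,3) by (simp add: mult.commute)
    qed
    ultimately show ?case using Suc(2,3) by (simp add: zS)
  qed (simp add: z)
  have Zherm: "Z $$ (j, i) = cnj (Z $$ (i, j))" if "i < n" "j < n" for i j
  proof -
    have "(\<lambda>k. cnj (z k $$ (i, j))) \<longlonglongrightarrow> cnj (Z $$ (i, j))" by (intro tendsto_cnj lim that)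
    then have "(\<lambda>k. z k $$ (j, i)) \<longlonglongrightarrow> cnj (Z $$ (i, j))" using that by (simp add: zherm[symmetric])
    then show ?thesis using lim[OF that(2,1)] LIMSEQ_unique by blast
  qed
  have Zeq: "2 * Z $$ (i, j) = s $$ (i, j) + (\<Sum>g<n. Z $$ (i, g) * Z $$ (g, j))" if "i < n" "j < n" for i j
  proof -
    have "(\<lambda>k. 2 * z (Suc k) $$ (i, j)) \<longlonglongrightarrow> 2 * Z $$ (i, j)"
      by (intro tendsto_intros LIMSEQ_Suc lim that)
    moreover have "(\<lambda>k. s $$ (i, j) + (\<Sum>g<n. z k $$ (i, g) * z k $$ (g, j)))
        \<longlonglongrightarrow> s $$ (i, j) + (\<Sum>g<n. Z $$ (i, g) * Z $$ (g, j))"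
      by (intro tendsto_add tendsto_const tendsto_sum tendsto_mult lim) (use that in auto)
    then have "(\<lambda>k. 2 * z (Suc k) $$ (i, j)) \<longlonglongrightarrow> s $$ (i, j) + (\<Sum>g<n. Z $$ (i, g) * Z $$ (g, j))"
      by (simp add: zS[OF that] add_divide_distrib)
    ultimately show ?thesis by (rule LIMSEQ_unique)
  qed
  define b where "b = complex_of_real (sqrt M) \<cdot>\<^sub>m (1\<^sub>m n + (-1) \<cdot>\<^sub>m Z)"
  have bC: "b \<in> C" unfolding b_def by (intro smult_mem add_mem one_mem ZC)
  note bc = mem_carrier[OF bC]
  have bi: "b $$ (i, j) = complex_of_real (sqrt M) * ((if i = j then 1 else 0) - Z $$ (i, j))"
    if "i < n" "j < n" for i j using that Zc by (simp add: b_def)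
  have "mat_adjoint b * b = h"
  proof (rule eq_matI)
    fix i j assume "i < dim_row h" "j < dim_col h"
    then have ij: "i < n" "j < n" using hc by auto
    have sq: "complex_of_real (sqrt M) * complex_of_real (sqrt M) = complex_of_real M"
      using M(1) by (metis of_real_mult real_sqrt_mult_self abs_of_pos)
    have "(mat_adjoint b * b) $$ (i, j) = (\<Sum>g<n. cnj (b $$ (g, i)) * b $$ (g, j))"
      using ij bc by (subst mat_mult_index[OF mat_adjoint_carrier[OF bc] bc ij])
        (auto simp: mat_adjoint_index intro!: sum.cong)
    \<comment> \<open>With \<open>Z\<close> hermitian, the adjoint of \<open>b\<close> times
      \<open>b\<close> is M (1 - 2 Z + Z Z). By \<open>Zeq\<close> this is M (1 - s), that is,
      \<open>h\<close>.\<close>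
    also have "\<dots> = (\<Sum>g<n. complex_of_real M *
        ((if g = i then (if i = j then 1 else 0) - Z $$ (i, j) else 0) - (if g = j then Z $$ (i, j) else 0)
         + Z $$ (i, g) * Z $$ (g, j)))"
    proof (intro sum.cong refl)
      fix g assume "g \<in> {..<n}"
      then have g: "g < n" by simp
      have "cnj (b $$ (g, i)) * b $$ (g, j) = (complex_of_real (sqrt M) * complex_of_real (sqrt M)) *
        (((if g = i then 1 else 0) - Z $$ (i, g)) * ((if g = j then 1 else 0) - Z $$ (g, j)))"
      proof -
        have "cnj (b $$ (g, i)) = complex_of_real (sqrt M) * ((if g = i then 1 else 0) - Z $$ (i, g))"
          unfolding bi[OF g ij(1)] Zherm[OF g ij(1)] by simp
        then show ?thesis by (simp add: bi[OF g ij(2)] mult.assoc mult.left_commute)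
      qed
      then show "cnj (b $$ (g, i)) * b $$ (g, j) = complex_of_real M *
        ((if g = i then (if i = j then 1 else 0) - Z $$ (i, j) else 0) - (if g = j then Z $$ (i, j) else 0)
         + Z $$ (i, g) * Z $$ (g, j))"
        unfolding sq by (auto simp: algebra_simps)
    qed
    also have "\<dots> = complex_of_real M * ((if i = j then 1 else 0) - 2 * Z $$ (i, j) + (\<Sum>g<n. Z $$ (i, g) * Z $$ (g, j)))"
      using ij unfolding sum_distrib_left[symmetric] by (simp add: sum.distrib sum_subtractf)
    also have "\<dots> = complex_of_real M * ((if i = j then 1 else 0) - s $$ (i, j))"
      using Zeq[OF ij] by simp
    also have "\<dots> = h $$ (i, j)" using ij hc M(1) by (simp add: s_def field_simps)
    finally show "(mat_adjoint b * b) $$ (i, j) = h $$ (i, j)" .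
  qed (use hc bc mat_adjoint_carrier[OF bc] in auto)
  then show ?thesis using bC by blast
qed

section \<open>Maximal matrix convex sets\<close>

lemma finite_univ: "finite (UNIV :: 'a::finite set)"
  by simp

lemma abelian_monoid_matrix_alg_gen:
  assumes "cstar_subalgebra (carrier (cstar_gen (matrix_alg n) S)) (matrix_alg n)"
  shows "abelian_monoid (cstar_gen (matrix_alg n) S)"
    and "carrier (cstar_gen (matrix_alg n) S) \<subseteq> carrier_mat n n"
    and "0\<^sub>m n n \<in> carrier (cstar_gen (matrix_alg n) S)"
    and "\<And>x y. x \<in> carrier (cstar_gen (matrix_alg n) S) \<Longrightarrow>
      y \<in> carrier (cstar_gen (matrix_alg n) S) \<Longrightarrow> x + y \<in> carrier (cstar_gen (matrix_alg n) S)"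
proof -
  let ?C = "carrier (cstar_gen (matrix_alg n) S)"
  show c: "?C \<subseteq> carrier_mat n n" and z: "0\<^sub>m n n \<in> ?C"
    using assms unfolding cstar_subalgebra_def matrix_alg_simps by blast+
  show add: "x + y \<in> ?C" if "x \<in> ?C" "y \<in> ?C" for x y
    using assms that unfolding cstar_subalgebra_def matrix_alg_simps by blast
  have "x + y + z = x + (y + z)" "x + y = y + x" "0\<^sub>m n n + x = x"
    if "x \<in> ?C" "y \<in> ?C" "z \<in> ?C" for x y z
  proof -
    have "x \<in> carrier_mat n n" "y \<in> carrier_mat n n" "z \<in> carrier_mat n n" using that c by blast+
    then show "x + y + z = x + (y + z)" "x + y = y + x" "0\<^sub>m n n + x = x" by auto
  qed
  then show "abelian_monoid (cstar_gen (matrix_alg n) S)"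
    by (intro abelian_monoidI) (simp_all add: z add)
qed

lemma finsum_matrix_alg_gen:
  assumes sub: "cstar_subalgebra (carrier (cstar_gen (matrix_alg n) S)) (matrix_alg n)"
    and f: "finite I" "\<And>i. i \<in> I \<Longrightarrow> f i \<in> carrier (cstar_gen (matrix_alg n) S)"
  shows "finsum (cstar_gen (matrix_alg n) S) f I = finsum (matrix_alg n) f I"
    and "finsum (matrix_alg n) f I \<in> carrier (cstar_gen (matrix_alg n) S)"
proof -
  let ?G = "cstar_gen (matrix_alg n) S"
  note A = abelian_monoid_matrix_alg_gen[OF sub]
  note c = A(2)
  have G: "finsum ?G f I \<in> carrier ?G"
    "\<And>i j. i < n \<Longrightarrow> j < n \<Longrightarrow> finsum ?G f I $$ (i, j) = (\<Sum>k\<in>I. f k $$ (i, j))"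
    using sum_mat_index[of ?G n I f] f A(2-4) by simp_all
  have f': "\<And>i. i \<in> I \<Longrightarrow> f i \<in> carrier_mat n n" using f c by auto
  note M = finsum_matrix_alg[OF f(1) f', of "\<lambda>i. i"]
  show eq: "finsum ?G f I = finsum (matrix_alg n) f I"
    by (rule eq_matI) (use G M c in \<open>auto simp: subset_iff\<close>)
  show "finsum (matrix_alg n) f I \<in> carrier ?G" using G(1) eq by simp
qed

section \<open>Positivity under unital completely positive maps\<close>

lemma positive_matrix_one:
  assumes "abelian_monoid A" "b \<in> carrier A" "mult A (adj A b) b \<in> carrier A"
  shows "positive_matrix A 1 (\<lambda>_ _. mult A (adj A b) b)"
proof -
  interpret abelian_monoid A by fact
  have "finsum A (\<lambda>_. mult A (adj A b) b) {0::nat} = mult A (adj A b) b"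
    using assms by (subst finsum_insert) auto
  moreover have "{..<1} = {0::nat}" by auto
  ultimately show ?thesis unfolding positive_matrix_def using assms by (intro exI[of _ "\<lambda>_ _. b"]) simp
qed

lemma ucp_form_nonneg:
  assumes "abelian_monoid A" "\<psi> \<in> ucp_maps A (matrix_alg n)" "b \<in> carrier A" "mult A (adj A b) b \<in> carrier A"
  shows "mform n (\<psi> (mult A (adj A b) b)) v v \<in> \<real>\<^sub>\<ge>\<^sub>0"
proof -
  have "positive_matrix (matrix_alg n) 1 (\<lambda>_ _. \<psi> (mult A (adj A b) b))"
    using assms(2) positive_matrix_one[OF assms(1,3,4)] unfolding ucp_maps_def completely_positive_def
    by fastforce
  from positive_matrixD[OF this] show ?thesis
    unfolding psd_blocks_def by (auto dest: spec[of _ "\<lambda>_. v"])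
qed

lemma
  assumes "\<psi> \<in> ucp_maps A (matrix_alg n)"
  shows ucp_carrier: "y \<in> carrier A \<Longrightarrow> \<psi> y \<in> carrier_mat n n"
    and ucp_add: "y \<in> carrier A \<Longrightarrow> z \<in> carrier A \<Longrightarrow> \<psi> (add A y z) = \<psi> y + \<psi> z"
    and ucp_smult: "y \<in> carrier A \<Longrightarrow> \<psi> (smult A c y) = c \<cdot>\<^sub>m \<psi> y"
    and ucp_one: "\<psi> (one A) = 1\<^sub>m n"
  using assms by (auto simp: ucp_maps_def linear_maps_def)

text \<open>In the target positivity is checked on forms, so no factorization of the image has to be
  exhibited.\<close>

lemma completely_positive_matrixI:
  assumes "\<And>m y V. positive_matrix A m y \<Longrightarrow>
      (\<Sum>i<m. \<Sum>j<m. mform n (\<phi> (y i j)) (V i) (V j)) \<in> \<real>\<^sub>\<ge>\<^sub>0"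
    and "\<And>m y i j. positive_matrix A m y \<Longrightarrow> i < m \<Longrightarrow> j < m \<Longrightarrow> \<phi> (y i j) \<in> carrier_mat n n"
  shows "completely_positive A (matrix_alg n) \<phi>"
  unfolding completely_positive_def
  by (intro allI impI positive_matrixI) (use assms in \<open>auto simp: psd_blocks_def\<close>)

lemma
  fixes a :: "'d::finite \<Rightarrow> complex mat"
  assumes a: "\<And>k. a k \<in> carrier_mat n n"
  shows op_system_matrix_subset: "op_system (matrix_alg n) a \<subseteq> carrier_mat n n"
    and mem_op_system_matrix: "a l \<in> op_system (matrix_alg n) a"
    and one_mem_op_system_matrix: "1\<^sub>m n \<in> op_system (matrix_alg n) a"
proof -
  let ?t = "\<lambda>\<alpha> \<beta> k. (\<alpha> k \<cdot>\<^sub>m a k) + (\<beta> k \<cdot>\<^sub>m mat_adjoint (a k))"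
  have t: "?t \<alpha> \<beta> k \<in> carrier_mat n n" for \<alpha> \<beta> :: "'d \<Rightarrow> complex" and k
    using a mat_adjoint_carrier[OF a] by (intro add_carrier_mat smult_carrier_mat) auto
  have S: "op_system (matrix_alg n) a =
      {c \<cdot>\<^sub>m 1\<^sub>m n + finsum (matrix_alg n) (?t \<alpha> \<beta>) UNIV | c \<alpha> \<beta>. True}"
    by (simp add: op_system_def)
  have F: "finsum (matrix_alg n) (?t \<alpha> \<beta>) UNIV \<in> carrier_mat n n" for \<alpha> \<beta> :: "'d \<Rightarrow> complex"
    by (rule finsum_matrix_alg(1)[OF finite_univ t])
  have F2: "finsum (matrix_alg n) (?t \<alpha> \<beta>) UNIV $$ (i, j) = (\<Sum>k\<in>UNIV. ?t \<alpha> \<beta> k $$ (i, j))"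
    if "i < n" "j < n" for \<alpha> \<beta> :: "'d \<Rightarrow> complex" and i j
    by (rule finsum_matrix_alg(2)[OF finite_univ t that])
  show "op_system (matrix_alg n) a \<subseteq> carrier_mat n n" unfolding S using F by auto
  have ti: "?t \<alpha> \<beta> k $$ (i, j) = \<alpha> k * a k $$ (i, j) + \<beta> k * cnj (a k $$ (j, i))"
    if "i < n" "j < n" for \<alpha> \<beta> k i j
    using that a[of k] mat_adjoint_carrier[OF a[of k]] by (auto simp: mat_adjoint_index)
  have "a l = 0 \<cdot>\<^sub>m 1\<^sub>m n + finsum (matrix_alg n) (?t (\<lambda>k. if k = l then 1 else 0) (\<lambda>_. 0)) UNIV"
  proof (rule eq_matI)
    fix i j assume "i < dim_row (0 \<cdot>\<^sub>m 1\<^sub>m n + finsum (matrix_alg n) (?t (\<lambda>k. if k = l then 1 else 0) (\<lambda>_. 0)) UNIV)"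
      "j < dim_col (0 \<cdot>\<^sub>m 1\<^sub>m n + finsum (matrix_alg n) (?t (\<lambda>k. if k = l then 1 else 0) (\<lambda>_. 0)) UNIV)"
    then have ij: "i < n" "j < n" using F[of "\<lambda>k. if k = l then 1 else 0" "\<lambda>_. 0"] by auto
    have "(\<Sum>k\<in>UNIV. ?t (\<lambda>k. if k = l then 1 else 0) (\<lambda>_. 0) k $$ (i, j)) = (\<Sum>k\<in>UNIV. if k = l then a k $$ (i, j) else 0)"
      using ti[OF ij, where \<alpha> = "\<lambda>k. if k = l then 1 else 0" and \<beta> = "\<lambda>_. 0"]
      by (intro sum.cong refl) simp
    then show "a l $$ (i, j) = (0 \<cdot>\<^sub>m 1\<^sub>m n + finsum (matrix_alg n) (?t (\<lambda>k. if k = l then 1 else 0) (\<lambda>_. 0)) UNIV) $$ (i, j)"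
      using ij F[of "\<lambda>k. if k = l then 1 else 0" "\<lambda>_. 0"] F2[OF ij, where \<alpha> = "\<lambda>k. if k = l then 1 else 0" and \<beta> = "\<lambda>_. 0"]
      by simp
  qed (use a[of l] F[of "\<lambda>k. if k = l then 1 else 0" "\<lambda>_. 0"] in auto)
  then show "a l \<in> op_system (matrix_alg n) a" unfolding S
    by (intro CollectI exI[of _ "0::complex"] exI[of _ "\<lambda>k. if k = l then 1 else 0"] exI[of _ "\<lambda>_. 0"] conjI TrueI)
  have "1\<^sub>m n = 1 \<cdot>\<^sub>m 1\<^sub>m n + finsum (matrix_alg n) (?t (\<lambda>_. 0) (\<lambda>_. 0)) UNIV"
  proof (rule eq_matI)
    fix i j assume "i < dim_row (1 \<cdot>\<^sub>m 1\<^sub>m n + finsum (matrix_alg n) (?t (\<lambda>_. 0) (\<lambda>_. 0)) UNIV)"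
      "j < dim_col (1 \<cdot>\<^sub>m 1\<^sub>m n + finsum (matrix_alg n) (?t (\<lambda>_. 0) (\<lambda>_. 0)) UNIV)"
    then have ij: "i < n" "j < n" using F[of "\<lambda>_. 0" "\<lambda>_. 0"] by auto
    show "1\<^sub>m n $$ (i, j) = (1 \<cdot>\<^sub>m 1\<^sub>m n + finsum (matrix_alg n) (?t (\<lambda>_. 0) (\<lambda>_. 0)) UNIV) $$ (i, j)"
      using ij F[of "\<lambda>_. 0" "\<lambda>_. 0"] F2[OF ij, where \<alpha> = "\<lambda>_. 0" and \<beta> = "\<lambda>_. 0"] ti[OF ij, where \<alpha> = "\<lambda>_. 0" and \<beta> = "\<lambda>_. 0"] by simp
  qed (use F[of "\<lambda>_. 0" "\<lambda>_. 0"] in auto)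
  then show "1\<^sub>m n \<in> op_system (matrix_alg n) a" unfolding S
    by (intro CollectI exI[of _ "1::complex"] exI[of _ "\<lambda>_. 0"] conjI TrueI)
qed

lemma matrix_subalgebra_gen:
  fixes a :: "'d::finite \<Rightarrow> complex mat"
  assumes a: "\<And>k. a k \<in> carrier_mat n n"
  shows "matrix_subalgebra n (carrier (cstar_gen (matrix_alg n) (op_system (matrix_alg n) a)))"
proof
  show "cstar_subalgebra (carrier (cstar_gen (matrix_alg n) (op_system (matrix_alg n) a))) (matrix_alg n)"
    by (rule cstar_subalgebra_gen[OF cstar_subalgebra_matrix_alg op_system_matrix_subset[of a, OF a]])
  show "1\<^sub>m n \<in> carrier (cstar_gen (matrix_alg n) (op_system (matrix_alg n) a))"
    by (rule subsetD[OF subset_cstar_gen one_mem_op_system_matrix[of a, OF a]])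
qed

section \<open>Joint numerical ranges and half-spaces\<close>

lemma closed_convex_halfspaces:
  fixes S :: "'a::euclidean_space set"
  assumes "closed S" "convex S" "\<And>u c. (\<And>q. q \<in> S \<Longrightarrow> inner u q \<le> c) \<Longrightarrow> inner u p \<le> c"
  shows "p \<in> S"
proof (rule ccontr)
  assume "p \<notin> S"
  then obtain a b where ab: "inner a p < b" "\<forall>x\<in>S. inner a x > b"
    using separating_hyperplane_closed_point assms by metis
  then have "inner (- a) p \<le> - b" by (intro assms(3)) (auto intro: less_imp_le)
  then show False using ab by simp
qed

text \<open>Realness of \<open>z\<close> is part of the conclusion: the coordinate direction with a
  bound \<open>R\<close> on \<open>K\<close> already forces the imaginary part of that coordinate to
  vanish. The real point then satisfies all half-spaces that contain \<open>K\<close>.\<close>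

lemma complex_point_mem:
  fixes K :: "(real ^ 'd::finite) set"
  assumes K: "compact K" "convex K"
    and z: "\<And>u c. (\<And>q. q \<in> K \<Longrightarrow> inner u q \<le> c) \<Longrightarrow>
      complex_of_real c - (\<Sum>k\<in>UNIV. complex_of_real (vec_nth u k) * z k) \<in> \<real>\<^sub>\<ge>\<^sub>0"
  shows "\<exists>p\<in>K. \<forall>k. z k = complex_of_real (vec_nth p k)"
proof -
  have "bounded K" by (rule compact_imp_bounded[OF K(1)])
  then obtain R where R: "\<And>q. q \<in> K \<Longrightarrow> norm q \<le> R" unfolding bounded_iff by blast
  have im: "Im (z k) = 0" for k
  proof -
    have "inner (axis k 1) q \<le> R" if "q \<in> K" for q
      using R[OF that] component_le_norm_cart[of q k] by (simp add: inner_axis')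
    from z[OF this] have "complex_of_real R - (\<Sum>l\<in>UNIV. complex_of_real (vec_nth (axis k 1) l) * z l) \<in> \<real>\<^sub>\<ge>\<^sub>0" .
    moreover have "(\<Sum>l\<in>UNIV. complex_of_real (vec_nth (axis k 1) l) * z l) = (\<Sum>l\<in>UNIV. if l = k then z l else 0)"
      by (intro sum.cong refl) (simp add: axis_def)
    ultimately show ?thesis by (simp add: complex_nonneg_Reals_iff)
  qed
  define p where "p = (\<chi> k. Re (z k))"
  have zp: "z k = complex_of_real (vec_nth p k)" for k using im by (simp add: p_def complex_eq_iff)
  have "p \<in> K"
  proof (rule closed_convex_halfspaces)
    fix u c assume "\<And>q. q \<in> K \<Longrightarrow> inner u q \<le> c"
    then have "complex_of_real c - (\<Sum>k\<in>UNIV. complex_of_real (vec_nth u k) * z k) \<in> \<real>\<^sub>\<ge>\<^sub>0" by (rule z)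
    then show "inner u p \<le> c" by (simp add: zp complex_nonneg_Reals_iff inner_vec_def)
  qed (use K compact_imp_closed in auto)
  then show ?thesis using zp by blast
qed

text \<open>One point \<open>p\<close> must serve all coordinates of the tuple at once.\<close>

definition forms_in :: "nat \<Rightarrow> (real ^ 'd) set \<Rightarrow> ('d \<Rightarrow> complex mat) \<Rightarrow> bool" where
  "forms_in n K a \<longleftrightarrow> (\<forall>v. sq_norm n v = 1 \<longrightarrow>
     (\<exists>p\<in>K. \<forall>k. mform n (a k) v v = complex_of_real (vec_nth p k)))"

lemma mform_normalize:
  assumes "sq_norm n v \<noteq> 0"
  shows "\<exists>w. sq_norm n w = 1 \<and> (\<forall>a. mform n a v v = complex_of_real (sq_norm n v) * mform n a w w)"
proof -
  define r where "r = sqrt (sq_norm n v)"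
  have r: "r > 0" "r * r = sq_norm n v" using assms sq_norm_nonneg[of n v] by (auto simp: r_def)
  define w where "w i = complex_of_real (1/r) * v i" for i
  have "sq_norm n w = (1/r)\<^sup>2 * (r * r)" unfolding w_def sq_norm_scale r(2) using r(1) by (simp add: norm_divide)
  then have "sq_norm n w = 1" using r(1) by (simp add: power2_eq_square)
  moreover have v: "v = (\<lambda>i. complex_of_real r * w i)" using r(1) by (auto simp: w_def)
  have "mform n a v v = complex_of_real (r * r) * mform n a w w" for a
    by (subst v, subst v, subst mform_scale) simp
  ultimately show ?thesis unfolding r(2) by blast
qed

lemma mform_zero:
  assumes "sq_norm n v = 0" shows "mform n a v v = 0"
proof -
  have "v i = 0" if "i < n" for i using that assms by (simp add: sq_norm_def sum_nonneg_eq_0_iff)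
  then show ?thesis by (simp add: mform_def)
qed

lemma forms_in_scaled:
  assumes "forms_in n K a" "K \<noteq> {}"
  shows "\<exists>p\<in>K. \<forall>k. mform n (a k) v v = complex_of_real (sq_norm n v * vec_nth p k)"
proof (cases "sq_norm n v = 0")
  case True
  then show ?thesis using assms(2) mform_zero[OF True] by auto
next
  case False
  then obtain w where w: "sq_norm n w = 1" "\<forall>a. mform n a v v = complex_of_real (sq_norm n v) * mform n a w w"
    using mform_normalize by blast
  obtain p where "p \<in> K" "\<And>k. mform n (a k) w w = complex_of_real (vec_nth p k)"
    using assms(1) w(1) unfolding forms_in_def by blast
  then show ?thesis using w(2) by auto
qed

text \<open>The image of a block matrix under the vector state is its block form restricted to
  vectors that are multiples of \<open>v\<close> in every block; for a sum of squares this is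
  nonnegative.\<close>

lemma vector_state_ucp:
  fixes a :: "'d::finite \<Rightarrow> complex mat"
  assumes a: "\<And>k. a k \<in> carrier_mat n n" and v: "sq_norm n v = 1"
  shows "(\<lambda>y. mat 1 1 (\<lambda>_. mform n y v v)) \<in>
    ucp_maps (cstar_gen (matrix_alg n) (op_system (matrix_alg n) a)) (matrix_alg 1)"
proof -
  let ?C = "cstar_gen (matrix_alg n) (op_system (matrix_alg n) a)"
  interpret matrix_subalgebra n "carrier ?C" by (rule matrix_subalgebra_gen[of a, OF a])
  let ?\<phi> = "\<lambda>y. mat 1 1 (\<lambda>_. mform n y v v)"
  have "?\<phi> \<in> linear_maps ?C (matrix_alg 1)"
    unfolding linear_maps_def
    by (auto intro!: eq_matI simp: mem_carrier mform_add mform_smult)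
  moreover have "?\<phi> (1\<^sub>m n) = 1\<^sub>m 1" by (rule eq_matI) (auto simp: mform_one v)
  moreover have "completely_positive ?C (matrix_alg 1) ?\<phi>"
  proof (rule completely_positive_matrixI)
    fix m y and V :: "nat \<Rightarrow> nat \<Rightarrow> complex"
    assume y: "positive_matrix ?C m y"
    then obtain b where b: "\<And>i j. i < m \<Longrightarrow> j < m \<Longrightarrow> b i j \<in> carrier ?C"
      "\<And>i j. i < m \<Longrightarrow> j < m \<Longrightarrow> y i j = finsum ?C (\<lambda>k. mat_adjoint (b k i) * b k j) {..<m}"
      unfolding positive_matrix_def cstar_gen_simps matrix_alg_simps by blast
    have adj: "mat_adjoint c \<in> carrier ?C" if "c \<in> carrier ?C" for c
      using subalgebra that unfolding cstar_subalgebra_def by auto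
    have "psd_blocks n m y"
    proof (rule psd_blocks_sum_squares)
      fix i j assume ij: "i < m" "j < m"
      show "y i j = finsum (matrix_alg n) (\<lambda>l. mat_adjoint (b l i) * b l j) {..<m}"
        unfolding b(2)[OF ij] using ij
        by (intro finsum_matrix_alg_gen[OF subalgebra]) (auto intro!: mult_mem adj b)
    qed (use b mem_carrier in auto)
    then have "(\<Sum>i<m. \<Sum>j<m. mform n (y i j) (\<lambda>g. V i 0 * v g) (\<lambda>g. V j 0 * v g)) \<in> \<real>\<^sub>\<ge>\<^sub>0"
      unfolding psd_blocks_def by (rule spec)
    moreover have "mform 1 (?\<phi> c) s t = mform n c (\<lambda>g. s 0 * v g) (\<lambda>g. t 0 * v g)" for c s t
      unfolding mform_scale by (simp add: mform_def[of "Suc 0"] ac_simps)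
    ultimately show "(\<Sum>i<m. \<Sum>j<m. mform 1 (?\<phi> (y i j)) (V i) (V j)) \<in> \<real>\<^sub>\<ge>\<^sub>0" by simp
  qed auto
  ultimately show ?thesis unfolding ucp_maps_def by simp
qed

text \<open>Vector states give one direction. For the other, a state of C*(a) need not be a vector
  state; but for each half-space containing \<open>K\<close> the matrix c - sum of u_k a_k has a
  semidefinite form, hence a factorization inside C*(a), and every state is nonnegative on
  it.\<close>

lemma max_matrix_set_iff:
  fixes K :: "(real ^ 'd::finite) set"
  assumes K: "compact K" "convex K" "K \<noteq> {}"
  shows "(n, a) \<in> max_matrix_set K \<longleftrightarrow> 1 \<le> n \<and> (\<forall>k. a k \<in> carrier_mat n n) \<and> forms_in n K a"
proof -
  have "matrix_range_level 1 (matrix_alg n) a \<subseteq> real_point ` K \<longleftrightarrow> forms_in n K a"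
    if a: "\<And>k. a k \<in> carrier_mat n n"
  proof
    assume sub: "matrix_range_level 1 (matrix_alg n) a \<subseteq> real_point ` K"
    show "forms_in n K a" unfolding forms_in_def
    proof (intro allI impI)
      fix v assume v: "sq_norm n v = 1"
      have "(\<lambda>k. mat 1 1 (\<lambda>_. mform n (a k) v v)) \<in> matrix_range_level 1 (matrix_alg n) a"
        unfolding matrix_range_level_def
        by (intro CollectI exI[of _ "\<lambda>y. mat 1 1 (\<lambda>_. mform n y v v)"] conjI refl vector_state_ucp[of a, OF a v])
      then obtain p where p: "p \<in> K" "(\<lambda>k. mat 1 1 (\<lambda>_. mform n (a k) v v)) = real_point p"
        using sub by blast
      have "mform n (a k) v v = complex_of_real (vec_nth p k)" for k
        using arg_cong[OF p(2), of "\<lambda>f. f k $$ (0, 0)"] by (simp add: real_point_def)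
      then show "\<exists>p\<in>K. \<forall>k. mform n (a k) v v = complex_of_real (vec_nth p k)" using p(1) by blast
    qed
  next
    assume f: "forms_in n K a"
    let ?C = "cstar_gen (matrix_alg n) (op_system (matrix_alg n) a)"
    interpret matrix_subalgebra n "carrier ?C" by (rule matrix_subalgebra_gen[of a, OF a])
    have aC: "a k \<in> carrier ?C" for k
      by (rule subsetD[OF subset_cstar_gen mem_op_system_matrix[of a, OF a]])
    show "matrix_range_level 1 (matrix_alg n) a \<subseteq> real_point ` K"
    proof
      fix x assume "x \<in> matrix_range_level 1 (matrix_alg n) a"
      then obtain \<psi> where \<psi>: "\<psi> \<in> ucp_maps ?C (matrix_alg 1)" and x: "x = (\<lambda>k. \<psi> (a k))"
        unfolding matrix_range_level_def by blast
      define z where "z k = \<psi> (a k) $$ (0, 0)" for k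
      have "\<exists>p\<in>K. \<forall>k. z k = complex_of_real (vec_nth p k)"
      proof (rule complex_point_mem[OF K(1,2)])
        fix u :: "real ^ 'd" and c :: real assume uc: "\<And>q. q \<in> K \<Longrightarrow> inner u q \<le> c"
        \<comment> \<open>The matrix c - sum of u_k a_k with the sum restricted to \<open>F\<close>;
          membership in C*(a) and the value under \<psi> then follow by induction on
          \<open>F\<close>.\<close>
        define h where "h F = mat n n (\<lambda>(i, j). (if i = j then complex_of_real c else 0) -
          (\<Sum>k\<in>F. complex_of_real (vec_nth u k) * a k $$ (i, j)))" for F
        have h: "h F \<in> carrier ?C \<and>
            \<psi> (h F) $$ (0, 0) = complex_of_real c - (\<Sum>k\<in>F. complex_of_real (vec_nth u k) * z k)" if "finite F" for F
          using that
        proof (induction F rule: finite_induct)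
          case empty
          have "h {} = complex_of_real c \<cdot>\<^sub>m 1\<^sub>m n" unfolding h_def by (rule eq_matI) auto
          then show ?case
            using ucp_smult[OF \<psi>, of "1\<^sub>m n" "complex_of_real c"] ucp_one[OF \<psi>] by (simp add: one_mem smult_mem)
        next
          case (insert l F)
          have e: "h (insert l F) = h F + (- complex_of_real (vec_nth u l)) \<cdot>\<^sub>m a l"
            unfolding h_def by (rule eq_matI) (use insert.hyps a[of l] in auto)
          have m: "(- complex_of_real (vec_nth u l)) \<cdot>\<^sub>m a l \<in> carrier ?C" by (intro smult_mem aC)
          have "\<psi> (h (insert l F)) = \<psi> (h F) + (- complex_of_real (vec_nth u l)) \<cdot>\<^sub>m \<psi> (a l)"
            unfolding e using ucp_add[OF \<psi> _ m] ucp_smult[OF \<psi> aC] insert.IH by simp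
          then show ?case
            using insert ucp_carrier[OF \<psi> aC, of l] by (simp add: e add_mem m z_def algebra_simps)
        qed
        have "mform n (h UNIV) v v \<in> \<real>\<^sub>\<ge>\<^sub>0" for v
        proof -
          have "mform n (h UNIV) v v = mform n (complex_of_real c \<cdot>\<^sub>m 1\<^sub>m n) v v -
              (\<Sum>k\<in>UNIV. complex_of_real (vec_nth u k) * mform n (a k) v v)"
          proof -
            have "(\<Sum>k\<in>UNIV. complex_of_real (vec_nth u k) * mform n (a k) v v) =
              (\<Sum>k\<in>UNIV. \<Sum>i<n. \<Sum>j<n. cnj (v i) * (complex_of_real (vec_nth u k) * a k $$ (i, j)) * v j)"
              by (simp add: mform_def sum_distrib_left algebra_simps)
            also have "\<dots> = (\<Sum>i<n. \<Sum>k\<in>UNIV. \<Sum>j<n. cnj (v i) * (complex_of_real (vec_nth u k) * a k $$ (i, j)) * v j)"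
              by (rule sum.swap)
            also have "\<dots> = (\<Sum>i<n. \<Sum>j<n. \<Sum>k\<in>UNIV. cnj (v i) * (complex_of_real (vec_nth u k) * a k $$ (i, j)) * v j)"
              by (intro sum.cong refl sum.swap)
            finally have s: "(\<Sum>k\<in>UNIV. complex_of_real (vec_nth u k) * mform n (a k) v v) = \<dots>" .
            show ?thesis unfolding s unfolding mform_def sum_subtractf[symmetric]
              by (intro sum.cong refl)
                (auto simp: h_def sum_distrib_left sum_distrib_right algebra_simps)
          qed
          also obtain p where p: "p \<in> K" "\<And>k. mform n (a k) v v = complex_of_real (sq_norm n v * vec_nth p k)"
            using forms_in_scaled[OF f K(3)] by blast
          have "mform n (complex_of_real c \<cdot>\<^sub>m 1\<^sub>m n) v v = complex_of_real (c * sq_norm n v)"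
            by (subst mform_smult) (auto simp: mform_one)
          moreover have "(\<Sum>k\<in>UNIV. complex_of_real (vec_nth u k) * mform n (a k) v v) =
              complex_of_real (sq_norm n v * inner u p)"
            by (simp add: p(2) inner_vec_def sum_distrib_left algebra_simps)
          ultimately have "mform n (h UNIV) v v = complex_of_real (sq_norm n v * (c - inner u p))"
            by (simp add: algebra_simps)
          moreover have "0 \<le> sq_norm n v * (c - inner u p)" using uc[OF p(1)] sq_norm_nonneg by simp
          ultimately show ?thesis by (simp only: nonneg_Reals_of_real_iff)
        qed
        then obtain b where b: "b \<in> carrier ?C" "mat_adjoint b * b = h UNIV"
          using sqrt_exists[of "h UNIV"] h[OF finite_univ] by blast
        have "mform 1 (\<psi> (h UNIV)) (\<lambda>_. 1) (\<lambda>_. 1) \<in> \<real>\<^sub>\<ge>\<^sub>0"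
          using ucp_form_nonneg[OF abelian_monoid_matrix_alg_gen(1)[OF subalgebra] \<psi> b(1), of "\<lambda>_. 1"] h[OF finite_univ]
          by (simp add: b)
        then show "complex_of_real c - (\<Sum>k\<in>UNIV. complex_of_real (vec_nth u k) * z k) \<in> \<real>\<^sub>\<ge>\<^sub>0"
          using h[OF finite_univ] by (simp add: mform_def)
      qed
      then obtain p where p: "p \<in> K" "\<And>k. z k = complex_of_real (vec_nth p k)" by blast
      have "x = real_point p"
        unfolding x real_point_def p(2)[symmetric] z_def
        by (rule ext, rule eq_matI) (use ucp_carrier[OF \<psi> aC] in auto)
      then show "x \<in> real_point ` K" using p(1) by blast
    qed
  qed
  then show ?thesis unfolding max_matrix_set_def by auto
qed

section \<open>Compactness and matrix convexity of the maximal set\<close>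

lemma compact_funs:
  fixes S :: "'i \<Rightarrow> 'a::topological_space set"
  assumes "\<And>i. compact (S i)" shows "compact {f. \<forall>i. f i \<in> S i}"
proof -
  have "compactin (product_topology (\<lambda>i::'i. euclidean :: 'a topology) UNIV) (PiE UNIV S)"
    using assms by (simp add: compactin_PiE)
  moreover have "PiE UNIV S = {f. \<forall>i. f i \<in> S i}" by auto
  ultimately show ?thesis by (simp add: euclidean_product_topology)
qed

text \<open>Each a_k has a quadratic form bounded by \<open>R\<close>, hence operator norm at most
  \<open>R\<close>, hence entries bounded by \<open>R\<close>. Semidefiniteness of R - a_k supplies
  the hermitian symmetry needed for the norm estimate.\<close>

lemma max_matrix_set_entry_bound:
  fixes K :: "(real ^ 'd::finite) set"
  assumes R: "\<And>p. p \<in> K \<Longrightarrow> norm p \<le> R" and "K \<noteq> {}"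
    and a: "\<And>k. a k \<in> carrier_mat n n" and f: "forms_in n K a" and ij: "i < n" "j < n"
  shows "cmod (a k $$ (i, j)) \<le> R"
proof -
  have R0: "0 \<le> R" using R assms(2) norm_ge_zero order_trans by blast
  have form: "\<exists>r. \<bar>r\<bar> \<le> R \<and> mform n (a k) v v = complex_of_real (sq_norm n v * r)" for v
  proof -
    obtain p where p: "p \<in> K" "\<And>k. mform n (a k) v v = complex_of_real (sq_norm n v * vec_nth p k)"
      using forms_in_scaled[OF f assms(2)] by blast
    have "\<bar>vec_nth p k\<bar> \<le> R" using R[OF p(1)] component_le_norm_cart[of p k] by linarith
    then show ?thesis using p(2) by blast
  qed
  define h where "h = complex_of_real R \<cdot>\<^sub>m 1\<^sub>m n + (-1) \<cdot>\<^sub>m a k"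
  have "mform n h v v \<in> \<real>\<^sub>\<ge>\<^sub>0" for v
  proof -
    obtain r where r: "\<bar>r\<bar> \<le> R" "mform n (a k) v v = complex_of_real (sq_norm n v * r)" using form by blast
    have "mform n h v v = complex_of_real (sq_norm n v * (R - r))"
      unfolding h_def using a[of k] by (simp add: mform_add mform_smult mform_one r algebra_simps)
    moreover have "0 \<le> sq_norm n v * (R - r)" using r sq_norm_nonneg by simp
    ultimately show ?thesis by (simp only: nonneg_Reals_of_real_iff)
  qed
  then have psd: "psd_kernel {..<n} (\<lambda>i j. h $$ (i, j))" by (rule mform_psd_kernel)
  have h1: "h $$ (j, i) = cnj (h $$ (i, j))" if "i < n" "j < n" for i j
    using psd_kernel_hermitian[OF psd finite_lessThan, of i j] that by simp
  have h2: "h $$ (i, j) = (if i = j then complex_of_real R else 0) - a k $$ (i, j)"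
    if "i < n" "j < n" for i j using that a[of k] by (simp add: h_def)
  have herm: "a k $$ (j, i) = cnj (a k $$ (i, j))" if "i < n" "j < n" for i j
    using h1[OF that] unfolding h2[OF that] h2[OF that(2,1)] by (cases "i = j") auto
  have "norm (mat_op n (a k)) \<le> R"
  proof (rule norm_selfadj_le[OF selfadj_mat_op[OF herm] _ R0])
    fix v
    obtain r where r: "\<bar>r\<bar> \<le> R" "mform n (a k) (ell2_nth v) (ell2_nth v) = complex_of_real (sq_norm n (ell2_nth v) * r)"
      using form by blast
    have "\<bar>inner v (mat_op n (a k) v)\<bar> = sq_norm n (ell2_nth v) * \<bar>r\<bar>"
      using sq_norm_nonneg by (simp add: inner_ell2_def cinner_mat_op_right r abs_mult)
    also have "\<dots> \<le> (norm v)\<^sup>2 * R"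
    proof (rule mult_mono)
      show "sq_norm n (ell2_nth v) \<le> (norm v)\<^sup>2"
        unfolding norm_ell2_square sq_norm_def by (rule sum_le_suminf[OF ell2_summable_norm]) auto
    qed (use r in auto)
    finally show "\<bar>inner v (mat_op n (a k) v)\<bar> \<le> R * (norm v)\<^sup>2" by (simp add: mult.commute)
  qed auto
  then have "norm (mat_op n (a k) (ket j)) \<le> R"
    using norm_blinfun[of "mat_op n (a k)" "ket j"] by (simp add: norm_ket)
  then show ?thesis using cmod_ell2_nth_le[of "mat_op n (a k) (ket j)" i] by (simp add: mat_op_ket ij)
qed

text \<open>The level is the intersection of a product of compact sets, which bounds the entries,
  with the closed conditions that the values of the forms at each unit vector lie in the compact
  image of \<open>K\<close>.\<close>

lemma compact_max_matrix_level:
  fixes K :: "(real ^ 'd::finite) set"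
  assumes K: "compact K" "convex K" "K \<noteq> {}" and n: "1 \<le> n"
  shows "compact (mat_entries n ` (max_matrix_set K `` {n}))"
proof -
  have "bounded K" by (rule compact_imp_bounded[OF K(1)])
  then obtain R where R: "\<And>q. q \<in> K \<Longrightarrow> norm q \<le> R" unfolding bounded_iff by blast
  define g where "g v f = (\<lambda>k. \<Sum>i<n. \<Sum>j<n. cnj (v i) * f k (i, j) * v j)"
    for v :: "nat \<Rightarrow> complex" and f :: "'d \<Rightarrow> nat \<times> nat \<Rightarrow> complex"
  define J where "J p = (\<lambda>k. complex_of_real (vec_nth p k))" for p :: "real ^ 'd"
  define T where "T = (\<Inter>v\<in>{v. sq_norm n v = 1}. g v -` (J ` K))"
  \<comment> \<open>\<open>mat_entries\<close> is 0 outside the n by n block, so there the factor is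
    a single point.\<close>
  define B where "B ij = (if fst ij < n \<and> snd ij < n then cball (0::complex) R else {0})" for ij :: "nat \<times> nat"
  define P where "P = {f :: 'd \<Rightarrow> nat \<times> nat \<Rightarrow> complex. \<forall>k. f k \<in> {h. \<forall>ij. h ij \<in> B ij}}"
  have "compact P" unfolding P_def by (intro compact_funs) (auto simp: B_def)
  moreover have "closed T"
  proof -
    have "continuous_on UNIV J" unfolding J_def
      by (intro continuous_on_coordinatewise_then_product continuous_intros)
    then have "closed (J ` K)"
      by (intro compact_imp_closed compact_continuous_image[OF _ K(1)]) (auto intro: continuous_on_subset)
    moreover have "continuous_on UNIV (g v)" for v
    proof -
      have "continuous_on UNIV (\<lambda>f :: 'd \<Rightarrow> nat \<times> nat \<Rightarrow> complex. f k ij)" for k ij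
        by (rule continuous_on_product_then_coordinatewise, rule continuous_on_product_then_coordinatewise,
            rule continuous_on_id)
      then show ?thesis unfolding g_def
        by (intro continuous_on_coordinatewise_then_product continuous_on_sum continuous_on_mult continuous_on_const)
    qed
    ultimately show ?thesis unfolding T_def by (intro closed_INT ballI closed_vimage) auto
  qed
  moreover have "mat_entries n ` (max_matrix_set K `` {n}) = P \<inter> T"
  proof
    show "mat_entries n ` (max_matrix_set K `` {n}) \<subseteq> P \<inter> T"
    proof
      fix f assume "f \<in> mat_entries n ` (max_matrix_set K `` {n})"
      then obtain a where f: "f = mat_entries n a" and a: "\<And>k. a k \<in> carrier_mat n n" "forms_in n K a"
        using max_matrix_set_iff[OF K] by auto
      have "f \<in> P"
        using max_matrix_set_entry_bound[OF R K(3) a]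
        by (auto simp: P_def B_def f mat_entries_def)
      moreover have "g v f \<in> J ` K" if v: "sq_norm n v = 1" for v
      proof -
        obtain p where p: "p \<in> K" "\<And>k. mform n (a k) v v = complex_of_real (vec_nth p k)"
          using a(2) v unfolding forms_in_def by blast
        have "g v f = J p" unfolding g_def J_def p(2)[symmetric] mform_def f mat_entries_def
          by (intro ext sum.cong refl) auto
        then show ?thesis using p(1) by blast
      qed
      ultimately show "f \<in> P \<inter> T" by (auto simp: T_def)
    qed
    show "P \<inter> T \<subseteq> mat_entries n ` (max_matrix_set K `` {n})"
    proof
      fix f assume f: "f \<in> P \<inter> T"
      define a where "a k = mat n n (f k)" for k
      have a: "a k \<in> carrier_mat n n" for k by (simp add: a_def)
      have "f k (i, j) = mat_entries n a k (i, j)" for k i j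
      proof -
        have "f k (i, j) \<in> B (i, j)" using f by (auto simp: P_def)
        then show ?thesis by (auto simp: mat_entries_def a_def B_def)
      qed
      then have "f = mat_entries n a" by (simp add: fun_eq_iff)
      moreover have "forms_in n K a" unfolding forms_in_def
      proof (intro allI impI)
        fix v assume "sq_norm n v = 1"
        then obtain p where p: "p \<in> K" "g v f = J p" using f by (auto simp: T_def)
        have "mform n (a k) v v = g v f k" for k
          unfolding mform_def g_def a_def by (intro sum.cong refl) auto
        then show "\<exists>p\<in>K. \<forall>k. mform n (a k) v v = complex_of_real (vec_nth p k)"
          using p by (auto simp: J_def)
      qed
      ultimately show "f \<in> mat_entries n ` (max_matrix_set K `` {n})"
        using max_matrix_set_iff[OF K, of n a] n a by auto
    qed
  qed
  ultimately show ?thesis by (simp add: compact_Int_closed)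
qed

lemma mform_compression:
  assumes \<gamma>: "\<gamma> \<in> carrier_mat N n" and a: "a \<in> carrier_mat N N"
  shows "mform n (mat_adjoint \<gamma> * a * \<gamma>) v v =
    mform N a (\<lambda>i. \<Sum>j<n. \<gamma> $$ (i, j) * v j) (\<lambda>i. \<Sum>j<n. \<gamma> $$ (i, j) * v j)"
proof -
  have "mat_adjoint \<gamma> * a * \<gamma> = mat_adjoint \<gamma> * (a * \<gamma>)"
    by (rule assoc_mult_mat[OF mat_adjoint_carrier[OF \<gamma>] a \<gamma>])
  then have "mform n (mat_adjoint \<gamma> * a * \<gamma>) v v =
      (\<Sum>g<N. cnj (\<Sum>i<n. \<gamma> $$ (g, i) * v i) * (\<Sum>j<n. (a * \<gamma>) $$ (g, j) * v j))"
    using mform_adjoint_mult[OF \<gamma> mult_carrier_mat[OF a \<gamma>]] by simp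
  also have "\<dots> = (\<Sum>g<N. cnj (\<Sum>i<n. \<gamma> $$ (g, i) * v i) * (\<Sum>h<N. a $$ (g, h) * (\<Sum>j<n. \<gamma> $$ (h, j) * v j)))"
  proof -
    have "(\<Sum>j<n. (a * \<gamma>) $$ (g, j) * v j) = (\<Sum>h<N. a $$ (g, h) * (\<Sum>j<n. \<gamma> $$ (h, j) * v j))"
      if "g < N" for g
    proof -
      have "(\<Sum>j<n. (a * \<gamma>) $$ (g, j) * v j) = (\<Sum>j<n. \<Sum>h<N. a $$ (g, h) * \<gamma> $$ (h, j) * v j)"
        using that by (intro sum.cong refl) (simp add: mat_mult_index[OF a \<gamma>] sum_distrib_right del: index_mult_mat(1))
      also have "\<dots> = (\<Sum>h<N. \<Sum>j<n. a $$ (g, h) * \<gamma> $$ (h, j) * v j)" by (rule sum.swap)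
      finally show ?thesis by (simp add: sum_distrib_left mult.assoc)
    qed
    then show ?thesis by (intro sum.cong refl) (simp only: lessThan_iff)
  qed
  also have "\<dots> = mform N a (\<lambda>i. \<Sum>j<n. \<gamma> $$ (i, j) * v j) (\<lambda>i. \<Sum>j<n. \<gamma> $$ (i, j) * v j)"
    by (simp add: mform_def sum_distrib_left mult.assoc)
  finally show ?thesis .
qed

text \<open>At a unit vector \<open>v\<close> the form of a matrix convex combination is a convex
  combination of points of \<open>K\<close>; the weights are the squared norms of \<gamma> j applied
  to \<open>v\<close>, and they add up to 1 by the normalization of the coefficients.\<close>

lemma compact_matrix_convex_max:
  fixes K :: "(real ^ 'd::finite) set"
  assumes K: "compact K" "convex K" "K \<noteq> {}"
  shows "compact_matrix_convex (max_matrix_set K)"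
  unfolding compact_matrix_convex_def
proof (intro conjI allI impI)
  show "max_matrix_set K \<subseteq> (SIGMA n:{1..}. {a. \<forall>k. a k \<in> carrier_mat n n})"
    unfolding max_matrix_set_def by auto
  show "compact (mat_entries n ` (max_matrix_set K `` {n}))" if "1 \<le> n" for n
    by (rule compact_max_matrix_level[OF K that])
  fix n and m :: nat and N a \<gamma>
  assume H: "1 \<le> n \<and> (\<forall>j<m. (N j, a j) \<in> max_matrix_set K \<and> \<gamma> j \<in> carrier_mat (N j) n) \<and>
    (\<Oplus>\<^bsub>matrix_alg n\<^esub>j\<in>{..<m}. mat_adjoint (\<gamma> j) * \<gamma> j) = 1\<^sub>m n"
  have \<gamma>: "\<gamma> j \<in> carrier_mat (N j) n" if "j < m" for j using H that by blast
  have a: "a j k \<in> carrier_mat (N j) (N j)" "forms_in (N j) K (a j)" if "j < m" for j k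
    using H that max_matrix_set_iff[OF K] by auto
  define w where "w v j = (\<lambda>i. \<Sum>l<n. \<gamma> j $$ (i, l) * v l)" for v j
  have c: "mat_adjoint (\<gamma> j) * a j k * \<gamma> j \<in> carrier_mat n n" if "j < m" for j k
    using mat_adjoint_carrier[OF \<gamma>[OF that]] a(1)[OF that] \<gamma>[OF that] by (meson mult_carrier_mat)
  have c1: "mat_adjoint (\<gamma> j) * \<gamma> j \<in> carrier_mat n n" if "j < m" for j
    using mat_adjoint_carrier[OF \<gamma>[OF that]] \<gamma>[OF that] by (meson mult_carrier_mat)
  let ?s = "\<lambda>k. finsum (matrix_alg n) (\<lambda>j. mat_adjoint (\<gamma> j) * a j k * \<gamma> j) {..<m}"
  have "forms_in n K ?s" unfolding forms_in_def
  proof (intro allI impI)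
    fix v assume v: "sq_norm n v = 1"
    have form: "mform n (?s k) v v = (\<Sum>j<m. mform (N j) (a j k) (w v j) (w v j))" for k
      using mform_finsum[of "{..<m}" "\<lambda>j. mat_adjoint (\<gamma> j) * a j k * \<gamma> j" n v v] c
      by (simp add: mform_compression[OF \<gamma> a(1)] w_def)
    have "complex_of_real 1 = mform n (finsum (matrix_alg n) (\<lambda>j. mat_adjoint (\<gamma> j) * \<gamma> j) {..<m}) v v"
      using H v by (simp add: mform_one)
    also have "\<dots> = (\<Sum>j<m. mform n (mat_adjoint (\<gamma> j) * \<gamma> j) v v)"
      using c1 by (intro mform_finsum) auto
    also have "\<dots> = (\<Sum>j<m. complex_of_real (sq_norm (N j) (w v j)))"
    proof (intro sum.cong refl)
      fix j assume "j \<in> {..<m}"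
      then have "mform n (mat_adjoint (\<gamma> j) * \<gamma> j) v v = (\<Sum>g<N j. cnj (w v j g) * w v j g)"
        using mform_adjoint_mult[OF \<gamma> \<gamma>] by (simp add: w_def)
      then show "mform n (mat_adjoint (\<gamma> j) * \<gamma> j) v v = complex_of_real (sq_norm (N j) (w v j))"
        unfolding sq_norm_def of_real_sum complex_norm_square by (simp add: mult.commute)
    qed
    finally have one: "(\<Sum>j<m. sq_norm (N j) (w v j)) = 1" by (metis of_real_eq_iff of_real_sum)
    have "\<exists>p\<in>K. \<forall>k. mform (N j) (a j k) (w v j) (w v j) = complex_of_real (sq_norm (N j) (w v j) * vec_nth p k)"
      if "j < m" for j
      by (rule forms_in_scaled[OF a(2)[OF that] K(3)])
    then obtain p where p: "\<And>j. j < m \<Longrightarrow> p j \<in> K"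
      "\<And>j k. j < m \<Longrightarrow> mform (N j) (a j k) (w v j) (w v j) = complex_of_real (sq_norm (N j) (w v j) * vec_nth (p j) k)"
      by metis
    have "(\<Sum>j<m. sq_norm (N j) (w v j) *\<^sub>R p j) \<in> K"
      using p(1) one sq_norm_nonneg by (intro convex_sum K) auto
    moreover have "mform n (?s k) v v = complex_of_real (vec_nth (\<Sum>j<m. sq_norm (N j) (w v j) *\<^sub>R p j) k)" for k
      unfolding form using p(2) by simp
    ultimately show "\<exists>p\<in>K. \<forall>k. mform n (?s k) v v = complex_of_real (vec_nth p k)" by blast
  qed
  moreover have "?s k \<in> carrier_mat n n" for k using c by (intro finsum_matrix_alg) auto
  ultimately show "(n, ?s) \<in> max_matrix_set K" using H max_matrix_set_iff[OF K] by blast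
qed

section \<open>States at infinity\<close>

lemma
  fixes x :: "'d::finite \<Rightarrow> ell2 \<Rightarrow>\<^sub>L ell2"
  assumes x: "\<And>k. clinear_ell2 (x k)"
  shows op_system_subset: "op_system bounded_ops x \<subseteq> {T. clinear_ell2 T}"
    and mem_op_system: "x l \<in> op_system bounded_ops x"
    and id_mem_op_system: "id_blinfun \<in> op_system bounded_ops x"
proof -
  let ?t = "\<lambda>\<alpha> \<beta> k. cscale (\<alpha> k) (x k) + cscale (\<beta> k) (adj_op (x k))"
  have t: "clinear_ell2 (?t \<alpha> \<beta> k)" for \<alpha> \<beta> :: "'d \<Rightarrow> complex" and k
    by (intro clinear_add clinear_cscale clinear_adj x)
  have S: "op_system bounded_ops x = {cscale c id_blinfun + sum (?t \<alpha> \<beta>) UNIV | c \<alpha> \<beta>. True}"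
  proof -
    have "finsum bounded_ops (?t \<alpha> \<beta>) UNIV = sum (?t \<alpha> \<beta>) UNIV" for \<alpha> \<beta> :: "'d \<Rightarrow> complex"
      by (rule finsum_eq_sum) (simp_all add: clinear_zero clinear_add t)
    then show ?thesis unfolding op_system_def bounded_ops_simps by simp
  qed
  show "op_system bounded_ops x \<subseteq> {T. clinear_ell2 T}"
    unfolding S by (auto intro!: clinear_add clinear_cscale clinear_id clinear_sum clinear_adj x)
  have c0: "cscale 0 T = 0" "cscale 1 T = T" for T
    by (rule blinfun_eqI, simp add: cscale_apply scaleC_simps)+
  have "sum (?t (\<lambda>k. if k = l then 1 else 0) (\<lambda>_. 0)) UNIV = (\<Sum>k\<in>UNIV. if k = l then x k else 0)"
    by (intro sum.cong refl) (simp add: c0)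
  then have "x l = cscale 0 id_blinfun + sum (?t (\<lambda>k. if k = l then 1 else 0) (\<lambda>_. 0)) UNIV"
    by (simp add: c0)
  then show "x l \<in> op_system bounded_ops x" unfolding S
    by (intro CollectI exI[of _ "0::complex"] exI[of _ "\<lambda>k. if k = l then 1 else 0"] exI[of _ "\<lambda>_. 0"] conjI TrueI)
  have "id_blinfun = cscale 1 id_blinfun + sum (?t (\<lambda>_. 0) (\<lambda>_. 0)) UNIV"
    by (simp add: c0)
  then show "id_blinfun \<in> op_system bounded_ops x" unfolding S
    by (intro CollectI exI[of _ "1::complex"] exI[of _ "\<lambda>_. 0"] conjI TrueI)
qed

abbreviation cstar :: "('d::finite \<Rightarrow> ell2 \<Rightarrow>\<^sub>L ell2) \<Rightarrow> (ell2 \<Rightarrow>\<^sub>L ell2) star_algebra" where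
  "cstar x \<equiv> cstar_gen bounded_ops (op_system bounded_ops x)"

lemma operator_algebra_cstar:
  assumes "\<And>k. clinear_ell2 (x k)" shows "operator_algebra (carrier (cstar x))"
proof
  show "cstar_subalgebra (carrier (cstar x)) bounded_ops"
    by (rule cstar_subalgebra_gen[OF cstar_subalgebra_bounded_ops_carrier op_system_subset[of x, OF assms]])
  show "id_blinfun \<in> carrier (cstar x)"
    by (rule subsetD[OF subset_cstar_gen id_mem_op_system[of x, OF assms]])
qed

lemma mem_cstar:
  assumes "\<And>k. clinear_ell2 (x k)" shows "x l \<in> carrier (cstar x)"
  by (rule subsetD[OF subset_cstar_gen mem_op_system[of x, OF assms]])

context
  fixes A :: "(ell2 \<Rightarrow>\<^sub>L ell2) star_algebra" and x :: "'d::finite \<Rightarrow> ell2 \<Rightarrow>\<^sub>L ell2"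
  assumes A: "A = cstar x" and x: "\<And>k. clinear_ell2 (x k)"
begin

interpretation operator_algebra "carrier A"
  unfolding A by (rule operator_algebra_cstar[OF x])

lemma cstar_simps:
  "mult A S T = S o\<^sub>L T" "one A = id_blinfun" "zero A = 0" "add A S T = S + T"
  "smult A c T = cscale c T" "adj A = adj_op"
  by (simp_all add: A)

lemma abelian_monoid_cstar: "abelian_monoid A"
  by (rule abelian_monoidI) (simp_all add: cstar_simps zero_mem add_mem ac_simps)

lemma positive_matrix_cstarE:
  assumes "positive_matrix A m y"
  obtains b where "\<And>i j. i < m \<Longrightarrow> j < m \<Longrightarrow> b i j \<in> carrier A"
    "\<And>i j. i < m \<Longrightarrow> j < m \<Longrightarrow> y i j = (\<Sum>k<m. adj_op (b k i) o\<^sub>L b k j)"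
proof -
  obtain b where b: "\<And>i j. i < m \<Longrightarrow> j < m \<Longrightarrow> b i j \<in> carrier A"
    "\<And>i j. i < m \<Longrightarrow> j < m \<Longrightarrow> y i j = finsum A (\<lambda>k. adj_op (b k i) o\<^sub>L b k j) {..<m}"
    using assms unfolding positive_matrix_def cstar_simps by blast
  have eq: "finsum A (\<lambda>k. adj_op (b k i) o\<^sub>L b k j) {..<m} = (\<Sum>k<m. adj_op (b k i) o\<^sub>L b k j)"
    if "i < m" "j < m" for i j
    by (rule finsum_eq_sum) (use b that in \<open>auto simp: cstar_simps zero_mem add_mem comp_mem adj_mem\<close>)
  show ?thesis
  proof (rule that[of b])
    show "b i j \<in> carrier A" if "i < m" "j < m" for i j using b(1) that by blast
    show "y i j = (\<Sum>k<m. adj_op (b k i) o\<^sub>L b k j)" if "i < m" "j < m" for i j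
      using b(2)[OF that] eq[OF that] by simp
  qed
qed

lemma positive_matrix_cstar_ex:
  assumes "positive_matrix A m y"
  shows "\<exists>b. (\<forall>i<m. \<forall>j<m. b i j \<in> carrier A) \<and>
    (\<forall>i<m. \<forall>j<m. y i j = (\<Sum>k<m. adj_op (b k i) o\<^sub>L b k j))"
  by (rule positive_matrix_cstarE[OF assms]) blast

lemma ucp_cstar_form_nonneg:
  assumes \<psi>: "\<psi> \<in> ucp_maps A (matrix_alg n)" and b: "b \<in> carrier A"
  shows "mform n (\<psi> (adj_op b o\<^sub>L b)) v v \<in> \<real>\<^sub>\<ge>\<^sub>0"
  using ucp_form_nonneg[OF abelian_monoid_cstar \<psi> b] comp_mem[OF adj_mem[OF b] b]
  by (simp add: cstar_simps)

end

text \<open>Weak compactness in the form needed: a bounded sequence of functionals has a cluster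
  point in a product of discs, and a filter finer than \<open>sequentially\<close> converges to it
  at every argument simultaneously.\<close>

lemma pointwise_cluster:
  fixes f :: "nat \<Rightarrow> 'a \<Rightarrow> complex"
  assumes "\<And>N T. cmod (f N T) \<le> b T"
  obtains G \<phi> where "G \<noteq> bot" "G \<le> sequentially" "\<And>T. ((\<lambda>N. f N T) \<longlongrightarrow> \<phi> T) G"
proof -
  let ?P = "{g. \<forall>T. g T \<in> cball (0::complex) (b T)}"
  have "compact ?P" by (intro compact_funs compact_cball)
  moreover have "filtermap f sequentially \<noteq> bot" by (simp add: filtermap_bot_iff)
  moreover have "\<forall>\<^sub>F g in filtermap f sequentially. g \<in> ?P"
    using assms by (simp add: eventually_filtermap)
  ultimately obtain \<phi> where \<phi>: "inf (nhds \<phi>) (filtermap f sequentially) \<noteq> bot"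
    unfolding compact_filter by blast
  \<comment> \<open>The filter generated by the preimages of neighbourhoods of the cluster point
    together with the tails of the index set; it is proper exactly because \<phi> is a cluster
    point.\<close>
  define G where "G = inf (filtercomap f (nhds \<phi>)) sequentially"
  have "G \<noteq> bot"
  proof
    assume "G = bot"
    then have "eventually (\<lambda>_. False) G" by simp
    then obtain P Q where PQ: "eventually P (filtercomap f (nhds \<phi>))" "eventually Q sequentially"
      "\<And>N. P N \<Longrightarrow> Q N \<Longrightarrow> False"
      unfolding G_def eventually_inf by auto
    obtain R where R: "eventually R (nhds \<phi>)" "\<And>N. R (f N) \<Longrightarrow> P N"
      using PQ(1) unfolding eventually_filtercomap by auto
    have "eventually (\<lambda>g. \<exists>N. Q N \<and> g = f N) (filtermap f sequentially)"
      unfolding eventually_filtermap by (rule eventually_mono[OF PQ(2)]) auto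
    then have "eventually (\<lambda>_. False) (inf (nhds \<phi>) (filtermap f sequentially))"
      unfolding eventually_inf using R PQ(3)
      by (intro exI[of _ R] exI[of _ "\<lambda>g. \<exists>N. Q N \<and> g = f N"]) auto
    then show False using \<phi> by (simp add: trivial_limit_def)
  qed
  moreover have "G \<le> sequentially" unfolding G_def by simp
  moreover have "((\<lambda>N. f N T) \<longlongrightarrow> \<phi> T) G" for T
  proof -
    have "filterlim f (nhds \<phi>) G"
      unfolding G_def filterlim_def by (meson filtermap_filtercomap filtermap_mono inf_le1 order_trans)
    moreover have "continuous_on UNIV (\<lambda>g :: 'a \<Rightarrow> complex. g T)"
      by (rule continuous_on_product_then_coordinatewise, rule continuous_on_id)
    ultimately show ?thesis
      using continuous_on_tendsto_compose[of UNIV "\<lambda>g :: 'a \<Rightarrow> complex. g T" f \<phi> G] by simp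
  qed
  ultimately show ?thesis using that by blast
qed

text \<open>A compact \<open>T\<close> satisfies norm (T o high N) --> 0, and v N is fixed by
  \<open>high N\<close>, so the limiting state vanishes on compact operators. Positivity is
  inherited from the vector states.\<close>

lemma state_at_infinity:
  fixes x :: "'d::finite \<Rightarrow> ell2 \<Rightarrow>\<^sub>L ell2"
  assumes x: "\<And>k. clinear_ell2 (x k)"
    and v: "\<And>N. norm (v N) = 1" "\<And>N. high N (v N) = v N"
  obtains G z where "G \<noteq> bot" "G \<le> sequentially"
    "\<forall>k. ((\<lambda>N. cinner_ell2 (v N) (x k (v N))) \<longlongrightarrow> z k) G"
    "(\<lambda>k. mat 1 1 (\<lambda>_. z k)) \<in> ess_matrix_range_level 1 x"
proof -
  have "cmod (cinner_ell2 (v N) (blinfun_apply T (v N))) \<le> norm T" for N T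
    using cmod_cinner_le[of "v N" "T (v N)"] norm_blinfun[of T "v N"] v(1)[of N] by simp
  then obtain G \<phi> where G: "G \<noteq> bot" "G \<le> sequentially"
    and lim: "\<And>T. ((\<lambda>N. cinner_ell2 (v N) (blinfun_apply T (v N))) \<longlongrightarrow> \<phi> T) G"
    using pointwise_cluster[of "\<lambda>N T. cinner_ell2 (v N) (blinfun_apply T (v N))" norm] by metis
  have uniq: "a = b" if "(f \<longlongrightarrow> a) G" "(f \<longlongrightarrow> b) G" for f and a b :: complex
    using tendsto_unique[OF G(1)] that by blast
  have add: "\<phi> (S + T) = \<phi> S + \<phi> T" for S T
    using uniq[OF lim[of "S + T"]] tendsto_add[OF lim[of S] lim[of T]]
    by (simp add: blinfun.add_left cinner_add_right)
  have scale: "\<phi> (cscale c T) = c * \<phi> T" for c T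
    using uniq[OF lim[of "cscale c T"]] tendsto_mult_left[OF lim[of T], of c]
    by (simp add: cscale_apply cinner_scaleC_right)
  have "((\<lambda>N. cinner_ell2 (v N) (id_blinfun (v N))) \<longlongrightarrow> 1) G" by (simp add: cinner_self v)
  then have "\<phi> id_blinfun = 1" using uniq[OF lim[of id_blinfun]] by blast
  have null: "\<phi> T = 0" if "clinear_ell2 T" "tail_null T" for T
  proof -
    have "(\<lambda>N. norm (T o\<^sub>L high N)) \<longlonglongrightarrow> 0" by (rule tail_null_imp_comp_high[OF that])
    moreover have "cmod (cinner_ell2 (v N) (T (v N))) \<le> norm (T o\<^sub>L high N)" for N
      using cmod_cinner_le[of "v N" "T (v N)"] norm_blinfun[of "T o\<^sub>L high N" "v N"] v(1,2)[of N] by simp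
    ultimately have "(\<lambda>N. cinner_ell2 (v N) (T (v N))) \<longlonglongrightarrow> 0"
      by (intro Lim_null_comparison[of "\<lambda>N. cinner_ell2 (v N) (T (v N))" "\<lambda>N. norm (T o\<^sub>L high N)"])
        (auto intro: always_eventually)
    then show ?thesis using uniq[OF lim[of T]] tendsto_mono[OF G(2)] by blast
  qed
  let ?C = "cstar x" and ?\<psi> = "\<lambda>T. mat 1 1 (\<lambda>_. \<phi> T)"
  interpret operator_algebra "carrier ?C" by (rule operator_algebra_cstar[OF x])
  note simps = cstar_simps[of ?C x, OF refl x]
  have "?\<psi> \<in> linear_maps ?C (matrix_alg 1)"
    unfolding linear_maps_def by (auto intro!: eq_matI simp: simps add scale)
  moreover have "?\<psi> id_blinfun = 1\<^sub>m 1" by (rule eq_matI) (auto simp: \<open>\<phi> id_blinfun = 1\<close>)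
  moreover have "completely_positive ?C (matrix_alg 1) ?\<psi>"
  proof (rule completely_positive_matrixI)
    fix m y and V :: "nat \<Rightarrow> nat \<Rightarrow> complex"
    assume y: "positive_matrix ?C m y"
    obtain b where b0: "\<forall>i<m. \<forall>j<m. b i j \<in> carrier ?C"
      "\<forall>i<m. \<forall>j<m. y i j = (\<Sum>k<m. adj_op (b k i) o\<^sub>L b k j)"
      using positive_matrix_cstar_ex[of ?C x m y, OF refl x y] by (elim exE conjE) (rule that)
    have b: "b i j \<in> carrier ?C" "y i j = (\<Sum>k<m. adj_op (b k i) o\<^sub>L b k j)" if "i < m" "j < m" for i j
      using b0[rule_format, OF that] by blast+
    \<comment> \<open>For a vector state the block form is a finite sum of squared norms, a property
      that persists as nonnegativity in the limit along \<open>G\<close>.\<close>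
    have eq: "(\<Sum>i<m. \<Sum>j<m. cnj (V i 0) * cinner_ell2 w (y i j w) * V j 0) =
        (\<Sum>k<m. complex_of_real ((norm (\<Sum>j<m. scaleC_ell2 (V j 0) (b k j w)))\<^sup>2))" for w
    proof -
      have "(\<Sum>i<m. \<Sum>j<m. cnj (V i 0) * cinner_ell2 w (y i j w) * V j 0) =
          (\<Sum>i<m. \<Sum>j<m. \<Sum>k<m. cinner_ell2 (scaleC_ell2 (V i 0) (b k i w)) (scaleC_ell2 (V j 0) (b k j w)))"
      proof (intro sum.cong refl)
        fix i j assume "i \<in> {..<m}" "j \<in> {..<m}"
        then have ij: "i < m" "j < m" by auto
        have "cinner_ell2 w (y i j w) = (\<Sum>k<m. cinner_ell2 (b k i w) (b k j w))"
          unfolding b(2)[OF ij] blinfun.sum_left cinner_sum_right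
        proof (intro sum.cong refl)
          fix k assume "k \<in> {..<m}"
          then have "clinear_ell2 (b k i)" using ij b(1) mem_clinear by blast
          then show "cinner_ell2 w ((adj_op (b k i) o\<^sub>L b k j) w) = cinner_ell2 (b k i w) (b k j w)"
            by (simp add: cinner_adj_right)
        qed
        then show "cnj (V i 0) * cinner_ell2 w (y i j w) * V j 0 =
          (\<Sum>k<m. cinner_ell2 (scaleC_ell2 (V i 0) (b k i w)) (scaleC_ell2 (V j 0) (b k j w)))"
          by (simp add: sum_distrib_left sum_distrib_right cinner_scaleC_left cinner_scaleC_right algebra_simps)
      qed
      also have "\<dots> = (\<Sum>i<m. \<Sum>k<m. \<Sum>j<m. cinner_ell2 (scaleC_ell2 (V i 0) (b k i w)) (scaleC_ell2 (V j 0) (b k j w)))"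
        by (intro sum.cong refl sum.swap)
      also have "\<dots> = (\<Sum>k<m. \<Sum>i<m. \<Sum>j<m. cinner_ell2 (scaleC_ell2 (V i 0) (b k i w)) (scaleC_ell2 (V j 0) (b k j w)))"
        by (rule sum.swap)
      also have "\<dots> = (\<Sum>k<m. cinner_ell2 (\<Sum>i<m. scaleC_ell2 (V i 0) (b k i w)) (\<Sum>j<m. scaleC_ell2 (V j 0) (b k j w)))"
        unfolding cinner_sum_left unfolding cinner_sum_right ..
      finally show ?thesis by (simp only: cinner_self)
    qed
    have "((\<lambda>N. \<Sum>i<m. \<Sum>j<m. cnj (V i 0) * cinner_ell2 (v N) (y i j (v N)) * V j 0) \<longlongrightarrow>
        (\<Sum>i<m. \<Sum>j<m. cnj (V i 0) * \<phi> (y i j) * V j 0)) G"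
      by (intro tendsto_intros lim)
    moreover have "(\<Sum>i<m. \<Sum>j<m. cnj (V i 0) * cinner_ell2 (v N) (y i j (v N)) * V j 0) \<in> \<real>\<^sub>\<ge>\<^sub>0" for N
      unfolding eq by (rule nonneg_Reals_sum) (simp only: nonneg_Reals_of_real_iff zero_le_power2)
    ultimately have "(\<Sum>i<m. \<Sum>j<m. cnj (V i 0) * \<phi> (y i j) * V j 0) \<in> \<real>\<^sub>\<ge>\<^sub>0"
      using Lim_in_closed_set[OF closed_nonneg_Reals_complex _ G(1)] by (metis (no_types, lifting) always_eventually)
    then show "(\<Sum>i<m. \<Sum>j<m. mform 1 (?\<psi> (y i j)) (V i) (V j)) \<in> \<real>\<^sub>\<ge>\<^sub>0"
      by (simp add: mform_def[of "Suc 0"])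
  qed auto
  ultimately have "?\<psi> \<in> ucp_maps ?C (matrix_alg 1)" unfolding ucp_maps_def by (simp add: simps)
  moreover have "?\<psi> T = zero (matrix_alg 1)" if "T \<in> carrier ?C \<inter> compact_ops" for T
    by (rule eq_matI) (use that null in \<open>auto simp: compact_ops_iff\<close>)
  ultimately have "(\<lambda>k. ?\<psi> (x k)) \<in> ess_matrix_range_level 1 x"
    unfolding ess_matrix_range_level_def Let_def by (intro CollectI exI[of _ ?\<psi>]) auto
  then show ?thesis by (rule that[of G "\<lambda>k. \<phi> (x k)", OF G allI[OF lim]])
qed

text \<open>If unit vectors arbitrarily far out had values at distance from \<open>K\<close>, a
  limit of their states would be an essential state with values outside \<open>K\<close>. The
  resulting \<open>N\<close> is uniform in \<open>v\<close>.\<close>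

lemma essential_forms_near:
  fixes x :: "'d::finite \<Rightarrow> ell2 \<Rightarrow>\<^sub>L ell2" and K :: "(real ^ 'd) set"
  assumes x: "\<And>k. clinear_ell2 (x k)" and K: "compact K" "convex K" "K \<noteq> {}"
    and ess: "ess_matrix_range x = max_matrix_set K" and e: "0 < e"
  shows "\<exists>N. \<forall>v. norm v = 1 \<and> high N v = v \<longrightarrow>
    (\<exists>p\<in>K. \<forall>k. cmod (cinner_ell2 v (x k v) - complex_of_real (vec_nth p k)) < e)"
proof (rule ccontr)
  assume "\<not> ?thesis"
  then have "\<forall>N. \<exists>v. (norm v = 1 \<and> high N v = v) \<and>
    \<not> (\<exists>p\<in>K. \<forall>k. cmod (cinner_ell2 v (x k v) - complex_of_real (vec_nth p k)) < e)"
    unfolding not_ex not_all not_imp .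
  from choice[OF this] obtain v where v0: "\<forall>N. (norm (v N) = 1 \<and> high N (v N) = v N) \<and>
    \<not> (\<exists>p\<in>K. \<forall>k. cmod (cinner_ell2 (v N) (x k (v N)) - complex_of_real (vec_nth p k)) < e)" ..
  have v: "norm (v N) = 1" "high N (v N) = v N"
    and far: "p \<in> K \<Longrightarrow> \<exists>k. \<not> cmod (cinner_ell2 (v N) (x k (v N)) - complex_of_real (vec_nth p k)) < e" for N p
    using v0[rule_format, of N] by blast+
  obtain G z where G0: "G \<noteq> bot" "\<forall>k. ((\<lambda>N. cinner_ell2 (v N) (x k (v N))) \<longlongrightarrow> z k) G"
    and z: "(\<lambda>k. mat 1 1 (\<lambda>_. z k)) \<in> ess_matrix_range_level 1 x"
    by (rule state_at_infinity[of x v, OF x v]) (rule that)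
  note G = G0(1) G0(2)[rule_format]
  have "(1, \<lambda>k. mat 1 1 (\<lambda>_. z k)) \<in> ess_matrix_range x" using z by (simp add: ess_matrix_range_def)
  then have f1: "forms_in 1 K (\<lambda>k. mat 1 1 (\<lambda>_. z k))" unfolding ess using max_matrix_set_iff[OF K] by blast
  have s1: "sq_norm 1 (\<lambda>_. 1) = 1" by (simp add: sq_norm_def)
  obtain p where p: "p \<in> K" "\<forall>k. mform 1 (mat 1 1 (\<lambda>_. z k)) (\<lambda>_. 1) (\<lambda>_. 1) = complex_of_real (vec_nth p k)"
    using f1[unfolded forms_in_def, rule_format, OF s1] by (elim bexE) (rule that)
  have zp: "z k = complex_of_real (vec_nth p k)" for k using p(2)[rule_format, of k] by (simp add: mform_def)
  have "\<forall>\<^sub>F N in G. dist (cinner_ell2 (v N) (x k (v N))) (z k) < e" for k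
    by (rule tendstoD[OF G(2) e])
  then have "\<forall>\<^sub>F N in G. \<forall>k\<in>UNIV. dist (cinner_ell2 (v N) (x k (v N))) (z k) < e"
    by (subst eventually_ball_finite_distrib) auto
  then obtain N where "\<And>k. dist (cinner_ell2 (v N) (x k (v N))) (z k) < e"
    using eventually_happens'[OF G(1)] by blast
  then show False using far[OF p(1), of N] by (auto simp: dist_norm zp)
qed

section \<open>Correcting the numerical range by compact operators\<close>

lemma tail_null_low_left: "tail_null (low L o\<^sub>L A)"
  unfolding tail_null_def
proof (rule tendsto_eventually)
  show "\<forall>\<^sub>F n in sequentially. norm (high n o\<^sub>L (low L o\<^sub>L A)) = 0"
    unfolding eventually_sequentially
  proof (intro exI[of _ L] allI impI)
    fix n assume "L \<le> n"
    then have "high n o\<^sub>L (low L o\<^sub>L A) = 0"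
      by (intro blinfun_eqI ell2_eqI) (auto simp: high_nth low_nth zero_ell2.rep_eq)
    then show "norm (high n o\<^sub>L (low L o\<^sub>L A)) = 0" by simp
  qed
qed

lemma selfadj_diag_op: "(\<And>n. \<bar>f n\<bar> \<le> 1) \<Longrightarrow> selfadj (diag_op f)"
  by (simp add: selfadj_def clinear_diag_op cinner_diag_op)

lemma norm_comp3_le:
  fixes A B C :: "ell2 \<Rightarrow>\<^sub>L ell2"
  assumes "norm A \<le> 1" "norm C \<le> 1" shows "norm (A o\<^sub>L B o\<^sub>L C) \<le> norm B"
proof -
  have "norm (A o\<^sub>L B o\<^sub>L C) \<le> (norm A * norm B) * norm C"
    by (rule order_trans[OF norm_blinfun_compose mult_right_mono[OF norm_blinfun_compose]]) simp
  also have "\<dots> \<le> (1 * norm B) * 1" using assms by (intro mult_mono) auto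
  finally show ?thesis by simp
qed

lemma one_minus_cos_le: "1 - cos t \<le> t\<^sup>2 / 2" for t :: real
proof -
  have "cos t = 1 - 2 * (sin (t/2))\<^sup>2" using cos_double_sin[of "t/2"] by simp
  moreover have "\<bar>sin (t/2)\<bar> \<le> \<bar>t/2\<bar>" by (rule abs_sin_x_le_abs_x)
  then have "(sin (t/2))\<^sup>2 \<le> (t/2)\<^sup>2" unfolding abs_le_square_iff .
  ultimately show ?thesis by (simp add: power_divide)
qed

text \<open>Along a sufficiently sparse sequence of blocks the operators are almost block tridiagonal.
  If \<open>t i = (pi / 2) * (i / m)\<close> on the \<open>i\<close>-th block, then \<open>T - g T g - h T h\<close> is the Schur multiple of \<open>T\<close>
  with symbol \<open>1 - cos (t i - t j)\<close>, which is \<open>O(1 / m\<^sup>2)\<close> next to the diagonal.\<close>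

lemma almost_commuting_cut:
  fixes T :: "'d::finite \<Rightarrow> ell2 \<Rightarrow>\<^sub>L ell2"
  assumes T: "\<And>k. selfadj (T k)" "\<And>k. norm (T k) \<le> M" and \<epsilon>: "0 < \<epsilon>"
  shows "\<exists>\<theta> L. (\<forall>j<N. \<theta> j = 0) \<and> (\<forall>j\<ge>L. \<theta> j = pi / 2) \<and>
    (\<forall>k. norm (T k - (diag_op (\<lambda>j. cos (\<theta> j)) o\<^sub>L T k o\<^sub>L diag_op (\<lambda>j. cos (\<theta> j)))
      - (diag_op (\<lambda>j. sin (\<theta> j)) o\<^sub>L T k o\<^sub>L diag_op (\<lambda>j. sin (\<theta> j)))) \<le> \<epsilon>)"
proof -
  have M: "0 \<le> M" using T(2) norm_ge_zero order_trans by blast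
  \<comment> \<open>The near-diagonal terms will add up to at most 8 M / m; this choice makes that
    at most \<epsilon> / 2.\<close>
  obtain m0 where m0: "16 * M / \<epsilon> \<le> real m0" using real_arch_simple by blast
  define m where "m = Suc m0"
  have m: "1 \<le> m" "16 * M / \<epsilon> \<le> real m" using m0 by (auto simp: m_def)
  \<comment> \<open>There are (m + 1)^2 block entries with weight at most 2 each, so errors \<delta>
    in them add up to \<epsilon> / 2.\<close>
  define \<delta> where "\<delta> = \<epsilon> / (4 * (real m + 1)\<^sup>2)"
  have \<delta>: "0 < \<delta>" using \<epsilon> by (simp add: \<delta>_def add_nonneg_pos)
  have "\<exists>q>p. \<forall>k. norm (high q o\<^sub>L (T k o\<^sub>L low p)) \<le> \<delta>" for p
  proof -
    have "\<forall>\<^sub>F q in sequentially. norm (high q o\<^sub>L (T k o\<^sub>L low p)) < \<delta>" for k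
      using tail_null_comp_low[OF selfadj_clinear[OF T(1)], of k p] \<delta>
      unfolding tail_null_def by (rule order_tendstoD(2))
    then have "\<forall>\<^sub>F q in sequentially. \<forall>k\<in>UNIV. norm (high q o\<^sub>L (T k o\<^sub>L low p)) < \<delta>"
      by (subst eventually_ball_finite_distrib) auto
    then have "\<forall>\<^sub>F q in sequentially. p < q \<and> (\<forall>k\<in>UNIV. norm (high q o\<^sub>L (T k o\<^sub>L low p)) < \<delta>)"
      by (intro eventually_conj eventually_gt_at_top)
    then obtain q where "p < q \<and> (\<forall>k\<in>UNIV. norm (high q o\<^sub>L (T k o\<^sub>L low p)) < \<delta>)"
      unfolding eventually_sequentially by blast
    then show ?thesis by (intro exI[of _ q]) (auto intro: less_imp_le)
  qed
  then have "\<forall>p. \<exists>q. p < q \<and> (\<forall>k. norm (high q o\<^sub>L (T k o\<^sub>L low p)) \<le> \<delta>)" by blast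
  \<comment> \<open>From the endpoint p the next endpoint f p lies so far out that every
    \<open>T k\<close> carries vectors supported below p beyond f p only up to \<delta>.\<close>
  from choice[OF this] obtain f where f0: "\<forall>p. p < f p \<and> (\<forall>k. norm (high (f p) o\<^sub>L (T k o\<^sub>L low p)) \<le> \<delta>)" ..
  have f: "p < f p" "norm (high (f p) o\<^sub>L (T k o\<^sub>L low p)) \<le> \<delta>" for p k
    using f0[rule_format, of p] by blast+
  define n where "n i = (f ^^ i) N" for i
  have n0: "n 0 = N" and nS: "n (Suc i) = f (n i)" for i by (simp_all add: n_def)
  have "strict_mono n" unfolding strict_mono_Suc_iff by (simp add: nS f)
  then have nmono: "i \<le> j \<Longrightarrow> n i \<le> n j" for i j by (simp add: strict_mono_less_eq)
  \<comment> \<open>Block index of a coordinate: block 0 is everything below \<open>N\<close>, and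
    block \<open>m\<close> is the infinite remainder.\<close>
  define b where "b j = (LEAST i. i = m \<or> j < n i)" for j
  have bP: "b j = m \<or> j < n (b j)" for j unfolding b_def by (rule LeastI[of _ m]) simp
  have bm: "b j \<le> m" for j unfolding b_def by (rule Least_le) simp
  have bL: "i < b j \<Longrightarrow> n i \<le> j" for i j
    using not_less_Least[of i "\<lambda>i. i = m \<or> j < n i"] unfolding b_def[symmetric] by auto
  define t where "t i = pi / 2 * (real i / real m)" for i :: nat
  define \<theta> where "\<theta> j = t (b j)" for j
  define E where "E i = diag_op (\<lambda>j. if b j = i then 1 else 0)" for i
  have E_nth: "ell2_nth (E i v) j = (if b j = i then ell2_nth v j else 0)" for i v j
    unfolding E_def by (subst diag_op_nth) auto
  have E1: "norm (E i) \<le> 1" for i unfolding E_def by (rule norm_diag_op_le) auto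
  have Ec: "selfadj (E i)" for i unfolding E_def by (rule selfadj_diag_op) auto
  have decomp: "diag_op (\<lambda>j. c (b j)) v = (\<Sum>i\<le>m. c i *\<^sub>R E i v)" if c: "\<And>i. \<bar>c i\<bar> \<le> 1" for c v
  proof (rule ell2_eqI)
    fix j
    have "ell2_nth (\<Sum>i\<le>m. c i *\<^sub>R E i v) j = (\<Sum>i\<le>m. if b j = i then complex_of_real (c i) * ell2_nth v j else 0)"
      unfolding ell2_nth_sum by (intro sum.cong refl) (simp add: ell2_nth_simps E_nth)
    also have "\<dots> = complex_of_real (c (b j)) * ell2_nth v j" using bm[of j] by simp
    finally show "ell2_nth (diag_op (\<lambda>j. c (b j)) v) j = ell2_nth (\<Sum>i\<le>m. c i *\<^sub>R E i v) j"
      using c by (simp add: diag_op_nth)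
  qed
  have id_decomp: "v = (\<Sum>i\<le>m. E i v)" for v
  proof (rule ell2_eqI)
    fix j show "ell2_nth v j = ell2_nth (\<Sum>i\<le>m. E i v) j"
      unfolding ell2_nth_sum E_nth using bm[of j] by simp
  qed
  have far: "norm (E j o\<^sub>L T k o\<^sub>L E i) \<le> \<delta>" if ij: "Suc (Suc i) \<le> j" "j \<le> m" for i j k
  proof -
    have "low (n i) o\<^sub>L E i = E i"
    proof (intro blinfun_eqI ell2_eqI)
      fix v l show "ell2_nth ((low (n i) o\<^sub>L E i) v) l = ell2_nth (E i v) l"
        using bP[of l] ij by (auto simp: low_nth E_nth)
    qed
    moreover have "E j o\<^sub>L high (n (Suc i)) = E j"
    proof (intro blinfun_eqI ell2_eqI)
      fix v l show "ell2_nth ((E j o\<^sub>L high (n (Suc i))) v) l = ell2_nth (E j v) l"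
        using bL[of "Suc i" l] ij by (auto simp: high_nth E_nth)
    qed
    ultimately have "E j o\<^sub>L T k o\<^sub>L E i = E j o\<^sub>L (high (n (Suc i)) o\<^sub>L (T k o\<^sub>L low (n i))) o\<^sub>L E i"
      by (metis blinfun_compose_assoc)
    then have "norm (E j o\<^sub>L T k o\<^sub>L E i) \<le> norm (high (n (Suc i)) o\<^sub>L (T k o\<^sub>L low (n i)))"
      using norm_comp3_le[OF E1 E1] by metis
    then show ?thesis using f(2)[where p = "n i" and k = k] unfolding nS by linarith
  qed
  have far': "norm (E i o\<^sub>L T k o\<^sub>L E j) \<le> \<delta>" if ij: "Suc (Suc i) \<le> j" "j \<le> m" for i j k
  proof -
    have "E i o\<^sub>L T k o\<^sub>L E j = adj_op (E j o\<^sub>L T k o\<^sub>L E i)"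
      by (simp add: adj_comp clinear_comp selfadj_clinear[OF Ec] selfadj_clinear[OF T(1)] selfadj_adj[OF Ec]
          selfadj_adj[OF T(1)] blinfun_compose_assoc)
    then have "norm (E i o\<^sub>L T k o\<^sub>L E j) \<le> norm (E j o\<^sub>L T k o\<^sub>L E i)"
      using norm_adj_le[of "E j o\<^sub>L T k o\<^sub>L E i"]
      by (simp add: clinear_comp selfadj_clinear[OF Ec] selfadj_clinear[OF T(1)])
    then show ?thesis using far[OF ij, of k] by linarith
  qed
  \<comment> \<open>Neighbouring angles differ by pi / (2 m), so the weight is at most half its
    square; with pi < 4 this is at most 2 / m^2.\<close>
  define a where "a = 2 * M / (real m)\<^sup>2"
  have a0: "0 \<le> a" using M by (simp add: a_def)
  \<comment> \<open>For i = 0 the index i - 1 is again 0; the surplus term \<open>a\<close> on the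
    diagonal is nonnegative and does no harm.\<close>
  have entry: "\<bar>1 - cos (t i - t j)\<bar> * norm (E i o\<^sub>L T k o\<^sub>L E j) \<le>
      ((if j = Suc i then a else 0) + (if j = i - 1 then a else 0)) + 2 * \<delta>"
    if ij: "i \<le> m" "j \<le> m" for i j k
  proof -
    have c0: "0 \<le> 1 - cos (t i - t j)" "1 - cos (t i - t j) \<le> 2"
      using cos_le_one[of "t i - t j"] cos_ge_minus_one[of "t i - t j"] by linarith+
    have TM: "norm (E i o\<^sub>L T k o\<^sub>L E j) \<le> M" using norm_comp3_le[OF E1 E1, of i "T k" j] T(2)[of k] by linarith
    consider "i = j" | "j = Suc i \<or> i = Suc j" | "Suc (Suc i) \<le> j \<or> Suc (Suc j) \<le> i" by linarith
    then show ?thesis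
    proof cases
      case 1 then show ?thesis using a0 \<delta> by simp
    next
      case 2
      then have "\<bar>real i - real j\<bar> = 1" by auto
      then have "(t i - t j)\<^sup>2 = (pi / (2 * real m))\<^sup>2"
        unfolding t_def by (metis (no_types, opaque_lifting) abs_divide abs_mult diff_divide_distrib
            mult.right_neutral power2_abs right_diff_distrib divide_divide_eq_left times_divide_eq_right)
      then have "1 - cos (t i - t j) \<le> (pi / (2 * real m))\<^sup>2 / 2" using one_minus_cos_le[of "t i - t j"] by simp
      also have "\<dots> = pi\<^sup>2 / (8 * (real m)\<^sup>2)" by (simp add: power2_eq_square)
      also have "\<dots> \<le> 16 / (8 * (real m)\<^sup>2)"
      proof (rule divide_right_mono)
        have "pi\<^sup>2 \<le> 4\<^sup>2" using pi_less_4 by (intro power_mono) auto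
        then show "pi\<^sup>2 \<le> 16" by simp
      qed simp
      finally have "1 - cos (t i - t j) \<le> 2 / (real m)\<^sup>2" by simp
      then have "\<bar>1 - cos (t i - t j)\<bar> * norm (E i o\<^sub>L T k o\<^sub>L E j) \<le> 2 / (real m)\<^sup>2 * M"
        using c0 TM by (intro mult_mono) auto
      also have "\<dots> = a" by (simp add: a_def)
      finally show ?thesis using 2 a0 \<delta> by auto
    next
      case 3
      then have "norm (E i o\<^sub>L T k o\<^sub>L E j) \<le> \<delta>" using far far' ij by blast
      then have "\<bar>1 - cos (t i - t j)\<bar> * norm (E i o\<^sub>L T k o\<^sub>L E j) \<le> 2 * \<delta>"
        using c0 \<delta> by (intro mult_mono) auto
      then show ?thesis using a0 by auto
    qed
  qed
  have "norm (T k - (diag_op (\<lambda>j. cos (\<theta> j)) o\<^sub>L T k o\<^sub>L diag_op (\<lambda>j. cos (\<theta> j)))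
      - (diag_op (\<lambda>j. sin (\<theta> j)) o\<^sub>L T k o\<^sub>L diag_op (\<lambda>j. sin (\<theta> j)))) \<le> \<epsilon>" (is "norm ?D \<le> _") for k
  proof -
    have sandwich: "(diag_op (\<lambda>j. c (b j)) o\<^sub>L T k o\<^sub>L diag_op (\<lambda>j. c (b j))) v
        = (\<Sum>i\<le>m. \<Sum>j\<le>m. (c i * c j) *\<^sub>R E i (T k (E j v)))" if c: "\<And>i. \<bar>c i\<bar> \<le> 1" for c v
      by (simp add: decomp[of c, OF c] blinfun.sum_right blinfun.scaleR_right scaleR_sum_right,
          subst sum.swap, simp add: mult.commute)
    have Tv: "T k v = (\<Sum>i\<le>m. \<Sum>j\<le>m. E i (T k (E j v)))" for v
    proof -
      have "T k v = (\<Sum>i\<le>m. E i (T k v))" by (rule id_decomp)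
      also have "\<dots> = (\<Sum>i\<le>m. E i (T k (\<Sum>j\<le>m. E j v)))" using id_decomp[of v] by simp
      finally show ?thesis by (simp add: blinfun.sum_right)
    qed
    have D: "?D v = (\<Sum>i\<le>m. \<Sum>j\<le>m. (1 - cos (t i - t j)) *\<^sub>R E i (T k (E j v)))" for v
    proof -
      have "?D v = (\<Sum>i\<le>m. \<Sum>j\<le>m. E i (T k (E j v)))
          - (\<Sum>i\<le>m. \<Sum>j\<le>m. (cos (t i) * cos (t j)) *\<^sub>R E i (T k (E j v)))
          - (\<Sum>i\<le>m. \<Sum>j\<le>m. (sin (t i) * sin (t j)) *\<^sub>R E i (T k (E j v)))"
        unfolding \<theta>_def blinfun.diff_left
        by (rule arg_cong2[where f = "(-)", OF arg_cong2[where f = "(-)", OF Tv sandwich] sandwich]) auto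
      also have "\<dots> = (\<Sum>i\<le>m. \<Sum>j\<le>m. (1 - cos (t i - t j)) *\<^sub>R E i (T k (E j v)))"
        unfolding sum_subtractf[symmetric]
        by (intro sum.cong refl) (simp add: cos_diff scaleR_diff_left scaleR_add_left)
      finally show ?thesis .
    qed
    have "norm ?D \<le> (\<Sum>i\<le>m. \<Sum>j\<le>m. \<bar>1 - cos (t i - t j)\<bar> * norm (E i o\<^sub>L T k o\<^sub>L E j))"
    proof (rule norm_blinfun_bound)
      fix v
      have "norm (?D v) \<le> (\<Sum>i\<le>m. \<Sum>j\<le>m. (\<bar>1 - cos (t i - t j)\<bar> * norm (E i o\<^sub>L T k o\<^sub>L E j)) * norm v)"
        unfolding D
      proof (intro sum_norm_le)
        fix i j
        have "norm (E i (T k (E j v))) \<le> norm (E i o\<^sub>L T k o\<^sub>L E j) * norm v"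
          using norm_blinfun[of "E i o\<^sub>L T k o\<^sub>L E j" v] by simp
        then show "norm ((1 - cos (t i - t j)) *\<^sub>R E i (T k (E j v))) \<le>
          \<bar>1 - cos (t i - t j)\<bar> * norm (E i o\<^sub>L T k o\<^sub>L E j) * norm v"
          by (simp add: mult.assoc mult_left_mono)
      qed
      then show "norm (?D v) \<le> (\<Sum>i\<le>m. \<Sum>j\<le>m. \<bar>1 - cos (t i - t j)\<bar> * norm (E i o\<^sub>L T k o\<^sub>L E j)) * norm v"
        by (simp add: sum_distrib_right)
    qed (simp add: sum_nonneg)
    also have "\<dots> \<le> (\<Sum>i\<le>m. \<Sum>j\<le>m. ((if j = Suc i then a else 0) + (if j = i - 1 then a else 0)) + 2 * \<delta>)"
      by (intro sum_mono entry) auto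
    also have "\<dots> \<le> (\<Sum>i\<le>m. a + a + (real m + 1) * (2 * \<delta>))"
    proof (rule sum_mono)
      fix i assume "i \<in> {..m}"
      have "(\<Sum>j\<le>m. (if j = Suc i then a else 0)) \<le> a" "(\<Sum>j\<le>m. (if j = i - 1 then a else 0)) \<le> a"
        using a0 by auto
      then show "(\<Sum>j\<le>m. ((if j = Suc i then a else 0) + (if j = i - 1 then a else 0)) + 2 * \<delta>) \<le> a + a + (real m + 1) * (2 * \<delta>)"
        by (simp add: sum.distrib algebra_simps)
    qed
    also have "\<dots> = 2 * (real m + 1) * a + (real m + 1)\<^sup>2 * (2 * \<delta>)" by (simp add: power2_eq_square algebra_simps)
    also have "(real m + 1)\<^sup>2 * (2 * \<delta>) = \<epsilon> / 2"
    proof -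
      have "(real m + 1)\<^sup>2 \<noteq> 0" by (simp add: add_nonneg_pos)
      then show ?thesis unfolding \<delta>_def by (simp add: field_simps)
    qed
    also have "2 * (real m + 1) * a \<le> \<epsilon> / 2"
    proof -
      have "2 * (real m + 1) * a \<le> 2 * (2 * real m) * a" using m(1) a0 by (intro mult_right_mono) auto
      also have "\<dots> = 8 * M / real m" using m(1) by (simp add: a_def power2_eq_square)
      also have "\<dots> \<le> \<epsilon> / 2" using m \<epsilon> by (simp add: field_simps)
      finally show ?thesis .
    qed
    finally show ?thesis by simp
  qed
  moreover have "\<theta> j = 0" if "j < N" for j
  proof -
    have "b j = 0" using bL[of 0 j] that n0 by fastforce
    then show ?thesis by (simp add: \<theta>_def t_def)
  qed
  moreover have "\<theta> j = pi / 2" if "n m \<le> j" for j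
  proof -
    have "b j = m" using bP[of j] nmono[OF bm, of j] that by linarith
    then show ?thesis using m(1) by (simp add: \<theta>_def t_def)
  qed
  ultimately show ?thesis by (intro exI[of _ \<theta>] exI[of _ "n m"] conjI allI impI)
qed

section \<open>Form inequalities over a polar set\<close>

definition lin_form :: "real ^ 'd::finite \<Rightarrow> ('d \<Rightarrow> ell2 \<Rightarrow>\<^sub>L ell2) \<Rightarrow> ell2 \<Rightarrow> real" where
  "lin_form u T v = (\<Sum>k\<in>UNIV. vec_nth u k * inner v (T k v))"

text \<open>If \<open>Q\<close> is the polar of a compact convex set with 0 in its interior, this
  says that the joint numerical range of a selfadjoint tuple lies in 1 + e times that set.\<close>

definition form_bound :: "(real ^ 'd::finite) set \<Rightarrow> real \<Rightarrow> ('d \<Rightarrow> ell2 \<Rightarrow>\<^sub>L ell2) \<Rightarrow> bool" where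
  "form_bound Q e T \<longleftrightarrow> (\<forall>u\<in>Q. \<forall>v. lin_form u T v \<le> (1 + e) * (norm v)\<^sup>2)"

text \<open>The essential version: every positive error is admissible at the price of moving far
  enough out, uniformly over \<open>Q\<close>.\<close>

definition tail_bound :: "(real ^ 'd::finite) set \<Rightarrow> ('d \<Rightarrow> ell2 \<Rightarrow>\<^sub>L ell2) \<Rightarrow> bool" where
  "tail_bound Q T \<longleftrightarrow>
    (\<forall>e>0. \<exists>N. \<forall>u\<in>Q. \<forall>v. high N v = v \<longrightarrow> lin_form u T v \<le> (1 + e) * (norm v)\<^sup>2)"

lemma high_fixed_iff: "high N v = v \<longleftrightarrow> (\<forall>j<N. ell2_nth v j = 0)"
proof
  assume "high N v = v"
  then show "\<forall>j<N. ell2_nth v j = 0" by (metis high_nth)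
next
  assume "\<forall>j<N. ell2_nth v j = 0"
  then show "high N v = v" by (intro ell2_eqI) (simp add: high_nth)
qed

lemma tail_boundD:
  assumes "tail_bound Q T" "0 < e"
  obtains N where "\<And>u v. u \<in> Q \<Longrightarrow> high N v = v \<Longrightarrow> lin_form u T v \<le> (1 + e) * (norm v)\<^sup>2"
  using assms unfolding tail_bound_def by blast

text \<open>Only vectors supported beyond an arbitrary index matter, so modifying finitely many
  coordinates preserves the bound.\<close>

lemma tail_bound_cong:
  assumes "tail_bound Q T" and "\<And>u v. high L v = v \<Longrightarrow> lin_form u S v = lin_form u T v"
  shows "tail_bound Q S"
  unfolding tail_bound_def
proof (intro allI impI)
  fix e :: real assume "0 < e"
  then obtain N where N: "\<And>u v. u \<in> Q \<Longrightarrow> high N v = v \<Longrightarrow> lin_form u T v \<le> (1 + e) * (norm v)\<^sup>2"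
    using tail_boundD[OF assms(1)] by blast
  have "lin_form u S v \<le> (1 + e) * (norm v)\<^sup>2" if "u \<in> Q" "high (max N L) v = v" for u v
  proof -
    have "high N v = v" "high L v = v" using that(2) unfolding high_fixed_iff by auto
    then show ?thesis using N[OF that(1)] assms(2) by simp
  qed
  then show "\<exists>N. \<forall>u\<in>Q. \<forall>v. high N v = v \<longrightarrow> lin_form u S v \<le> (1 + e) * (norm v)\<^sup>2" by blast
qed

text \<open>The multiples of plus and minus the unit vectors in \<open>Q\<close> control each
  coordinate from both sides. The resulting bound depends on \<open>R\<close> alone, so it is the
  same for all tuples produced by the iteration.\<close>

lemma norm_le_of_form_bound:
  fixes T :: "'d::finite \<Rightarrow> ell2 \<Rightarrow>\<^sub>L ell2"
  assumes T: "\<And>k. selfadj (T k)" "form_bound Q e T" and e: "0 \<le> e" "e \<le> 1"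
    and R: "0 < R" "\<And>k. axis k (1/R) \<in> Q" "\<And>k. axis k (-1/R) \<in> Q"
  shows "norm (T k) \<le> 2 * R"
proof (rule norm_selfadj_le[OF T(1)])
  fix v
  have ax: "lin_form (axis k c) T v = c * inner v (T k v)" for c
  proof -
    have "lin_form (axis k c) T v = (\<Sum>l\<in>UNIV. if l = k then c * inner v (T l v) else 0)"
      unfolding lin_form_def by (intro sum.cong refl) (simp add: axis_def)
    then show ?thesis by simp
  qed
  have "1/R * inner v (T k v) \<le> (1 + e) * (norm v)\<^sup>2" "-1/R * inner v (T k v) \<le> (1 + e) * (norm v)\<^sup>2"
    using T(2) R(2,3)[of k] unfolding form_bound_def ax[symmetric] by blast+
  moreover have "(1 + e) * (norm v)\<^sup>2 \<le> 2 * (norm v)\<^sup>2" using e by (intro mult_right_mono) auto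
  ultimately have "\<bar>inner v (T k v)\<bar> / R \<le> 2 * (norm v)\<^sup>2" by (auto simp: abs_if)
  then show "\<bar>inner v (T k v)\<bar> \<le> 2 * R * (norm v)\<^sup>2" using R(1) by (simp add: field_simps)
qed (use R in simp)

text \<open>At \<open>v\<close> the new form is the old one at g v divided by 1 + e, plus the old
  one at h v. These are at most the squared norm of g v and 1 + e / 2 times that of h v, and the two
  squared norms add up to that of \<open>v\<close>. Beyond \<open>L\<close> nothing changes, so the
  tail bound is available for the next step.\<close>

lemma cut_step:
  fixes T :: "'d::finite \<Rightarrow> ell2 \<Rightarrow>\<^sub>L ell2"
  assumes T: "\<And>k. selfadj (T k)" "form_bound Q e T" "tail_bound Q T" "\<And>k. norm (T k) \<le> M"
    and e: "0 < e"
  shows "\<exists>T'. (\<forall>k. selfadj (T' k)) \<and> form_bound Q (e/2) T' \<and> tail_bound Q T' \<and>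
    (\<forall>k. tail_null (T' k - T k)) \<and> (\<forall>k. norm (T' k - T k) \<le> e * (M + 1))"
proof -
  \<comment> \<open>Beyond \<open>N\<close> the error is already e / 2, the accuracy wanted after
    the step; h vanishes below \<open>N\<close>.\<close>
  obtain N where N: "\<And>u v. u \<in> Q \<Longrightarrow> high N v = v \<Longrightarrow> lin_form u T v \<le> (1 + e/2) * (norm v)\<^sup>2"
    using tail_boundD[OF T(3), of "e/2"] e by auto
  obtain \<theta> L where \<theta>0: "\<forall>j<N. \<theta> j = 0" "\<forall>j\<ge>L. \<theta> j = pi / 2"
    and cut0: "\<forall>k. norm (T k - (diag_op (\<lambda>j. cos (\<theta> j)) o\<^sub>L T k o\<^sub>L diag_op (\<lambda>j. cos (\<theta> j)))
      - (diag_op (\<lambda>j. sin (\<theta> j)) o\<^sub>L T k o\<^sub>L diag_op (\<lambda>j. sin (\<theta> j)))) \<le> e"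
    using almost_commuting_cut[of T, OF T(1,4) e, of N] by (elim exE conjE) (rule that)
  define g where "g = diag_op (\<lambda>j. cos (\<theta> j))"
  define h where "h = diag_op (\<lambda>j. sin (\<theta> j))"
  note \<theta> = \<theta>0[rule_format] and cut = cut0[rule_format, folded g_def h_def]
  have g_nth: "ell2_nth (g v) j = complex_of_real (cos (\<theta> j)) * ell2_nth v j" for v j
    unfolding g_def by (rule diag_op_nth) simp
  have h_nth: "ell2_nth (h v) j = complex_of_real (sin (\<theta> j)) * ell2_nth v j" for v j
    unfolding h_def by (rule diag_op_nth) simp
  have gs: "selfadj g" and hs: "selfadj h" unfolding g_def h_def by (rule selfadj_diag_op, simp)+
  have g1: "norm g \<le> 1" unfolding g_def by (rule norm_diag_op_le) simp
  have pyth: "(norm (g v))\<^sup>2 + (norm (h v))\<^sup>2 = (norm v)\<^sup>2" for v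
  proof -
    have "(norm (g v))\<^sup>2 + (norm (h v))\<^sup>2 = (\<Sum>n. (cmod (ell2_nth (g v) n))\<^sup>2 + (cmod (ell2_nth (h v) n))\<^sup>2)"
      unfolding norm_ell2_square by (rule suminf_add[OF ell2_summable_norm ell2_summable_norm])
    also have "\<dots> = (\<Sum>n. (cmod (ell2_nth v n))\<^sup>2)"
    proof (rule suminf_cong)
      fix n
      have "(cmod (ell2_nth (g v) n))\<^sup>2 + (cmod (ell2_nth (h v) n))\<^sup>2
          = ((cos (\<theta> n))\<^sup>2 + (sin (\<theta> n))\<^sup>2) * (cmod (ell2_nth v n))\<^sup>2"
        by (simp only: g_nth h_nth norm_mult norm_of_real power_mult_distrib power2_abs distrib_right)
      then show "(cmod (ell2_nth (g v) n))\<^sup>2 + (cmod (ell2_nth (h v) n))\<^sup>2 = (cmod (ell2_nth v n))\<^sup>2" by simp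
    qed
    finally show ?thesis by (simp add: norm_ell2_square)
  qed
  define T' where "T' k = (1 / (1 + e)) *\<^sub>R (g o\<^sub>L T k o\<^sub>L g) + (h o\<^sub>L T k o\<^sub>L h)" for k
  have form: "lin_form u T' v = 1 / (1 + e) * lin_form u T (g v) + lin_form u T (h v)" for u v
  proof -
    have "inner v (T' k v) = 1 / (1 + e) * inner (g v) (T k (g v)) + inner (h v) (T k (h v))" for k
      using selfadj_inner[OF gs, of v "T k (g v)"] selfadj_inner[OF hs, of v "T k (h v)"]
      by (simp add: T'_def blinfun.bilinear_simps inner_add_right)
    then show ?thesis
      unfolding lin_form_def sum_distrib_left sum.distrib[symmetric]
      by (intro sum.cong refl) (simp add: distrib_left)
  qed
  have "form_bound Q (e/2) T'"
    unfolding form_bound_def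
  proof (intro ballI allI)
    fix u v assume u: "u \<in> Q"
    have "lin_form u T (g v) \<le> (1 + e) * (norm (g v))\<^sup>2" using T(2) u unfolding form_bound_def by blast
    then have 1: "1 / (1 + e) * lin_form u T (g v) \<le> (norm (g v))\<^sup>2" using e by (simp add: field_simps)
    have "high N (h v) = h v" unfolding high_fixed_iff by (simp add: h_nth \<theta>(1))
    then have 2: "lin_form u T (h v) \<le> (1 + e/2) * (norm (h v))\<^sup>2" by (rule N[OF u])
    have "(norm (g v))\<^sup>2 \<le> (1 + e/2) * (norm (g v))\<^sup>2" using e by (simp add: distrib_right)
    then have "lin_form u T' v \<le> (1 + e/2) * ((norm (g v))\<^sup>2 + (norm (h v))\<^sup>2)"
      unfolding form distrib_left using 1 2 by linarith
    then show "lin_form u T' v \<le> (1 + e/2) * (norm v)\<^sup>2" unfolding pyth .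
  qed
  moreover have "tail_bound Q T'"
  proof (rule tail_bound_cong[OF T(3)])
    fix u v assume "high L v = v"
    then have v: "ell2_nth v j = 0" if "j < L" for j using that unfolding high_fixed_iff by blast
    have "g v = 0"
    proof (rule ell2_eqI)
      fix j show "ell2_nth (g v) j = ell2_nth 0 j"
        by (cases "j < L") (simp_all add: g_nth v \<theta>(2) zero_ell2.rep_eq)
    qed
    moreover have "h v = v"
    proof (rule ell2_eqI)
      fix j show "ell2_nth (h v) j = ell2_nth v j"
        by (cases "j < L") (simp_all add: h_nth v \<theta>(2))
    qed
    ultimately show "lin_form u T' v = lin_form u T v" unfolding form by (simp add: lin_form_def)
  qed
  moreover have "selfadj (T' k)" for k
    unfolding T'_def by (intro selfadj_add selfadj_scaleR selfadj_sandwich T gs hs)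
  moreover have "tail_null (T' k - T k)" for k
  proof -
    \<comment> \<open>Both \<open>g\<close> and h - 1 vanish beyond \<open>L\<close>, so every term
      of T' - T contains a factor of finite rank.\<close>
    have gl: "g = low L o\<^sub>L g"
    proof (intro blinfun_eqI ell2_eqI)
      fix v j show "ell2_nth (g v) j = ell2_nth ((low L o\<^sub>L g) v) j"
        by (cases "j < L") (simp_all add: g_nth low_nth \<theta>(2))
    qed
    have hl: "h - id_blinfun = low L o\<^sub>L (h - id_blinfun)"
    proof (intro blinfun_eqI ell2_eqI)
      fix v j show "ell2_nth ((h - id_blinfun) v) j = ell2_nth ((low L o\<^sub>L (h - id_blinfun)) v) j"
        by (cases "j < L") (simp_all add: h_nth low_nth \<theta>(2) blinfun.diff_left ell2_nth_simps)
    qed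
    have "tail_null (g o\<^sub>L (T k o\<^sub>L g))" by (subst gl) (simp only: blinfun_compose_assoc tail_null_low_left)
    moreover have "tail_null ((h - id_blinfun) o\<^sub>L (T k o\<^sub>L h))"
      by (subst hl) (simp only: blinfun_compose_assoc tail_null_low_left)
    moreover have "tail_null (T k o\<^sub>L (h - id_blinfun))"
    proof (subst hl, subst blinfun_compose_assoc[symmetric])
      show "tail_null (T k o\<^sub>L low L o\<^sub>L (h - id_blinfun))"
        by (intro tail_null_comp_right tail_null_comp_low selfadj_clinear T)
    qed
    moreover have "T' k - T k = (1 / (1 + e)) *\<^sub>R (g o\<^sub>L (T k o\<^sub>L g))
        + (((h - id_blinfun) o\<^sub>L (T k o\<^sub>L h)) + (T k o\<^sub>L (h - id_blinfun)))"
      by (rule blinfun_eqI) (simp add: T'_def blinfun.bilinear_simps)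
    ultimately show ?thesis by (metis tail_null_add tail_null_scaleR)
  qed
  moreover have "norm (T' k - T k) \<le> e * (M + 1)" for k
  proof -
    have M: "0 \<le> M" using T(4)[of k] norm_ge_zero order_trans by blast
    \<comment> \<open>One part is the error of the cut, at most e. The other comes from dividing by
      1 + e, and has norm at most e / (1 + e) times \<open>M\<close>.\<close>
    have "T' k - T k = - (T k - (g o\<^sub>L T k o\<^sub>L g) - (h o\<^sub>L T k o\<^sub>L h)) - (e / (1 + e)) *\<^sub>R (g o\<^sub>L T k o\<^sub>L g)"
    proof -
      have "1 / (1 + e) = 1 - e / (1 + e)" using e by (simp add: field_simps)
      then show ?thesis unfolding T'_def by (simp add: scaleR_diff_left)
    qed
    then have "norm (T' k - T k) \<le> norm (T k - (g o\<^sub>L T k o\<^sub>L g) - (h o\<^sub>L T k o\<^sub>L h))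
        + norm ((e / (1 + e)) *\<^sub>R (g o\<^sub>L T k o\<^sub>L g))"
      by (metis norm_minus_cancel norm_triangle_ineq4)
    also have "norm ((e / (1 + e)) *\<^sub>R (g o\<^sub>L T k o\<^sub>L g)) \<le> e * M"
    proof -
      have "norm (g o\<^sub>L T k o\<^sub>L g) \<le> M" using norm_comp3_le[OF g1 g1, of "T k"] T(4)[of k] by linarith
      moreover have "e / (1 + e) \<le> e" "0 \<le> e / (1 + e)" using e by (simp_all add: field_simps)
      ultimately show ?thesis unfolding norm_scaleR using e M by (intro mult_mono) auto
    qed
    finally show ?thesis using cut[of k] by (simp add: algebra_simps)
  qed
  ultimately show ?thesis by (intro exI[of _ T']) blast
qed

text \<open>With high = 1 - low the difference is - (low S high + S low), a finite rank
  operator.\<close>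

lemma tail_null_compression:
  assumes "clinear_ell2 S" shows "tail_null ((high N o\<^sub>L S o\<^sub>L high N) - S)"
proof -
  have "(high N o\<^sub>L S o\<^sub>L high N) - S = - 1 *\<^sub>R ((low N o\<^sub>L (S o\<^sub>L high N)) + (S o\<^sub>L low N))"
  proof (rule blinfun_eqI)
    fix v
    have h: "high N w = w - low N w" for w using low_plus_high[of N w] by (simp add: algebra_simps)
    show "((high N o\<^sub>L S o\<^sub>L high N) - S) v = (- 1 *\<^sub>R ((low N o\<^sub>L (S o\<^sub>L high N)) + (S o\<^sub>L low N))) v"
      by (simp add: h blinfun.bilinear_simps)
  qed
  then show ?thesis
    by (metis tail_null_scaleR tail_null_add tail_null_low_left tail_null_comp_low assms)
qed

text \<open>Start of the iteration: compressing to coordinates where the tail bound holds with error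
  1 gives that bound everywhere, because the compression evaluates the form only at
  \<open>high N v\<close>.\<close>

lemma form_bound_one_exists:
  fixes S :: "'d::finite \<Rightarrow> ell2 \<Rightarrow>\<^sub>L ell2"
  assumes S: "\<And>k. selfadj (S k)" "tail_bound Q S"
  shows "\<exists>T. (\<forall>k. selfadj (T k) \<and> tail_null (T k - S k)) \<and> form_bound Q 1 T \<and> tail_bound Q T"
proof -
  have one: "(0::real) < 1" by simp
  obtain N where N: "\<And>u v. u \<in> Q \<Longrightarrow> high N v = v \<Longrightarrow> lin_form u S v \<le> (1 + 1) * (norm v)\<^sup>2"
    using tail_boundD[OF S(2) one] by blast
  define T where "T k = high N o\<^sub>L S k o\<^sub>L high N" for k
  have form: "lin_form u T v = lin_form u S (high N v)" for u v
    using selfadj_inner[OF selfadj_high[of N], of v] by (simp add: lin_form_def T_def)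
  have "form_bound Q 1 T"
    unfolding form_bound_def
  proof (intro ballI allI)
    fix u v assume u: "u \<in> Q"
    have "lin_form u T v \<le> (1 + 1) * (norm (high N v))\<^sup>2"
      unfolding form by (rule N[OF u]) (simp add: high_high)
    also have "\<dots> \<le> (1 + 1) * (norm v)\<^sup>2"
      using norm_high_apply_le[of N v] by (intro mult_left_mono power_mono) auto
    finally show "lin_form u T v \<le> (1 + 1) * (norm v)\<^sup>2" .
  qed
  moreover have "tail_bound Q T" by (rule tail_bound_cong[OF S(2), where L = N]) (simp add: form)
  moreover have "selfadj (T k)" for k unfolding T_def by (intro selfadj_sandwich selfadj_high S)
  moreover have "tail_null (T k - S k)" for k
    unfolding T_def by (rule tail_null_compression[OF selfadj_clinear[OF S(1)]])
  ultimately show ?thesis by blast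
qed

text \<open>The errors 2^(-n) give increments of norm at most 2^(-n) (2 R + 1), so the tuples
  converge in norm; norm limits preserve compactness of the difference from \<open>S\<close> and
  turn the form bounds into the bound with error 0.\<close>

lemma compact_correction:
  fixes S :: "'d::finite \<Rightarrow> ell2 \<Rightarrow>\<^sub>L ell2"
  assumes S: "\<And>k. selfadj (S k)" "tail_bound Q S"
    and R: "0 < R" "\<And>k. axis k (1/R) \<in> Q" "\<And>k. axis k (-1/R) \<in> Q"
  shows "\<exists>L. (\<forall>k. selfadj (L k) \<and> tail_null (L k - S k)) \<and> form_bound Q 0 L"
proof -
  define P where "P n T \<longleftrightarrow> (\<forall>k. selfadj (T k) \<and> tail_null (T k - S k)) \<and>
    form_bound Q ((1/2) ^ n) T \<and> tail_bound Q T" for n :: nat and T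
  \<comment> \<open>The factor 2 R is the uniform norm bound of the iterates; the additional 1 is
    the contribution of the cut.\<close>
  have "\<exists>f. \<forall>n. P n (f n) \<and> (\<forall>k. norm (f (Suc n) k - f n k) \<le> (1/2) ^ n * (2 * R + 1))"
  proof (rule dependent_nat_choice)
    show "\<exists>T. P 0 T" unfolding P_def using form_bound_one_exists[of S, OF S] by simp
    fix T n assume T: "P n T"
    have le1: "(1/2 :: real) ^ n \<le> 1" by (intro power_le_one) auto
    have sT: "selfadj (T k)" and tT: "tail_null (T k - S k)" and fT: "form_bound Q ((1/2) ^ n) T" and bT: "tail_bound Q T"
      for k using T unfolding P_def by blast+
    have M: "norm (T k) \<le> 2 * R" for k
      by (rule norm_le_of_form_bound[OF sT fT _ le1 R]) simp
    obtain T' where T': "\<forall>k. selfadj (T' k)" "form_bound Q ((1/2) ^ n / 2) T'" "tail_bound Q T'"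
      "\<forall>k. tail_null (T' k - T k)" "\<forall>k. norm (T' k - T k) \<le> (1/2) ^ n * (2 * R + 1)"
      using cut_step[OF sT fT bT M] by auto
    have "tail_null (T' k - S k)" for k
      using tail_null_add[OF T'(4)[rule_format, of k] tT[of k]] by simp
    then show "\<exists>T'. P (Suc n) T' \<and> (\<forall>k. norm (T' k - T k) \<le> (1/2) ^ n * (2 * R + 1))"
      unfolding P_def using T' by (intro exI[of _ T']) simp
  qed
  then obtain f where f: "\<And>n. P n (f n)" "\<And>n k. norm (f (Suc n) k - f n k) \<le> (1/2) ^ n * (2 * R + 1)"
    by blast
  have "\<exists>l. (\<lambda>n. f n k) \<longlonglongrightarrow> l" for k
  proof -
    have "summable (\<lambda>n. (1/2 :: real) ^ n * (2 * R + 1))" by (intro summable_mult2 summable_geometric) simp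
    then have "summable (\<lambda>n. f (Suc n) k - f n k)"
      by (rule summable_comparison_test'[where N = 0]) (rule f(2))
    then have "convergent (\<lambda>n. \<Sum>i<n. f (Suc i) k - f i k)" by (simp add: summable_iff_convergent)
    then have "convergent (\<lambda>n. f n k - f 0 k)" by (simp only: sum_lessThan_telescope[where f = "\<lambda>i. f i k"])
    then obtain l where "(\<lambda>n. f n k - f 0 k) \<longlonglongrightarrow> l" by (auto simp: convergent_def)
    from tendsto_add[OF this tendsto_const[of "f 0 k"]] show ?thesis by auto
  qed
  then obtain L where L: "\<And>k. (\<lambda>n. f n k) \<longlonglongrightarrow> L k" by metis
  have "selfadj (L k)" for k by (rule selfadj_tendsto[OF L]) (use f(1) in \<open>simp add: P_def\<close>)
  moreover have "tail_null (L k - S k)" for k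
    by (rule tail_null_tendsto[OF tendsto_diff[OF L tendsto_const]]) (use f(1) in \<open>simp add: P_def\<close>)
  moreover have "form_bound Q 0 L"
    unfolding form_bound_def
  proof (intro ballI allI)
    fix u v assume u: "u \<in> Q"
    have 1: "(\<lambda>n. lin_form u (f n) v) \<longlonglongrightarrow> lin_form u L v"
      unfolding lin_form_def by (intro tendsto_intros blinfun.tendsto L tendsto_const)
    have 2: "(\<lambda>n. (1 + (1/2) ^ n) * (norm v)\<^sup>2) \<longlonglongrightarrow> (1 + 0) * (norm v)\<^sup>2"
      by (intro tendsto_intros LIMSEQ_power_zero) simp
    show "lin_form u L v \<le> (1 + 0) * (norm v)\<^sup>2"
      by (rule LIMSEQ_le[OF 1 2]) (use f(1) u in \<open>auto simp: P_def form_bound_def\<close>)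
  qed
  ultimately show ?thesis by blast
qed

section \<open>Unital completely positive maps on operators\<close>

lemma op_system_subset_algebra:
  fixes x :: "'d::finite \<Rightarrow> ell2 \<Rightarrow>\<^sub>L ell2"
  assumes "operator_algebra B" and x: "\<And>k. x k \<in> B"
  shows "op_system bounded_ops x \<subseteq> B"
proof -
  interpret operator_algebra B by fact
  let ?t = "\<lambda>\<alpha> \<beta> k. cscale (\<alpha> k) (x k) + cscale (\<beta> k) (adj_op (x k))"
  have t: "?t \<alpha> \<beta> k \<in> B" for \<alpha> \<beta> :: "'d \<Rightarrow> complex" and k
    by (intro add_mem cscale_mem adj_mem x)
  have "finsum bounded_ops (?t \<alpha> \<beta>) UNIV = sum (?t \<alpha> \<beta>) UNIV" for \<alpha> \<beta> :: "'d \<Rightarrow> complex"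
    by (rule finsum_eq_sum) (use mem_clinear[OF t] in \<open>simp_all add: clinear_zero clinear_add\<close>)
  then show ?thesis unfolding op_system_def bounded_ops_simps
    using x by (auto intro!: add_mem cscale_mem id_mem sum_mem adj_mem)
qed

lemma positive_matrix_cstarI:
  assumes x: "\<And>k. clinear_ell2 (x k)"
    and b: "\<And>i j. i < m \<Longrightarrow> j < m \<Longrightarrow> b i j \<in> carrier (cstar x)"
  shows "positive_matrix (cstar x) m (\<lambda>i j. \<Sum>k<m. adj_op (b k i) o\<^sub>L b k j)"
proof -
  interpret operator_algebra "carrier (cstar x)" by (rule operator_algebra_cstar[OF x])
  have "finsum (cstar x) (\<lambda>k. adj_op (b k i) o\<^sub>L b k j) {..<m} = (\<Sum>k<m. adj_op (b k i) o\<^sub>L b k j)"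
    if "i < m" "j < m" for i j
    by (rule finsum_eq_sum) (use b that in \<open>auto simp: zero_mem add_mem comp_mem adj_mem\<close>)
  then show ?thesis unfolding positive_matrix_def cstar_simps[OF refl x] using b
    by (intro exI[of _ b] conjI allI impI) simp_all
qed

locale ucp_cstar =
  fixes x :: "'d::finite \<Rightarrow> ell2 \<Rightarrow>\<^sub>L ell2" and \<psi> :: "(ell2 \<Rightarrow>\<^sub>L ell2) \<Rightarrow> complex mat" and n :: nat
  assumes clinear_x: "clinear_ell2 (x k)" and ucp: "\<psi> \<in> ucp_maps (cstar x) (matrix_alg n)"
begin

sublocale operator_algebra "carrier (cstar x)"
  by (rule operator_algebra_cstar[OF clinear_x])

text \<open>Scalar functionals attached to the matrix-valued map; for unit \<open>v\<close> they are
  states, to which Cauchy-Schwarz applies.\<close>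

definition \<rho> :: "(nat \<Rightarrow> complex) \<Rightarrow> (ell2 \<Rightarrow>\<^sub>L ell2) \<Rightarrow> complex" where
  "\<rho> v T = mform n (\<psi> T) v v"

lemma \<psi>_carrier: "T \<in> carrier (cstar x) \<Longrightarrow> \<psi> T \<in> carrier_mat n n"
  by (rule ucp_carrier[OF ucp])

lemma \<psi>_add: "S \<in> carrier (cstar x) \<Longrightarrow> T \<in> carrier (cstar x) \<Longrightarrow> \<psi> (S + T) = \<psi> S + \<psi> T"
  using ucp_add[OF ucp] by (simp add: cstar_simps[OF refl clinear_x])

lemma \<psi>_cscale: "T \<in> carrier (cstar x) \<Longrightarrow> \<psi> (cscale c T) = c \<cdot>\<^sub>m \<psi> T"
  using ucp_smult[OF ucp] by (simp add: cstar_simps[OF refl clinear_x])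

lemma \<psi>_id: "\<psi> id_blinfun = 1\<^sub>m n"
  using ucp_one[OF ucp] by (simp add: cstar_simps[OF refl clinear_x])

lemma \<rho>_add: "S \<in> carrier (cstar x) \<Longrightarrow> T \<in> carrier (cstar x) \<Longrightarrow> \<rho> v (S + T) = \<rho> v S + \<rho> v T"
  unfolding \<rho>_def by (simp only: \<psi>_add mform_add[OF \<psi>_carrier \<psi>_carrier])

lemma \<rho>_cscale: "T \<in> carrier (cstar x) \<Longrightarrow> \<rho> v (cscale c T) = c * \<rho> v T"
  unfolding \<rho>_def by (simp only: \<psi>_cscale mform_smult[OF \<psi>_carrier])

lemma \<rho>_scaleR: "T \<in> carrier (cstar x) \<Longrightarrow> \<rho> v (r *\<^sub>R T) = complex_of_real r * \<rho> v T"
  unfolding scaleR_eq_cscale by (rule \<rho>_cscale)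

lemma \<rho>_diff: "S \<in> carrier (cstar x) \<Longrightarrow> T \<in> carrier (cstar x) \<Longrightarrow> \<rho> v (S - T) = \<rho> v S - \<rho> v T"
  using \<rho>_add[of S "(-1) *\<^sub>R T" v] \<rho>_scaleR[of T v "-1"] scaleR_mem[of T "-1"] by simp

lemma \<rho>_id: "\<rho> v id_blinfun = complex_of_real (sq_norm n v)"
  unfolding \<rho>_def by (simp only: \<psi>_id mform_one)

lemma \<rho>_zero: "\<rho> v 0 = 0"
  using \<rho>_scaleR[OF zero_mem, of v 0] by simp

lemma \<rho>_sum: "(\<And>i. i \<in> I \<Longrightarrow> f i \<in> carrier (cstar x)) \<Longrightarrow> \<rho> v (sum f I) = (\<Sum>i\<in>I. \<rho> v (f i))"
  by (induction I rule: infinite_finite_induct) (simp_all add: \<rho>_zero \<rho>_add sum_mem)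

lemma \<rho>_nonneg: "b \<in> carrier (cstar x) \<Longrightarrow> \<rho> v (adj_op b o\<^sub>L b) \<in> \<real>\<^sub>\<ge>\<^sub>0"
  unfolding \<rho>_def by (rule ucp_cstar_form_nonneg[OF refl clinear_x ucp])

lemma \<rho>_nonneg_selfadj: "b \<in> carrier (cstar x) \<Longrightarrow> selfadj b \<Longrightarrow> \<rho> v (b o\<^sub>L b) \<in> \<real>\<^sub>\<ge>\<^sub>0"
  using \<rho>_nonneg[of b v] by (simp add: selfadj_adj)

lemma \<rho>_expand:
  assumes z: "z \<in> carrier (cstar x)" and v: "sq_norm n v = 1"
  shows "\<rho> v (adj_op z o\<^sub>L z) + t * \<rho> v (adj_op z) + cnj t * \<rho> v z + cnj t * t \<in> \<real>\<^sub>\<ge>\<^sub>0"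
proof -
  let ?w = "z + cscale t id_blinfun"
  note m = z adj_mem[OF z] comp_mem[OF adj_mem[OF z] z] id_mem
  have "adj_op ?w o\<^sub>L ?w = (adj_op z o\<^sub>L z) + cscale t (adj_op z) + cscale (cnj t) z + cscale (cnj t * t) id_blinfun"
    by (rule blinfun_eqI)
      (simp add: adj_add adj_cscale adj_id clinear_cscale clinear_id mem_clinear z blinfun.bilinear_simps
        cscale_apply scaleC_simps clinear_scaleC[OF clinear_adj] clinear_scaleC mult.commute)
  moreover have "\<rho> v (adj_op ?w o\<^sub>L ?w) \<in> \<real>\<^sub>\<ge>\<^sub>0" by (intro \<rho>_nonneg add_mem cscale_mem z id_mem)
  ultimately show ?thesis using m v by (simp add: \<rho>_add \<rho>_cscale \<rho>_id add_mem cscale_mem)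
qed

text \<open>In the expansion of the square of z + t the value t = 0 gives realness, t = 1 and t = i
  give the compatibility with adjoints, and the minimizing value t = - \<rho> v z gives the
  inequality.\<close>

lemma \<rho>_cauchy_schwarz:
  assumes z: "z \<in> carrier (cstar x)" and v: "sq_norm n v = 1"
  shows "(cmod (\<rho> v z))\<^sup>2 \<le> Re (\<rho> v (adj_op z o\<^sub>L z))"
proof -
  note e = \<rho>_expand[OF z v, unfolded complex_nonneg_Reals_iff]
  have "Im (\<rho> v (adj_op z o\<^sub>L z)) = 0" using e[of 0] by simp
  then have h: "\<rho> v (adj_op z) = cnj (\<rho> v z)" using e[of 1] e[of \<i>] by (simp add: complex_eq_iff)
  have "0 \<le> Re (\<rho> v (adj_op z o\<^sub>L z)) - (Re (\<rho> v z))\<^sup>2 - (Im (\<rho> v z))\<^sup>2"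
    using e[of "- \<rho> v z"] by (simp add: h power2_eq_square)
  then show ?thesis by (simp add: cmod_power2)
qed

end

text \<open>For each half-space containing \<open>K\<close> the operator c - sum of u_k x_k is
  positive, so it is a square inside C*(x), and the states \<rho> v are nonnegative on it.\<close>

lemma ucp_forms_in:
  fixes x :: "'d::finite \<Rightarrow> ell2 \<Rightarrow>\<^sub>L ell2" and K :: "(real ^ 'd) set"
  assumes K: "compact K" "convex K"
    and x: "\<And>k. selfadj (x k)"
    and half: "\<And>u c v. (\<And>q. q \<in> K \<Longrightarrow> inner u q \<le> c) \<Longrightarrow> lin_form u x v \<le> c * (norm v)\<^sup>2"
    and \<psi>: "\<psi> \<in> ucp_maps (cstar x) (matrix_alg n)"
  shows "forms_in n K (\<lambda>k. \<psi> (x k))"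
proof -
  interpret ucp_cstar x \<psi> n by (unfold_locales) (auto simp: \<psi> x selfadj_clinear)
  have xC: "x k \<in> carrier (cstar x)" for k by (rule mem_cstar[OF clinear_x])
  show ?thesis unfolding forms_in_def
  proof (intro allI impI)
    fix v assume v: "sq_norm n v = 1"
    have "\<exists>p\<in>K. \<forall>k. \<rho> v (x k) = complex_of_real (vec_nth p k)"
    proof (rule complex_point_mem[OF K])
      fix u :: "real ^ 'd" and c :: real assume uc: "\<And>q. q \<in> K \<Longrightarrow> inner u q \<le> c"
      define h where "h = c *\<^sub>R id_blinfun - (\<Sum>k\<in>UNIV. vec_nth u k *\<^sub>R x k)"
      have hC: "h \<in> carrier (cstar x)" unfolding h_def by (intro diff_mem scaleR_mem id_mem sum_mem xC)
      have hs: "selfadj h" unfolding h_def by (intro selfadj_diff selfadj_scaleR selfadj_id selfadj_sum x)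
      have "0 \<le> inner w (h w)" for w
      proof -
        have "inner w (h w) = c * (norm w)\<^sup>2 - lin_form u x w"
          by (simp add: h_def blinfun.bilinear_simps blinfun.sum_left inner_diff_right inner_sum_right
              lin_form_def power2_norm_eq_inner)
        then show ?thesis using half[OF uc, of w] by simp
      qed
      then obtain b where b: "b \<in> carrier (cstar x)" "selfadj b" "b o\<^sub>L b = h"
        using sqrt_exists[OF hC hs] by blast
      have "\<rho> v h \<in> \<real>\<^sub>\<ge>\<^sub>0" using \<rho>_nonneg_selfadj[OF b(1,2), of v] b(3) by simp
      moreover have "\<rho> v h = complex_of_real c - (\<Sum>k\<in>UNIV. complex_of_real (vec_nth u k) * \<rho> v (x k))"
        unfolding h_def
        by (simp add: \<rho>_diff \<rho>_scaleR \<rho>_sum \<rho>_id scaleR_mem id_mem sum_mem xC v)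
      ultimately show "complex_of_real c - (\<Sum>k\<in>UNIV. complex_of_real (vec_nth u k) * \<rho> v (x k)) \<in> \<real>\<^sub>\<ge>\<^sub>0" by simp
    qed
    then show "\<exists>p\<in>K. \<forall>k. mform n (\<psi> (x k)) v v = complex_of_real (vec_nth p k)" by (simp add: \<rho>_def)
  qed
qed

subsection \<open>Extension along compact perturbations\<close>

lemma mform_polarization:
  "4 * mform n a u w = mform n a (\<lambda>i. u i + w i) (\<lambda>i. u i + w i) - mform n a (\<lambda>i. u i - w i) (\<lambda>i. u i - w i)
    - \<i> * (mform n a (\<lambda>i. u i + \<i> * w i) (\<lambda>i. u i + \<i> * w i) - mform n a (\<lambda>i. u i - \<i> * w i) (\<lambda>i. u i - \<i> * w i))"
  unfolding mform_def sum_distrib_left sum_subtractf[symmetric]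
  by (intro sum.cong refl) (simp add: algebra_simps)

text \<open>Polarization at two basis vectors: each of the four combinations has squared norm at
  most 4, also when the two vectors coincide, and the total 16 c is divided by 4.\<close>

lemma entry_le_of_forms:
  assumes a: "\<And>v. sq_norm n v = 1 \<Longrightarrow> cmod (mform n a v v) \<le> c" and ij: "i < n" "j < n"
  shows "cmod (a $$ (i, j)) \<le> 4 * c"
proof -
  have gen: "cmod (mform n a v v) \<le> c * sq_norm n v" for v
  proof (cases "sq_norm n v = 0")
    case False
    then obtain w where w: "sq_norm n w = 1" "\<forall>a. mform n a v v = complex_of_real (sq_norm n v) * mform n a w w"
      using mform_normalize by blast
    have "cmod (mform n a v v) = sq_norm n v * cmod (mform n a w w)"
      using sq_norm_nonneg by (simp add: w(2)[rule_format, of a] norm_mult)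
    then show ?thesis using mult_left_mono[OF a[OF w(1)] sq_norm_nonneg[of n v]] by (simp add: mult.commute)
  qed (simp add: mform_zero)
  define d where "d i j = (if j = i then 1 else 0 :: complex)" for i j :: nat
  have "mform n a (d i) (d j) = (\<Sum>i'<n. if i' = i then a $$ (i, j) else 0)"
    unfolding mform_def using ij
    by (intro sum.cong refl) (auto simp: d_def if_distrib[where f = "(*) z" for z] cong: if_cong)
  then have e: "mform n a (d i) (d j) = a $$ (i, j)" using ij by simp
  have sq: "sq_norm n (\<lambda>l. d i l + s * d j l) \<le> 4" if s: "cmod s = 1" for s
  proof -
    have "sq_norm n (\<lambda>l. d i l + s * d j l) \<le> (\<Sum>l<n. 2 * (if l = i then 1 else 0) + 2 * (if l = j then 1 else 0))"
      unfolding sq_norm_def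
    proof (rule sum_mono)
      fix l
      have "cmod (d i l + s * d j l) \<le> (if l = i then 1 else 0) + (if l = j then 1 else 0)"
        by (rule norm_triangle_le) (auto simp: d_def norm_mult s)
      then have "(cmod (d i l + s * d j l))\<^sup>2 \<le> ((if l = i then 1 else 0) + (if l = j then 1 else 0))\<^sup>2"
        by (intro power_mono) auto
      also have "\<dots> \<le> 2 * (if l = i then 1 else 0) + 2 * (if l = j then 1 else 0)" by simp
      finally show "(cmod (d i l + s * d j l))\<^sup>2 \<le> 2 * (if l = i then 1 else 0) + 2 * (if l = j then 1 else 0)" .
    qed
    also have "\<dots> = 4" using ij by (simp add: sum.distrib sum_distrib_left[symmetric])
    finally show ?thesis .
  qed
  have c: "0 \<le> c"
  proof -
    have "sq_norm n (d i) = (\<Sum>l<n. if l = i then 1 else 0)" unfolding sq_norm_def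
      by (intro sum.cong refl) (auto simp: d_def)
    then have "sq_norm n (d i) = 1" using ij by simp
    from a[OF this] show ?thesis using norm_ge_zero order_trans by blast
  qed
  have tm: "cmod (mform n a (\<lambda>l. d i l + s * d j l) (\<lambda>l. d i l + s * d j l)) \<le> 4 * c" if "cmod s = 1" for s
    using gen[of "\<lambda>l. d i l + s * d j l"] mult_left_mono[OF sq[OF that] c] by simp
  have "cmod (4 * a $$ (i, j)) \<le> 4 * c + 4 * c + (4 * c + 4 * c)"
    unfolding e[symmetric] mform_polarization[of n a "d i" "d j"]
  proof (intro order_trans[OF norm_triangle_ineq4] add_mono)
    show "cmod (mform n a (\<lambda>l. d i l + d j l) (\<lambda>l. d i l + d j l)) \<le> 4 * c" using tm[of 1] by simp
    show "cmod (mform n a (\<lambda>l. d i l - d j l) (\<lambda>l. d i l - d j l)) \<le> 4 * c" using tm[of "-1"] by simp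
    show "cmod (\<i> * (mform n a (\<lambda>l. d i l + \<i> * d j l) (\<lambda>l. d i l + \<i> * d j l)
        - mform n a (\<lambda>l. d i l - \<i> * d j l) (\<lambda>l. d i l - \<i> * d j l))) \<le> 4 * c + 4 * c"
      using tm[of \<i>] tm[of "-\<i>"] norm_triangle_ineq4[of "mform n a (\<lambda>l. d i l + \<i> * d j l) (\<lambda>l. d i l + \<i> * d j l)"
        "mform n a (\<lambda>l. d i l - \<i> * d j l) (\<lambda>l. d i l - \<i> * d j l)"] by (simp add: norm_mult)
  qed
  then show ?thesis by (simp add: norm_mult)
qed

locale essential_ucp = ucp_cstar +
  assumes null: "\<And>T. T \<in> carrier (cstar x) \<Longrightarrow> tail_null T \<Longrightarrow> \<psi> T = 0\<^sub>m n n"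
begin

text \<open>The compact operator \<open>y\<close> may lie outside C*(x). Up to a compact term the
  form of the adjoint of z times z is at most the squared norm of z - y. Splitting the difference
  inside C*(x) into a compact part, where \<rho> vanishes, and a negative square gives the bound at
  this product; Cauchy-Schwarz transfers it to \<open>z\<close>.\<close>

lemma \<rho>_essential_bound:
  assumes z: "z \<in> carrier (cstar x)" and y: "clinear_ell2 y" "tail_null y" and v: "sq_norm n v = 1"
  shows "cmod (\<rho> v z) \<le> norm (z - y)"
proof -
  define w where "w = z - y"
  define c where "c = norm w"
  have zc: "clinear_ell2 z" by (rule mem_clinear[OF z])
  have wc: "clinear_ell2 w" unfolding w_def by (intro clinear_diff zc y)
  define f where "f = (adj_op z o\<^sub>L z) - c\<^sup>2 *\<^sub>R id_blinfun"
  \<comment> \<open>With z = w + y the product of the adjoint of \<open>z\<close> and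
    \<open>z\<close> is that of \<open>w\<close> plus exactly this compact operator.\<close>
  define k where "k = (adj_op y o\<^sub>L z) + (adj_op w o\<^sub>L y)"
  have fC: "f \<in> carrier (cstar x)" unfolding f_def by (intro diff_mem comp_mem adj_mem scaleR_mem id_mem z)
  have "selfadj (adj_op z o\<^sub>L z)"
    by (rule selfadjI) (simp_all add: clinear_comp clinear_adj zc adj_comp adj_adj)
  then have fs: "selfadj f" unfolding f_def by (intro selfadj_diff selfadj_scaleR selfadj_id)
  have kc: "clinear_ell2 k" unfolding k_def by (intro clinear_add clinear_comp clinear_adj zc y wc)
  have kt: "tail_null k"
    unfolding k_def by (intro tail_null_add tail_null_comp_right[OF tail_null_adj[OF y]]
        tail_null_comp_left clinear_adj wc y)
  have "inner u (f u) \<le> inner u (k u)" for u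
  proof -
    have zw: "z u = w u + y u" by (simp add: w_def blinfun.diff_left)
    have a: "inner u (adj_op T s) = inner (T u) s" if "clinear_ell2 T" for T s
      using cinner_adj_right[OF that] by (simp add: inner_ell2_def)
    have "inner u (f u) = (norm (z u))\<^sup>2 - c\<^sup>2 * (norm u)\<^sup>2"
      by (simp add: f_def blinfun.bilinear_simps inner_diff_right a zc power2_norm_eq_inner)
    also have "(norm (z u))\<^sup>2 = (norm (w u))\<^sup>2 + inner u (k u)"
      unfolding k_def by (simp add: blinfun.bilinear_simps inner_add_right a y wc power2_norm_eq_inner zw
          inner_add_left inner_commute)
    finally have "inner u (f u) = (norm (w u))\<^sup>2 - c\<^sup>2 * (norm u)\<^sup>2 + inner u (k u)" by simp
    moreover have "(norm (w u))\<^sup>2 \<le> (c * norm u)\<^sup>2"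
      using norm_blinfun[of w u] unfolding c_def by (intro power_mono) auto
    ultimately show ?thesis by (simp add: power_mult_distrib)
  qed
  then obtain p b where pb: "p \<in> carrier (cstar x)" "tail_null p" "b \<in> carrier (cstar x)" "selfadj b"
      "f = p - (b o\<^sub>L b)"
    using essentially_nonpositive_split[OF fC fs kc kt] by blast
  have "\<rho> v p = 0" unfolding \<rho>_def null[OF pb(1,2)] by (simp add: mform_def)
  then have "\<rho> v f = - \<rho> v (b o\<^sub>L b)" unfolding pb(5) by (simp add: \<rho>_diff pb comp_mem)
  moreover have "\<rho> v f = \<rho> v (adj_op z o\<^sub>L z) - complex_of_real (c\<^sup>2)"
    unfolding f_def using z v by (simp add: \<rho>_diff \<rho>_scaleR \<rho>_id comp_mem adj_mem scaleR_mem id_mem)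
  ultimately have "Re (\<rho> v (adj_op z o\<^sub>L z)) \<le> c\<^sup>2"
    using \<rho>_nonneg_selfadj[OF pb(3,4), of v] by (simp add: complex_nonneg_Reals_iff complex_eq_iff)
  then have "(cmod (\<rho> v z))\<^sup>2 \<le> c\<^sup>2" using \<rho>_cauchy_schwarz[OF z v] by linarith
  then have "cmod (\<rho> v z) \<le> c" by (rule power2_le_imp_le) (simp add: c_def)
  then show ?thesis by (simp add: c_def w_def)
qed

lemma entry_essential_bound:
  assumes "z \<in> carrier (cstar x)" "clinear_ell2 y" "tail_null y" "i < n" "j < n"
  shows "cmod (\<psi> z $$ (i, j)) \<le> 4 * norm (z - y)"
  by (rule entry_le_of_forms[OF _ assms(4,5)]) (use \<rho>_essential_bound[OF assms(1-3)] in \<open>simp add: \<rho>_def\<close>)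

text \<open>\<open>ess_lim Z y\<close> says that the classes of \<open>Z\<close> in the Calkin algebra converge to that of \<open>y\<close>.\<close>

definition ess_lim :: "(nat \<Rightarrow> ell2 \<Rightarrow>\<^sub>L ell2) \<Rightarrow> (ell2 \<Rightarrow>\<^sub>L ell2) \<Rightarrow> bool" where
  "ess_lim Z y \<longleftrightarrow> (\<forall>N. Z N \<in> carrier (cstar x)) \<and>
    (\<exists>k. (\<forall>N. clinear_ell2 (k N) \<and> tail_null (k N)) \<and> (\<lambda>N. Z N + k N) \<longlonglongrightarrow> y)"

lemma ess_limI:
  assumes "\<And>N. Z N \<in> carrier (cstar x)" "\<And>N. clinear_ell2 (k N)" "\<And>N. tail_null (k N)"
    "(\<lambda>N. Z N + k N) \<longlonglongrightarrow> y"
  shows "ess_lim Z y"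
  unfolding ess_lim_def using assms by blast

lemma ess_limE:
  assumes "ess_lim Z y"
  shows "\<exists>k. (\<forall>N. clinear_ell2 (Z N) \<and> clinear_ell2 (k N) \<and> tail_null (k N)) \<and> (\<lambda>N. Z N + k N) \<longlonglongrightarrow> y"
  using assms mem_clinear unfolding ess_lim_def by metis

lemma ess_lim_mem: "ess_lim Z y \<Longrightarrow> Z N \<in> carrier (cstar x)"
  by (simp add: ess_lim_def)

lemma ess_lim_clinear:
  assumes "ess_lim Z y" shows "clinear_ell2 y"
proof -
  obtain k where k0: "\<forall>N. clinear_ell2 (Z N) \<and> clinear_ell2 (k N) \<and> tail_null (k N)"
    and k3: "(\<lambda>N. Z N + k N) \<longlonglongrightarrow> y"
    using ess_limE[OF assms(1)] by (elim exE conjE) (rule that)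
  have k: "clinear_ell2 (Z N)" "clinear_ell2 (k N)" "(\<lambda>N. Z N + k N) \<longlonglongrightarrow> y" for N
    using k0 k3 by blast+
  show ?thesis by (rule clinear_tendsto[OF k(3)]) (intro clinear_add k)
qed

lemma ess_lim_add:
  assumes "ess_lim Z y" "ess_lim Z' y'" shows "ess_lim (\<lambda>N. Z N + Z' N) (y + y')"
proof -
  obtain k where k0: "\<forall>N. clinear_ell2 (Z N) \<and> clinear_ell2 (k N) \<and> tail_null (k N)"
    and k3: "(\<lambda>N. Z N + k N) \<longlonglongrightarrow> y"
    using ess_limE[OF assms(1)] by (elim exE conjE) (rule that)
  have k: "clinear_ell2 (k N)" "tail_null (k N)" "(\<lambda>N. Z N + k N) \<longlonglongrightarrow> y" for N
    using k0 k3 by blast+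
  obtain k' where k'0: "\<forall>N. clinear_ell2 (Z' N) \<and> clinear_ell2 (k' N) \<and> tail_null (k' N)"
    and k'3: "(\<lambda>N. Z' N + k' N) \<longlonglongrightarrow> y'"
    using ess_limE[OF assms(2)] by (elim exE conjE) (rule that)
  have k': "clinear_ell2 (k' N)" "tail_null (k' N)" "(\<lambda>N. Z' N + k' N) \<longlonglongrightarrow> y'" for N
    using k'0 k'3 by blast+
  show ?thesis
  proof (rule ess_limI)
    show "(\<lambda>N. (Z N + Z' N) + (k N + k' N)) \<longlonglongrightarrow> y + y'"
      using tendsto_add[OF k(3) k'(3)] by (simp add: algebra_simps)
  qed (intro add_mem clinear_add tail_null_add ess_lim_mem[OF assms(1)] ess_lim_mem[OF assms(2)] k k')+
qed

lemma bounded_linear_cscale: "bounded_linear (cscale c)"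
proof (rule bounded_linear_intro[where K = "cmod c"])
  show "norm (cscale c T) \<le> norm T * cmod c" for T using norm_cscale[of c T] by (simp add: mult.commute)
qed (rule blinfun_eqI, simp add: cscale_apply blinfun.bilinear_simps scaleC_simps scaleR_eq_scaleC mult.commute)+

lemma ess_lim_cscale:
  assumes "ess_lim Z y" shows "ess_lim (\<lambda>N. cscale c (Z N)) (cscale c y)"
proof -
  obtain k where k0: "\<forall>N. clinear_ell2 (Z N) \<and> clinear_ell2 (k N) \<and> tail_null (k N)"
    and k3: "(\<lambda>N. Z N + k N) \<longlonglongrightarrow> y"
    using ess_limE[OF assms(1)] by (elim exE conjE) (rule that)
  have k: "clinear_ell2 (k N)" "tail_null (k N)" "(\<lambda>N. Z N + k N) \<longlonglongrightarrow> y" for N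
    using k0 k3 by blast+
  show ?thesis
  proof (rule ess_limI)
    show "(\<lambda>N. cscale c (Z N) + cscale c (k N)) \<longlonglongrightarrow> cscale c y"
      using bounded_linear.tendsto[OF bounded_linear_cscale k(3), of c]
      by (simp add: linear_add[OF bounded_linear.linear[OF bounded_linear_cscale]])
  qed (intro cscale_mem clinear_cscale tail_null_cscale ess_lim_mem[OF assms] k)+
qed

lemma tendsto_adj:
  assumes "Y \<longlonglongrightarrow> y" "\<And>N. clinear_ell2 (Y N)" "clinear_ell2 y"
  shows "(\<lambda>N. adj_op (Y N)) \<longlonglongrightarrow> adj_op y"
proof (rule LIM_zero_cancel, rule Lim_null_comparison)
  show "(\<lambda>N. norm (Y N - y)) \<longlonglongrightarrow> 0" using assms(1) by (simp add: tendsto_norm_zero_iff LIM_zero_iff)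
  show "\<forall>\<^sub>F N in sequentially. norm (adj_op (Y N) - adj_op y) \<le> norm (Y N - y)"
    using norm_adj_le[OF clinear_diff[OF assms(2,3)]] by (simp add: adj_diff assms(2,3))
qed

lemma ess_lim_adj:
  assumes "ess_lim Z y" shows "ess_lim (\<lambda>N. adj_op (Z N)) (adj_op y)"
proof -
  obtain k where k0: "\<forall>N. clinear_ell2 (Z N) \<and> clinear_ell2 (k N) \<and> tail_null (k N)"
    and k3: "(\<lambda>N. Z N + k N) \<longlonglongrightarrow> y"
    using ess_limE[OF assms(1)] by (elim exE conjE) (rule that)
  have k: "clinear_ell2 (Z N)" "clinear_ell2 (k N)" "tail_null (k N)" "(\<lambda>N. Z N + k N) \<longlonglongrightarrow> y" for N
    using k0 k3 by blast+
  show ?thesis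
  proof (rule ess_limI)
    show "(\<lambda>N. adj_op (Z N) + adj_op (k N)) \<longlonglongrightarrow> adj_op y"
      using tendsto_adj[OF k(4) clinear_add[OF k(1,2)] ess_lim_clinear[OF assms]] by (simp add: adj_add k)
  qed (intro adj_mem clinear_adj tail_null_adj ess_lim_mem[OF assms] k)+
qed

lemma ess_lim_comp:
  assumes "ess_lim Z y" "ess_lim Z' y'" shows "ess_lim (\<lambda>N. Z N o\<^sub>L Z' N) (y o\<^sub>L y')"
proof -
  obtain k where k0: "\<forall>N. clinear_ell2 (Z N) \<and> clinear_ell2 (k N) \<and> tail_null (k N)"
    and k3: "(\<lambda>N. Z N + k N) \<longlonglongrightarrow> y"
    using ess_limE[OF assms(1)] by (elim exE conjE) (rule that)
  have k: "clinear_ell2 (Z N)" "clinear_ell2 (k N)" "tail_null (k N)" "(\<lambda>N. Z N + k N) \<longlonglongrightarrow> y" for N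
    using k0 k3 by blast+
  obtain k' where k'0: "\<forall>N. clinear_ell2 (Z' N) \<and> clinear_ell2 (k' N) \<and> tail_null (k' N)"
    and k'3: "(\<lambda>N. Z' N + k' N) \<longlonglongrightarrow> y'"
    using ess_limE[OF assms(2)] by (elim exE conjE) (rule that)
  have k': "clinear_ell2 (Z' N)" "clinear_ell2 (k' N)" "tail_null (k' N)" "(\<lambda>N. Z' N + k' N) \<longlonglongrightarrow> y'" for N
    using k'0 k'3 by blast+
  \<comment> \<open>The compact remainder of the product: (Z + k)(Z' + k') - Z Z' = Z k' + k (Z' +
    k').\<close>
  let ?k = "\<lambda>N. (Z N o\<^sub>L k' N) + (k N o\<^sub>L (Z' N + k' N))"
  show ?thesis
  proof (rule ess_limI)
    have "(\<lambda>N. (Z N + k N) o\<^sub>L (Z' N + k' N)) \<longlonglongrightarrow> (y o\<^sub>L y')"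
      by (rule bounded_bilinear.tendsto[OF bounded_bilinear_blinfun_compose k(4) k'(4)])
    moreover have "(Z N + k N) o\<^sub>L (Z' N + k' N) = (Z N o\<^sub>L Z' N) + ?k N" for N
      by (rule blinfun_eqI) (simp add: blinfun.bilinear_simps)
    ultimately show "(\<lambda>N. (Z N o\<^sub>L Z' N) + ?k N) \<longlonglongrightarrow> (y o\<^sub>L y')" by simp
    show "clinear_ell2 (?k N)" for N by (intro clinear_add clinear_comp k k')
    show "tail_null (?k N)" for N by (intro tail_null_add tail_null_comp_left tail_null_comp_right k k')
    show "Z N o\<^sub>L Z' N \<in> carrier (cstar x)" for N
      by (intro comp_mem ess_lim_mem[OF assms(1)] ess_lim_mem[OF assms(2)])
  qed
qed

lemma ess_lim_const:
  assumes "z \<in> carrier (cstar x)" "clinear_ell2 k" "tail_null k" shows "ess_lim (\<lambda>_. z) (z + k)"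
  by (rule ess_limI[where k = "\<lambda>_. k"]) (use assms in auto)

lemma ess_lim_sum:
  assumes "\<And>i. i \<in> I \<Longrightarrow> ess_lim (Z i) (y i)"
  shows "ess_lim (\<lambda>N. \<Sum>i\<in>I. Z i N) (\<Sum>i\<in>I. y i)"
  using assms
proof (induction I rule: infinite_finite_induct)
  case (insert i I)
  then show ?case by (simp add: ess_lim_add)
qed (use ess_lim_const[OF zero_mem clinear_zero tail_null_zero] in simp_all)

lemma ess_lim_entry_null:
  assumes "ess_lim Z 0" "i < n" "j < n" shows "(\<lambda>N. \<psi> (Z N) $$ (i, j)) \<longlonglongrightarrow> 0"
proof -
  obtain k where k0: "\<forall>N. clinear_ell2 (Z N) \<and> clinear_ell2 (k N) \<and> tail_null (k N)"
    and k3: "(\<lambda>N. Z N + k N) \<longlonglongrightarrow> 0"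
    using ess_limE[OF assms(1)] by (elim exE conjE) (rule that)
  have k: "clinear_ell2 (k N)" "tail_null (k N)" "(\<lambda>N. Z N + k N) \<longlonglongrightarrow> 0" for N
    using k0 k3 by blast+
  show ?thesis
  proof (rule Lim_null_comparison)
    show "(\<lambda>N. 4 * norm (Z N + k N)) \<longlonglongrightarrow> 0"
      using tendsto_mult_right_zero[OF tendsto_norm_zero[OF k(3)], of 4] .
    have "cmod (\<psi> (Z N) $$ (i, j)) \<le> 4 * norm (Z N - (-1) *\<^sub>R k N)" for N
      by (intro entry_essential_bound ess_lim_mem[OF assms(1)] clinear_scaleR tail_null_scaleR k assms)
    then show "\<forall>\<^sub>F N in sequentially. norm (\<psi> (Z N) $$ (i, j)) \<le> 4 * norm (Z N + k N)" by simp
  qed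
qed

text \<open>The compact corrections may vary with the index, but the entries of \<psi> are bounded
  by the distance to the compact operators, so the Cauchy property modulo compacts is
  enough.\<close>

lemma ess_lim_entry_convergent:
  assumes "ess_lim Z y" "i < n" "j < n" shows "convergent (\<lambda>N. \<psi> (Z N) $$ (i, j))"
proof -
  obtain k where k0: "\<forall>N. clinear_ell2 (Z N) \<and> clinear_ell2 (k N) \<and> tail_null (k N)"
    and k3: "(\<lambda>N. Z N + k N) \<longlonglongrightarrow> y"
    using ess_limE[OF assms(1)] by (elim exE conjE) (rule that)
  have k: "clinear_ell2 (k N)" "tail_null (k N)" "(\<lambda>N. Z N + k N) \<longlonglongrightarrow> y" for N
    using k0 k3 by blast+
  have "Cauchy (\<lambda>N. \<psi> (Z N) $$ (i, j))"
  proof (rule CauchyI)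
    fix e :: real assume "0 < e"
    moreover have "Cauchy (\<lambda>N. Z N + k N)" using k(3) by (rule LIMSEQ_imp_Cauchy)
    ultimately obtain M where M: "\<And>p q. p \<ge> M \<Longrightarrow> q \<ge> M \<Longrightarrow> norm ((Z p + k p) - (Z q + k q)) < e / 4"
      using CauchyD[of "\<lambda>N. Z N + k N" "e / 4"] by auto
    have "norm (\<psi> (Z p) $$ (i, j) - \<psi> (Z q) $$ (i, j)) < e" if "p \<ge> M" "q \<ge> M" for p q
    proof -
      note m = ess_lim_mem[OF assms(1)]
      have e1: "\<psi> (Z p + (-1) *\<^sub>R Z q) $$ (i, j) = \<psi> (Z p) $$ (i, j) - \<psi> (Z q) $$ (i, j)"
        using \<psi>_carrier[OF m, of p] \<psi>_carrier[OF m, of q] assms(2,3)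
        by (simp add: scaleR_eq_cscale \<psi>_add \<psi>_cscale cscale_mem m del: scaleR_minus_left)
      have e2: "cmod (\<psi> (Z p + (-1) *\<^sub>R Z q) $$ (i, j)) \<le> 4 * norm ((Z p + (-1) *\<^sub>R Z q) - (k q - k p))"
        by (intro entry_essential_bound add_mem scaleR_mem m clinear_diff tail_null_diff k assms)
      have e3: "(Z p + (-1) *\<^sub>R Z q) - (k q - k p) = (Z p + k p) - (Z q + k q)" by simp
      show ?thesis using e2 M[OF that] unfolding e1 e3 by linarith
    qed
    then show "\<exists>M. \<forall>p\<ge>M. \<forall>q\<ge>M. norm (\<psi> (Z p) $$ (i, j) - \<psi> (Z q) $$ (i, j)) < e" by blast
  qed
  then show ?thesis by (rule Cauchy_convergent)
qed

text \<open>The value is computed from one arbitrarily chosen approximating sequence;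
  \<open>ext_tendsto\<close> shows that every other one gives the same limit.\<close>

definition ext :: "(ell2 \<Rightarrow>\<^sub>L ell2) \<Rightarrow> complex mat" where
  "ext y = mat n n (\<lambda>(i, j). lim (\<lambda>N. \<psi> ((SOME Z. ess_lim Z y) N) $$ (i, j)))"

lemma ext_carrier: "ext y \<in> carrier_mat n n"
  by (simp add: ext_def)

lemma ext_dim: "dim_row (ext y) = n" "dim_col (ext y) = n"
  by (simp_all add: ext_def)

text \<open>The difference of two approximating sequences tends to 0 modulo compacts, so its entries
  under \<psi> tend to 0.\<close>

lemma ext_tendsto:
  assumes Z: "ess_lim Z y" and ij: "i < n" "j < n"
  shows "(\<lambda>N. \<psi> (Z N) $$ (i, j)) \<longlonglongrightarrow> ext y $$ (i, j)"
proof -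
  define Y where "Y = (SOME Z. ess_lim Z y)"
  have Y: "ess_lim Y y" unfolding Y_def by (rule someI[of _ Z]) (rule Z)
  have 1: "(\<lambda>N. \<psi> (Y N) $$ (i, j)) \<longlonglongrightarrow> ext y $$ (i, j)"
    using ess_lim_entry_convergent[OF Y ij] ij by (simp add: ext_def Y_def[symmetric] convergent_LIMSEQ_iff)
  have "y + cscale (-1) y = 0" by (rule blinfun_eqI) (simp add: cscale_apply blinfun.bilinear_simps scaleC_simps)
  then have "ess_lim (\<lambda>N. Z N + cscale (-1) (Y N)) 0"
    using ess_lim_add[OF Z ess_lim_cscale[OF Y, of "-1"]] by simp
  then have 2: "(\<lambda>N. \<psi> (Z N + cscale (-1) (Y N)) $$ (i, j)) \<longlonglongrightarrow> 0" by (rule ess_lim_entry_null[OF _ ij])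
  have "\<psi> (Z N + cscale (-1) (Y N)) $$ (i, j) + \<psi> (Y N) $$ (i, j) = \<psi> (Z N) $$ (i, j)" for N
    using \<psi>_carrier[OF ess_lim_mem[OF Z, of N]] \<psi>_carrier[OF ess_lim_mem[OF Y, of N]] ij
    by (simp add: \<psi>_add \<psi>_cscale cscale_mem ess_lim_mem[OF Z] ess_lim_mem[OF Y])
  then show ?thesis using tendsto_add[OF 2 1] by simp
qed

text \<open>The operators whose class modulo compacts lies in the norm closure of the classes from
  C*(x). This is a C*-algebra containing every compact perturbation of each x k, hence also the
  algebra such perturbations generate.\<close>

definition ess_closure :: "(ell2 \<Rightarrow>\<^sub>L ell2) set" where
  "ess_closure = {y. \<exists>Z. ess_lim Z y}"

text \<open>One sufficiently late term is taken from the approximating sequence of each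
  \<open>f i\<close>, with error below 1 / (i + 1).\<close>

lemma ess_closure_tendsto:
  assumes "\<And>i::nat. f i \<in> ess_closure" "f \<longlonglongrightarrow> y" shows "y \<in> ess_closure"
proof -
  have "\<exists>z k. z \<in> carrier (cstar x) \<and> clinear_ell2 k \<and> tail_null k \<and> norm (z + k - f i) < inverse (real (Suc i))" for i
  proof -
    obtain Z where Z: "ess_lim Z (f i)" using assms(1)[of i] unfolding ess_closure_def by blast
    obtain k where k0: "\<forall>N. clinear_ell2 (Z N) \<and> clinear_ell2 (k N) \<and> tail_null (k N)"
      and k3: "(\<lambda>N. Z N + k N) \<longlonglongrightarrow> f i"
      using ess_limE[OF Z] by (elim exE conjE) (rule that)
    obtain N where "norm (Z N + k N - f i) < inverse (real (Suc i))"
      using LIMSEQ_D[OF k3, of "inverse (real (Suc i))"] by auto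
    then show ?thesis using k0 ess_lim_mem[OF Z, of N] by (intro exI[of _ "Z N"] exI[of _ "k N"]) simp
  qed
  then obtain z k where zk: "\<And>i. z i \<in> carrier (cstar x)" "\<And>i. clinear_ell2 (k i)" "\<And>i. tail_null (k i)"
    "\<And>i. norm (z i + k i - f i) < inverse (real (Suc i))" by metis
  have "(\<lambda>i. z i + k i - f i) \<longlonglongrightarrow> 0"
    by (rule Lim_null_comparison[OF _ LIMSEQ_inverse_real_of_nat]) (use zk(4) in \<open>auto intro!: always_eventually less_imp_le\<close>)
  from tendsto_add[OF this assms(2)] have "(\<lambda>i. z i + k i) \<longlonglongrightarrow> y" by simp
  then have "ess_lim z y" by (rule ess_limI[OF zk(1,2,3)])
  then show ?thesis unfolding ess_closure_def by blast
qed

lemma operator_algebra_ess_closure: "operator_algebra ess_closure"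
proof
  have add: "y + y' \<in> ess_closure" and comp: "y o\<^sub>L y' \<in> ess_closure"
    if "y \<in> ess_closure" "y' \<in> ess_closure" for y y'
    using that ess_lim_add ess_lim_comp unfolding ess_closure_def by blast+
  have un: "adj_op y \<in> ess_closure" "cscale c y \<in> ess_closure" "clinear_ell2 y" if "y \<in> ess_closure" for y c
    using that ess_lim_adj ess_lim_cscale ess_lim_clinear unfolding ess_closure_def by blast+
  have zero: "0 \<in> ess_closure"
    using ess_lim_const[OF zero_mem clinear_zero tail_null_zero] unfolding ess_closure_def by auto
  show "cstar_subalgebra ess_closure bounded_ops"
    unfolding cstar_subalgebra_bounded_ops
  proof (intro conjI ballI allI impI)
    show "a \<in> ess_closure" if "(\<forall>i. f i \<in> ess_closure) \<and> f \<longlonglongrightarrow> a" for f :: "nat \<Rightarrow> _" and a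
      using that ess_closure_tendsto[of f a] by simp
  qed (simp_all add: add comp un zero)
  show "id_blinfun \<in> ess_closure"
    using ess_lim_const[OF id_mem clinear_zero tail_null_zero] unfolding ess_closure_def by auto
qed

text \<open>The factors of a positive matrix are approximated separately. The squares of the
  approximants form positive matrices over C*(x), where \<psi> is completely positive, and the
  inequality passes to the limit.\<close>

lemma ext_ucp:
  assumes x': "\<And>k. clinear_ell2 (x' k)" "\<And>k. x' k \<in> ess_closure"
  shows "ext \<in> ucp_maps (cstar x') (matrix_alg n)"
proof -
  have sub: "carrier (cstar x') \<subseteq> ess_closure"
    using cstar_gen_least[OF operator_algebra.subalgebra[OF operator_algebra_ess_closure]
        op_system_subset_algebra[of _ x', OF operator_algebra_ess_closure x'(2)]] .
  note simps = cstar_simps[of "cstar x'" x', OF refl x'(1)]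
  have ex: "\<exists>Z. ess_lim Z y" if "y \<in> carrier (cstar x')" for y
    using sub that unfolding ess_closure_def by blast
  have "ext (y + y') = ext y + ext y'" if y: "y \<in> carrier (cstar x')" "y' \<in> carrier (cstar x')" for y y'
  proof (rule eq_matI)
    obtain Z Z' where Z: "ess_lim Z y" "ess_lim Z' y'" using ex y by blast
    fix i j assume "i < dim_row (ext y + ext y')" "j < dim_col (ext y + ext y')"
    then have ij: "i < n" "j < n" using ext_carrier[of y'] by auto
    have "(\<lambda>N. \<psi> (Z N) $$ (i, j) + \<psi> (Z' N) $$ (i, j)) \<longlonglongrightarrow> ext y $$ (i, j) + ext y' $$ (i, j)"
      by (intro tendsto_add ext_tendsto Z ij)
    moreover have eq: "\<psi> (Z N + Z' N) $$ (i, j) = \<psi> (Z N) $$ (i, j) + \<psi> (Z' N) $$ (i, j)" for N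
      using \<psi>_carrier[OF ess_lim_mem[OF Z(1), of N]] \<psi>_carrier[OF ess_lim_mem[OF Z(2), of N]] ij
      by (simp add: \<psi>_add ess_lim_mem[OF Z(1)] ess_lim_mem[OF Z(2)])
    ultimately have "ext (y + y') $$ (i, j) = ext y $$ (i, j) + ext y' $$ (i, j)"
      using LIMSEQ_unique[OF ext_tendsto[OF ess_lim_add[OF Z] ij, unfolded eq]] by blast
    then show "ext (y + y') $$ (i, j) = (ext y + ext y') $$ (i, j)"
      using ij ext_carrier[of y] ext_carrier[of y'] by simp
  qed (auto simp: ext_dim)
  moreover have "ext (cscale c y) = c \<cdot>\<^sub>m ext y" if y: "y \<in> carrier (cstar x')" for c y
  proof (rule eq_matI)
    obtain Z where Z: "ess_lim Z y" using ex y by blast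
    fix i j assume "i < dim_row (c \<cdot>\<^sub>m ext y)" "j < dim_col (c \<cdot>\<^sub>m ext y)"
    then have ij: "i < n" "j < n" using ext_carrier[of y] by auto
    have "(\<lambda>N. c * \<psi> (Z N) $$ (i, j)) \<longlonglongrightarrow> c * ext y $$ (i, j)"
      by (intro tendsto_mult_left ext_tendsto Z ij)
    moreover have eq: "\<psi> (cscale c (Z N)) $$ (i, j) = c * \<psi> (Z N) $$ (i, j)" for N
      using \<psi>_carrier[OF ess_lim_mem[OF Z, of N]] ij by (simp add: \<psi>_cscale ess_lim_mem[OF Z])
    ultimately have "ext (cscale c y) $$ (i, j) = c * ext y $$ (i, j)"
      using LIMSEQ_unique[OF ext_tendsto[OF ess_lim_cscale[OF Z, of c] ij, unfolded eq]] by blast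
    then show "ext (cscale c y) $$ (i, j) = (c \<cdot>\<^sub>m ext y) $$ (i, j)"
      using ij ext_carrier[of y] by simp
  qed (auto simp: ext_dim)
  ultimately have "ext \<in> linear_maps (cstar x') (matrix_alg n)"
    unfolding linear_maps_def by (auto simp: simps ext_carrier)
  moreover have "ext id_blinfun = 1\<^sub>m n"
  proof (rule eq_matI)
    fix i j assume "i < dim_row (1\<^sub>m n :: complex mat)" "j < dim_col (1\<^sub>m n :: complex mat)"
    then have ij: "i < n" "j < n" by auto
    have "(\<lambda>_. \<psi> id_blinfun $$ (i, j)) \<longlonglongrightarrow> ext id_blinfun $$ (i, j)"
      using ext_tendsto[OF ess_lim_const[OF id_mem clinear_zero tail_null_zero] ij] by simp
    then show "ext id_blinfun $$ (i, j) = 1\<^sub>m n $$ (i, j)"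
      using LIMSEQ_unique[OF tendsto_const] \<psi>_id by metis
  qed (auto simp: ext_dim)
  moreover have "completely_positive (cstar x') (matrix_alg n) ext"
  proof (rule completely_positive_matrixI)
    fix m y and V :: "nat \<Rightarrow> nat \<Rightarrow> complex"
    assume y: "positive_matrix (cstar x') m y"
    obtain b where b: "\<forall>i<m. \<forall>j<m. b i j \<in> carrier (cstar x')"
      "\<forall>i<m. \<forall>j<m. y i j = (\<Sum>k<m. adj_op (b k i) o\<^sub>L b k j)"
      using positive_matrix_cstar_ex[of "cstar x'" x' m y, OF refl x'(1) y] by (elim exE conjE) (rule that)
    have "\<exists>Z. ess_lim Z (b i j)" if "i < m" "j < m" for i j using ex b that by blast
    then obtain Z where Z: "\<And>i j. i < m \<Longrightarrow> j < m \<Longrightarrow> ess_lim (Z i j) (b i j)" by metis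
    define Y where "Y N i j = (\<Sum>k<m. adj_op (Z k i N) o\<^sub>L Z k j N)" for N i j
    have lim: "ess_lim (\<lambda>N. Y N i j) (y i j)" if "i < m" "j < m" for i j
      unfolding Y_def b(2)[rule_format, OF that]
      by (intro ess_lim_sum ess_lim_comp ess_lim_adj Z) (use that in auto)
    have nonneg: "(\<Sum>i<m. \<Sum>j<m. mform n (\<psi> (Y N i j)) (V i) (V j)) \<in> \<real>\<^sub>\<ge>\<^sub>0" for N
    proof -
      have "positive_matrix (cstar x) m (Y N)"
        unfolding Y_def by (rule positive_matrix_cstarI[OF clinear_x]) (use ess_lim_mem[OF Z] in auto)
      then have "positive_matrix (matrix_alg n) m (\<lambda>i j. \<psi> (Y N i j))"
        using ucp unfolding ucp_maps_def completely_positive_def by blast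
      from positive_matrixD[OF this] show ?thesis unfolding psd_blocks_def by blast
    qed
    have conv: "(\<lambda>N. \<Sum>i<m. \<Sum>j<m. mform n (\<psi> (Y N i j)) (V i) (V j)) \<longlonglongrightarrow>
        (\<Sum>i<m. \<Sum>j<m. mform n (ext (y i j)) (V i) (V j))"
      unfolding mform_def
      by (intro tendsto_sum tendsto_mult tendsto_const ext_tendsto lim) auto
    show "(\<Sum>i<m. \<Sum>j<m. mform n (ext (y i j)) (V i) (V j)) \<in> \<real>\<^sub>\<ge>\<^sub>0"
      by (rule Lim_in_closed_set[OF closed_nonneg_Reals_complex _ _ conv])
        (use nonneg in \<open>auto intro: always_eventually\<close>)
  qed (rule ext_carrier)
  ultimately show ?thesis unfolding ucp_maps_def by (simp add: simps)
qed

end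

text \<open>The constant sequence x k approximates x k + \<kappa> k modulo compacts, so the
  extension takes there the value that \<psi> takes at x k.\<close>

lemma ess_matrix_range_subset:
  assumes x: "\<And>k. clinear_ell2 (x k)" and \<kappa>: "\<And>k. clinear_ell2 (\<kappa> k)" "\<And>k. tail_null (\<kappa> k)"
  shows "ess_matrix_range_level n x \<subseteq> matrix_range_level n bounded_ops (\<lambda>k. x k + \<kappa> k)"
proof
  fix a assume "a \<in> ess_matrix_range_level n x"
  then obtain \<psi> where a: "a = (\<lambda>k. \<psi> (x k))" and ucp: "\<psi> \<in> ucp_maps (cstar x) (matrix_alg n)"
    and null: "\<forall>T \<in> carrier (cstar x) \<inter> compact_ops. \<psi> T = zero (matrix_alg n)"
    unfolding ess_matrix_range_level_def Let_def by blast
  interpret ucp_cstar x \<psi> n by unfold_locales (rule x, rule ucp)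
  interpret essential_ucp x \<psi> n
    by unfold_locales (use null mem_clinear in \<open>auto simp: compact_ops_iff\<close>)
  have lim: "ess_lim (\<lambda>_. x k) (x k + \<kappa> k)" for k by (rule ess_lim_const[OF mem_cstar[OF x] \<kappa>])
  have "ext \<in> ucp_maps (cstar (\<lambda>k. x k + \<kappa> k)) (matrix_alg n)"
    by (rule ext_ucp) (use lim in \<open>auto simp: clinear_add x \<kappa> ess_closure_def\<close>)
  moreover have "ext (x k + \<kappa> k) = \<psi> (x k)" for k
  proof (rule eq_matI)
    fix i j assume "i < dim_row (\<psi> (x k))" "j < dim_col (\<psi> (x k))"
    then have "i < n" "j < n" using \<psi>_carrier[OF mem_cstar[OF x], of k] by auto
    from ext_tendsto[OF lim this] show "ext (x k + \<kappa> k) $$ (i, j) = \<psi> (x k) $$ (i, j)"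
      by (rule LIMSEQ_unique[OF _ tendsto_const])
  qed (use \<psi>_carrier[OF mem_cstar[OF x], of k] in \<open>auto simp: ext_dim\<close>)
  ultimately show "a \<in> matrix_range_level n bounded_ops (\<lambda>k. x k + \<kappa> k)"
    unfolding matrix_range_level_def a by (intro CollectI exI[of _ ext]) auto
qed

section \<open>Smith-Ward geometry\<close>

text \<open>The form of the imaginary part is the imaginary part of the form of \<open>x\<close>, so
  its compressions to far coordinates have small norm; subtracting such a compression leaves a
  finite rank operator nearby.\<close>

lemma tail_null_skew_part:
  assumes x: "clinear_ell2 x"
    and im: "\<And>e. 0 < e \<Longrightarrow> \<exists>N. \<forall>v. norm v = 1 \<and> high N v = v \<longrightarrow> \<bar>Im (cinner_ell2 v (x v))\<bar> < e"
  shows "tail_null (x - adj_op x)"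
proof -
  define y where "y = cscale (- \<i> / 2) (x - adj_op x)"
  have yc: "clinear_ell2 y" unfolding y_def by (intro clinear_cscale clinear_diff clinear_adj x)
  have "adj_op y = y"
  proof -
    have "adj_op y = cscale (\<i> / 2) (adj_op x - x)"
      unfolding y_def by (simp add: adj_cscale adj_diff clinear_diff clinear_adj x adj_adj)
    also have "\<dots> = y" unfolding y_def
      by (rule blinfun_eqI, rule ell2_eqI) (simp add: cscale_apply blinfun.diff_left ell2_nth_simps algebra_simps)
    finally show ?thesis .
  qed
  then have ys: "selfadj y" by (intro selfadjI yc)
  have form: "inner v (y v) = Im (cinner_ell2 v (x v))" for v
  proof -
    have "cinner_ell2 v (adj_op x v) = cnj (cinner_ell2 v (x v))"
      by (metis cinner_adj_right[OF x] cinner_commute)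
    then show ?thesis
      by (simp add: inner_ell2_def y_def cscale_apply blinfun.diff_left cinner_scaleC_right cinner_diff_right)
  qed
  have "tail_null y"
  proof (rule tail_null_limit)
    fix e :: real assume e: "0 < e"
    then obtain N where N: "\<And>v. norm v = 1 \<Longrightarrow> high N v = v \<Longrightarrow> \<bar>Im (cinner_ell2 v (x v))\<bar> < e / 2"
      using im[of "e/2"] by auto
    let ?c = "high N o\<^sub>L y o\<^sub>L high N"
    have "norm ?c \<le> e / 2"
    proof (rule norm_selfadj_le)
      show "selfadj ?c" by (intro selfadj_sandwich selfadj_high ys)
      fix v
      define w where "w = high N v"
      have cw: "inner v (?c v) = inner w (y w)"
        using selfadj_inner[OF selfadj_high[of N], of v "y w"] by (simp add: w_def)
      have "\<bar>inner w (y w)\<bar> \<le> e / 2 * (norm w)\<^sup>2"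
      proof (cases "w = 0")
        case False
        define s where "s = inverse (norm w) *\<^sub>R w"
        have s: "norm s = 1" "high N s = s"
          using False by (simp_all add: s_def w_def blinfun.scaleR_right high_high)
        have ws: "w = norm w *\<^sub>R s" using False by (simp add: s_def)
        have "inner w (y w) = (norm w)\<^sup>2 * inner s (y s)"
          by (subst ws, subst (2) ws) (simp add: blinfun.scaleR_right power2_eq_square s(1))
        moreover have "\<bar>inner s (y s)\<bar> \<le> e / 2" using N[OF s] by (simp add: form)
        then have "(norm w)\<^sup>2 * \<bar>inner s (y s)\<bar> \<le> (norm w)\<^sup>2 * (e / 2)" by (intro mult_left_mono) auto
        ultimately show ?thesis by (simp add: abs_mult mult.commute)
      qed simp
      also have "\<dots> \<le> e / 2 * (norm v)\<^sup>2"
        using norm_high_apply_le[of N v] e unfolding w_def by (intro mult_left_mono power_mono) auto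
      finally show "\<bar>inner v (?c v)\<bar> \<le> e / 2 * (norm v)\<^sup>2" unfolding cw .
    qed (use e in simp)
    moreover have "tail_null (y - ?c)"
      using tail_null_scaleR[OF tail_null_compression[OF yc, of N], of "-1"] by simp
    ultimately show "\<exists>S. tail_null S \<and> norm (y - S) < e"
      using e by (intro exI[of _ "y - ?c"]) simp
  qed
  moreover have "x - adj_op x = cscale (2 * \<i>) y"
    unfolding y_def by (rule blinfun_eqI) (simp add: cscale_apply scaleC_simps)
  ultimately show ?thesis by (simp add: tail_null_cscale)
qed

text \<open>Translation by an interior point turns each half-space containing \<open>K\<close> into
  a form inequality with right-hand side 1, the shape that the iterative correction handles.
  Replacing the operators by their real parts costs only a compact perturbation.\<close>

lemma smith_ward_geometry_max:
  fixes K :: "(real ^ 'd::finite) set"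
  assumes K: "compact K" "convex K" and int: "interior K \<noteq> {}"
  shows "smith_ward_geometry (max_matrix_set K)"
  unfolding smith_ward_geometry_def
proof (intro conjI allI impI)
  have K0: "K \<noteq> {}" using int interior_subset by blast
  show "compact_matrix_convex (max_matrix_set K)" by (rule compact_matrix_convex_max[OF K K0])
  fix x :: "'d \<Rightarrow> ell2 \<Rightarrow>\<^sub>L ell2"
  assume H: "(\<forall>i. x i \<in> carrier bounded_ops) \<and> ess_matrix_range x = max_matrix_set K"
  then have x: "clinear_ell2 (x k)" for k by simp
  have near: "\<exists>N. \<forall>v. norm v = 1 \<and> high N v = v \<longrightarrow>
    (\<exists>p\<in>K. \<forall>k. cmod (cinner_ell2 v (x k v) - complex_of_real (vec_nth p k)) < e)" if "0 < e" for e
    using essential_forms_near[of x, OF x K K0 _ that] H by blast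
  have skew: "tail_null (x k - adj_op (x k))" for k
  proof (rule tail_null_skew_part[OF x])
    fix e :: real assume "0 < e"
    from near[OF this] obtain N where N: "\<forall>v. norm v = 1 \<and> high N v = v \<longrightarrow>
      (\<exists>p\<in>K. \<forall>k. cmod (cinner_ell2 v (x k v) - complex_of_real (vec_nth p k)) < e)" ..
    have "\<bar>Im (cinner_ell2 v (x k v))\<bar> < e" if v: "norm v = 1 \<and> high N v = v" for v
    proof -
      obtain p where "cmod (cinner_ell2 v (x k v) - complex_of_real (vec_nth p k)) < e"
        using N v by blast
      then show ?thesis using abs_Im_le_cmod[of "cinner_ell2 v (x k v) - complex_of_real (vec_nth p k)"] by simp
    qed
    then show "\<exists>N. \<forall>v. norm v = 1 \<and> high N v = v \<longrightarrow> \<bar>Im (cinner_ell2 v (x k v))\<bar> < e" by blast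
  qed
  define X where "X k = (1/2) *\<^sub>R (x k + adj_op (x k))" for k
  have Xs: "selfadj (X k)" for k
    unfolding X_def by (intro selfadj_scaleR selfadjI clinear_add clinear_adj x)
      (simp add: adj_add clinear_adj x adj_adj add.commute)
  have Xform: "inner v (X k v) = Re (cinner_ell2 v (x k v))" for v k
    using cinner_adj_right[OF x, of v k v] cinner_commute[of v "x k v"]
    by (simp add: X_def inner_ell2_def blinfun.bilinear_simps cinner_scaleR_right cinner_add_right)
  have Xx: "tail_null (X k - x k)" for k
  proof -
    have "X k - x k = (-1/2) *\<^sub>R (x k - adj_op (x k))"
      unfolding X_def by (rule blinfun_eqI, rule ell2_eqI) (simp add: blinfun.bilinear_simps ell2_nth_simps field_simps)
    then show ?thesis by (simp only: tail_null_scaleR[OF skew])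
  qed
  obtain p0 where "p0 \<in> interior K" using int by blast
  then obtain r where r: "0 < r" "cball p0 r \<subseteq> K" unfolding mem_interior_cball by blast
  have "bounded K" by (rule compact_imp_bounded[OF K(1)])
  then obtain R0 where R0: "\<And>q. q \<in> K \<Longrightarrow> norm q \<le> R0" unfolding bounded_iff by blast
  \<comment> \<open>Bounds the coordinates of q - p0 for q in \<open>K\<close>, which puts plus and
    minus the unit vectors divided by \<open>R\<close> into the polar; the summand 1 makes it
    positive.\<close>
  define R where "R = \<bar>R0\<bar> + norm p0 + 1"
  have R: "0 < R" by (simp add: R_def add_nonneg_pos)
  \<comment> \<open>The polar of \<open>K\<close> translated by - p0. The ball of radius
    \<open>r\<close> inside \<open>K\<close> bounds it by 1 / r, which makes the tail estimate
    uniform in \<open>u\<close>.\<close>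
  define Q where "Q = {u. \<forall>q\<in>K. inner u (q - p0) \<le> 1}"
  have Qr: "norm u * r \<le> 1" if "u \<in> Q" for u
  proof (cases "u = 0")
    case False
    have "p0 + (r / norm u) *\<^sub>R u \<in> K" using r False by (intro subsetD[OF r(2)]) (simp add: dist_norm)
    then have "inner u ((r / norm u) *\<^sub>R u) \<le> 1" using that unfolding Q_def by fastforce
    then show ?thesis using False by (simp add: power2_norm_eq_inner[symmetric] power2_eq_square mult.commute)
  qed simp
  have ax: "axis k (1/R) \<in> Q" "axis k (-1/R) \<in> Q" for k
  proof -
    have "\<bar>vec_nth (q - p0) k\<bar> \<le> R" if "q \<in> K" for q
      using R0[OF that] component_le_norm_cart[of "q - p0" k] norm_triangle_ineq4[of q p0] unfolding R_def by linarith
    then show "axis k (1/R) \<in> Q" "axis k (-1/R) \<in> Q"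
      unfolding Q_def using R by (auto simp: inner_axis' field_simps abs_le_iff)
  qed
  define S where "S k = X k - vec_nth p0 k *\<^sub>R id_blinfun" for k
  have Ss: "selfadj (S k)" for k unfolding S_def by (intro selfadj_diff selfadj_scaleR selfadj_id Xs)
  have shift: "lin_form u (\<lambda>k. T k + vec_nth p0 k *\<^sub>R id_blinfun) v = lin_form u T v + inner u p0 * (norm v)\<^sup>2" for u T v
    by (simp add: lin_form_def blinfun.bilinear_simps inner_add_right distrib_left sum.distrib inner_vec_def
        power2_norm_eq_inner sum_distrib_right mult.assoc)
  have "tail_bound Q S"
    unfolding tail_bound_def
  proof (intro allI impI)
    fix e :: real assume e: "0 < e"
    \<comment> \<open>The factor \<open>r\<close> compensates the bound 1 / r for the elements of
      \<open>Q\<close>, and the number of coordinates compensates the summation; the total error is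
      at most \<open>e\<close>.\<close>
    define d where "d = e * r / real CARD('d)"
    have d: "0 < d" using e r by (simp add: d_def)
    from near[OF d] obtain N where N: "\<forall>v. norm v = 1 \<and> high N v = v \<longrightarrow>
      (\<exists>p\<in>K. \<forall>k. cmod (cinner_ell2 v (x k v) - complex_of_real (vec_nth p k)) < d)" ..
    have unit: "lin_form u S v \<le> 1 + e" if u: "u \<in> Q" and v: "norm v = 1" "high N v = v" for u v
    proof -
      obtain p where p: "p \<in> K" "\<And>k. cmod (cinner_ell2 v (x k v) - complex_of_real (vec_nth p k)) < d"
        using N v by blast
      have "vec_nth u k * inner v (S k v) \<le> vec_nth u k * (vec_nth p k - vec_nth p0 k) + norm u * d" for k
      proof -
        define \<delta> where "\<delta> = Re (cinner_ell2 v (x k v)) - vec_nth p k"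
        have "\<bar>\<delta>\<bar> \<le> d"
          using p(2)[of k] abs_Re_le_cmod[of "cinner_ell2 v (x k v) - complex_of_real (vec_nth p k)"] by (simp add: \<delta>_def)
        then have "\<bar>vec_nth u k\<bar> * \<bar>\<delta>\<bar> \<le> norm u * d" by (intro mult_mono component_le_norm_cart) auto
        then have "vec_nth u k * \<delta> \<le> norm u * d" by (metis abs_le_D1 abs_mult)
        moreover have "inner v (S k v) = vec_nth p k - vec_nth p0 k + \<delta>"
          using v(1) by (simp add: S_def blinfun.bilinear_simps inner_diff_right Xform \<delta>_def power2_norm_eq_inner[symmetric])
        ultimately show ?thesis by (simp add: distrib_left)
      qed
      then have "lin_form u S v \<le> (\<Sum>k\<in>UNIV. vec_nth u k * (vec_nth p k - vec_nth p0 k) + norm u * d)"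
        unfolding lin_form_def by (intro sum_mono)
      also have "\<dots> = inner u (p - p0) + real CARD('d) * (norm u * d)"
        by (simp add: sum.distrib inner_vec_def)
      also have "real CARD('d) * (norm u * d) = e * (norm u * r)" by (simp add: d_def)
      also have "\<dots> \<le> e * 1" using Qr[OF u] e by (intro mult_left_mono) auto
      also have "inner u (p - p0) + e * 1 \<le> 1 + e" using u p(1) unfolding Q_def by auto
      finally show ?thesis by simp
    qed
    have "lin_form u S v \<le> (1 + e) * (norm v)\<^sup>2" if u: "u \<in> Q" and v: "high N v = v" for u v
    proof (cases "v = 0")
      case False
      define s where "s = inverse (norm v) *\<^sub>R v"
      have s: "norm s = 1" "high N s = s" using False v by (simp_all add: s_def blinfun.scaleR_right)
      have vs: "v = norm v *\<^sub>R s" using False by (simp add: s_def)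
      have "inner v (S k v) = (norm v)\<^sup>2 * inner s (S k s)" for k
        by (subst vs, subst (2) vs) (simp add: blinfun.scaleR_right power2_eq_square s(1))
      then have "lin_form u S v = (norm v)\<^sup>2 * lin_form u S s"
        by (simp add: lin_form_def sum_distrib_left mult.left_commute)
      also have "\<dots> \<le> (norm v)\<^sup>2 * (1 + e)" by (intro mult_left_mono unit u s) simp
      finally show ?thesis by (simp add: mult.commute)
    qed (simp add: lin_form_def)
    then show "\<exists>N. \<forall>u\<in>Q. \<forall>v. high N v = v \<longrightarrow> lin_form u S v \<le> (1 + e) * (norm v)\<^sup>2" by blast
  qed
  from compact_correction[of S, OF Ss this R ax] obtain L where
    L0: "\<forall>k. selfadj (L k) \<and> tail_null (L k - S k)" and L1: "form_bound Q 0 L"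
    by (elim exE conjE) (rule that)
  define x' where "x' k = L k + vec_nth p0 k *\<^sub>R id_blinfun" for k
  have x's: "selfadj (x' k)" for k unfolding x'_def using L0 by (intro selfadj_add selfadj_scaleR selfadj_id) auto
  define \<kappa> where "\<kappa> k = x' k - x k" for k
  have \<kappa>c: "clinear_ell2 (\<kappa> k)" for k unfolding \<kappa>_def by (intro clinear_diff selfadj_clinear x's x)
  have \<kappa>t: "tail_null (\<kappa> k)" for k
  proof -
    have "\<kappa> k = (L k - S k) + (X k - x k)" by (simp add: \<kappa>_def x'_def S_def)
    then show ?thesis using L0 Xx tail_null_add by metis
  qed
  have half: "lin_form u x' v \<le> c * (norm v)\<^sup>2" if uc: "\<And>q. q \<in> K \<Longrightarrow> inner u q \<le> c" for u c v
  proof (cases "u = 0")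
    case True
    obtain q where "q \<in> K" using K0 by blast
    from uc[OF this] True show ?thesis by (simp add: lin_form_def)
  next
    case False
    \<comment> \<open>The bound of the half-space as seen from \<open>p0\<close>. It is positive
      because \<open>K\<close> contains a ball about \<open>p0\<close>, so u / c' lies in the
      polar.\<close>
    define c' where "c' = c - inner u p0"
    have "p0 + (r / norm u) *\<^sub>R u \<in> K" using r False by (intro subsetD[OF r(2)]) (simp add: dist_norm)
    from uc[OF this] have "norm u * r \<le> c'"
      using False by (simp add: c'_def inner_add_right power2_norm_eq_inner[symmetric] power2_eq_square mult.commute)
    moreover have "0 < norm u * r" using False r by simp
    ultimately have c': "0 < c'" by linarith
    have "inner ((1/c') *\<^sub>R u) (q - p0) \<le> 1" if "q \<in> K" for q
    proof -
      have "inner u (q - p0) \<le> c'" using uc[OF that] by (simp add: c'_def inner_diff_right)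
      then show ?thesis using c' by simp
    qed
    then have "(1/c') *\<^sub>R u \<in> Q" unfolding Q_def by blast
    then have "lin_form ((1/c') *\<^sub>R u) L v \<le> (norm v)\<^sup>2" using L1 unfolding form_bound_def by fastforce
    moreover have "lin_form ((1/c') *\<^sub>R u) L v = lin_form u L v / c'"
      by (simp add: lin_form_def sum_divide_distrib)
    ultimately have "lin_form u L v \<le> c' * (norm v)\<^sup>2" using c' by (simp add: field_simps)
    then show ?thesis unfolding x'_def shift by (simp add: c'_def algebra_simps)
  qed
  have xx: "(\<lambda>k. x k + \<kappa> k) = x'" by (simp add: \<kappa>_def)
  have "matrix_range_level n bounded_ops x' = ess_matrix_range_level n x" if n: "1 \<le> n" for n
  proof
    show "ess_matrix_range_level n x \<subseteq> matrix_range_level n bounded_ops x'"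
      using ess_matrix_range_subset[of x \<kappa>, OF x \<kappa>c \<kappa>t] unfolding xx .
    \<comment> \<open>The form inequalities place every such tuple in the maximal matrix convex set
      of \<open>K\<close>, which by assumption is the essential matrix range.\<close>
    show "matrix_range_level n bounded_ops x' \<subseteq> ess_matrix_range_level n x"
    proof
      fix a assume "a \<in> matrix_range_level n bounded_ops x'"
      then obtain \<psi> where a: "a = (\<lambda>k. \<psi> (x' k))" and \<psi>: "\<psi> \<in> ucp_maps (cstar x') (matrix_alg n)"
        unfolding matrix_range_level_def by blast
      have "a k \<in> carrier_mat n n" for k
        unfolding a by (rule ucp_carrier[OF \<psi> mem_cstar[OF selfadj_clinear[OF x's]]])
      moreover have "forms_in n K a" unfolding a by (rule ucp_forms_in[OF K x's half \<psi>])
      ultimately have "(n, a) \<in> max_matrix_set K" using max_matrix_set_iff[OF K K0] n by blast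
      then show "a \<in> ess_matrix_range_level n x" using H by (auto simp: ess_matrix_range_def)
    qed
  qed
  then have "ess_matrix_range x = matrix_range bounded_ops x'"
    unfolding ess_matrix_range_def matrix_range_def by (intro Sigma_cong) auto
  then show "smith_ward_property x"
    unfolding smith_ward_property_def using \<kappa>c \<kappa>t
    by (intro exI[of _ \<kappa>]) (simp add: compact_ops_iff xx)
qed

theorem theorem3p3:
  fixes K :: "(real ^ 2) set"
  assumes "compact K" and "convex K" and "interior K \<noteq> {}"
    and "ellipse (frontier K)"
  shows "smith_ward_geometry (max_matrix_set K)"
  using assms(1-3) by (rule smith_ward_geometry_max)

end
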